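(* Let $G$ be an amenable locally compact group, $1<p<\infty$, and let $q$ be the conjugate exponent of $p$ ($1/p+1/q=1$). Then $$L^1(G,\omega_q)\cap L^p(G)^+=L_p^{T}(G)^+ .$$
   Context: $\lambda$ is a fixed left Haar measure on $G$ (written $dx$), $L^p(G)$ is taken with respect to $\lambda$, and $\Delta$ is the modular function, with the convention $\lambda(Ex)=\Delta(x)\lambda(E)$. Functions are identified when equal almost everywhere. For measurable $f,g$ the convolution is $f*g(x)=\int_G f(y)g(y^{-1}x)\,d\lambda(y)$; $f*g$ is said to exist if the integrand is $\lambda$-integrable in $y$ for almost all $x\in G$. For $1<p<\infty$, $L_p^T(G)$ is the set of all $f\in L^p(G)$ such that $g*f$ exists for all $g\in L^p(G)$ and $\|f\|_p^T=\sup\{\|g*f\|_p: g\in L^p(G),\ \|g\|_p\le 1\}<\infty$. The weight is $\omega_q=\Delta^{-1/q}$, and $L^1(G,\omega_q)$ is the set of all complex-valued measurable functions $f$ on $G$ with $f\omega_q\in L^1(G)$. The superscript $+$ denotes the subset of nonnegative real-valued functions (almost everywhere) in the given space. *)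

theory Defs
  imports "HOL-Analysis.Analysis"
begin

text \<open>
  Groups are written additively: \<^class>\<open>group_add\<close> does not assume commutativity, so
  \<^class>\<open>topological_group_add\<close> is the class of all topological groups.  Thus \<open>x + y\<close> stands for
  the product \<open>x y\<close> and \<open>- x\<close> for the inverse of \<open>x\<close>, and the order of summands matters.

  Measurable means Borel measurable.  The function spaces below are sets of Borel functions, closed
  under almost everywhere equality of Borel functions; an equation between two such sets is the
  same as the equation between the corresponding sets of equivalence classes.
\<close>

text \<open>
  No countability assumption is made on the group, so the measure need not be sigma-finite:
  outer regularity holds for all Borel sets, inner regularity for open sets.
\<close>

definition left_haar_measure :: "'a::{topological_group_add, t2_space} measure \<Rightarrow> bool" where
  "left_haar_measure M \<longleftrightarrow>
     sets M = sets borel \<and>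
     emeasure M UNIV \<noteq> 0 \<and>
     (\<forall>K. compact K \<longrightarrow> emeasure M K < \<infinity>) \<and>
     (\<forall>A\<in>sets borel. emeasure M A = (INF U\<in>{U. open U \<and> A \<subseteq> U}. emeasure M U)) \<and>
     (\<forall>U. open U \<longrightarrow> emeasure M U = (SUP K\<in>{K. compact K \<and> K \<subseteq> U}. emeasure M K)) \<and>
     (\<forall>x. \<forall>A\<in>sets borel. emeasure M ((\<lambda>y. x + y) ` A) = emeasure M A)"

definition modular_function :: "'a::{topological_group_add, t2_space} measure \<Rightarrow> 'a \<Rightarrow> real" where
  "modular_function M x =
     (THE d. 0 < d \<and>
        (\<forall>E\<in>sets borel. emeasure M ((\<lambda>y. y + x) ` E) = ennreal d * emeasure M E))"

text \<open>
  \<open>L\<^sup>\<infinity>\<close> is taken modulo locally null sets, so that it is the dual of \<open>L\<^sup>1\<close> also for groups that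
  are not sigma-compact.
\<close>

definition locally_AE :: "'a measure \<Rightarrow> ('a \<Rightarrow> bool) \<Rightarrow> bool" where
  "locally_AE M P \<longleftrightarrow> (\<forall>A\<in>sets M. emeasure M A < \<infinity> \<longrightarrow> (AE x in M. x \<in> A \<longrightarrow> P x))"

definition Linfty :: "'a measure \<Rightarrow> ('a \<Rightarrow> complex) set" where
  "Linfty M = {f \<in> borel_measurable M. \<exists>C. locally_AE M (\<lambda>x. norm (f x) \<le> C)}"

text \<open>
  Positivity together with additivity makes a mean constant on classes of locally almost
  everywhere equal functions.
\<close>

definition left_invariant_mean ::
    "'a::{topological_group_add, t2_space} measure \<Rightarrow> (('a \<Rightarrow> complex) \<Rightarrow> complex) \<Rightarrow> bool" where
  "left_invariant_mean M m \<longleftrightarrow>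
     (\<forall>f\<in>Linfty M. \<forall>g\<in>Linfty M. m (\<lambda>x. f x + g x) = m f + m g) \<and>
     (\<forall>c. \<forall>f\<in>Linfty M. m (\<lambda>x. c * f x) = c * m f) \<and>
     (\<forall>f\<in>Linfty M. locally_AE M (\<lambda>x. f x \<in> \<real>\<^sub>\<ge>\<^sub>0) \<longrightarrow> m f \<in> \<real>\<^sub>\<ge>\<^sub>0) \<and>
     m (\<lambda>_. 1) = 1 \<and>
     (\<forall>x. \<forall>f\<in>Linfty M. m (\<lambda>y. f (- x + y)) = m f)"

text \<open>
  As left Haar measures are unique up to a factor, amenability does not depend on the choice of
  the left Haar measure \<open>M\<close>.
\<close>

definition amenable :: "'a::{topological_group_add, t2_space} measure \<Rightarrow> bool" where
  "amenable M \<longleftrightarrow> (\<exists>m. left_invariant_mean M m)"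

definition Lp :: "'a measure \<Rightarrow> real \<Rightarrow> ('a \<Rightarrow> complex) set" where
  "Lp M p = {f \<in> borel_measurable M. integrable M (\<lambda>x. norm (f x) powr p)}"

definition Lp_norm :: "'a measure \<Rightarrow> real \<Rightarrow> ('a \<Rightarrow> complex) \<Rightarrow> ennreal" where
  "Lp_norm M p f =
     (if f \<in> Lp M p then ennreal ((\<integral>x. norm (f x) powr p \<partial>M) powr (1 / p)) else \<infinity>)"

definition conv_exists ::
    "'a::{topological_group_add, t2_space} measure \<Rightarrow> ('a \<Rightarrow> complex) \<Rightarrow> ('a \<Rightarrow> complex) \<Rightarrow> bool" where
  "conv_exists M f g \<longleftrightarrow> (AE x in M. integrable M (\<lambda>y. f y * g (- y + x)))"

definition conv ::
    "'a::{topological_group_add, t2_space} measure \<Rightarrow> ('a \<Rightarrow> complex) \<Rightarrow> ('a \<Rightarrow> complex) \<Rightarrow> 'a \<Rightarrow> complex" where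
  "conv M f g x = (\<integral>y. f y * g (- y + x) \<partial>M)"

definition T_norm ::
    "'a::{topological_group_add, t2_space} measure \<Rightarrow> real \<Rightarrow> ('a \<Rightarrow> complex) \<Rightarrow> ennreal" where
  "T_norm M p f = (SUP g\<in>{g \<in> Lp M p. Lp_norm M p g \<le> 1}. Lp_norm M p (conv M g f))"

definition LpT :: "'a::{topological_group_add, t2_space} measure \<Rightarrow> real \<Rightarrow> ('a \<Rightarrow> complex) set" where
  "LpT M p = {f \<in> Lp M p. (\<forall>g\<in>Lp M p. conv_exists M g f) \<and> T_norm M p f < \<infinity>}"

definition omega :: "'a::{topological_group_add, t2_space} measure \<Rightarrow> real \<Rightarrow> 'a \<Rightarrow> real" where
  "omega M q x = modular_function M x powr (- 1 / q)"

definition L1_weighted :: "'a measure \<Rightarrow> ('a \<Rightarrow> real) \<Rightarrow> ('a \<Rightarrow> complex) set" where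
  "L1_weighted M w = {f \<in> borel_measurable M. (\<lambda>x. f x * complex_of_real (w x)) \<in> Lp M 1}"

definition nonneg_part :: "'a measure \<Rightarrow> ('a \<Rightarrow> complex) set \<Rightarrow> ('a \<Rightarrow> complex) set" where
  "nonneg_part M S = {f \<in> S. AE x in M. f x \<in> \<real>\<^sub>\<ge>\<^sub>0}"

end

theory Submission
  imports Defs
begin

text \<open>
  The convolution \<open>g * f\<close> is the integral of the translates \<open>\<Delta>(y)\<^sup>-\<^sup>1\<^sup>/\<^sup>p g(\<cdot> y\<^sup>-\<^sup>1)\<close>, which have the
  same \<open>L\<^sup>p\<close> norm as \<open>g\<close>, against the measure \<open>f \<omega>\<^sub>q d\<lambda>\<close>.  Hence \<open>f \<omega>\<^sub>q \<in> L\<^sup>1\<close> suffices for \<open>f\<close> to be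
  a bounded right convolver.

  Conversely, let \<open>f \<ge> 0\<close> be a bounded convolver.  Truncating \<open>f\<close> to a bounded function of compact
  support and applying the inversion of the group, one has to show that the norm on \<open>L\<^sup>p\<close> of the
  operator \<open>F \<mapsto> \<integral>F(t \<cdot>) d\<mu>(t)\<close>, with \<open>\<mu>\<close> a probability measure of compact support, is at least \<open>1\<close>
  on an amenable group.  Suppose that it is less than \<open>1\<close>.  Combining this operator with its
  reflection and with convolution by a symmetric continuous kernel \<open>b\<close> gives an averaging operator
  \<open>P\<close>, still of norm less than \<open>1\<close>, all of whose translations cancel in the abelianisation.  For
  some \<open>r > 1\<close> the Green function \<open>U = \<Sum>\<^sub>n r\<^sup>n P\<^sup>n b\<close> is finite; it satisfies \<open>r P U \<le> U\<close> and, thanks to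
  the kernel, a Harnack inequality.  By Jensen's inequality \<open>\<psi> = ln U\<close> satisfies \<open>ln r + P \<psi> \<le> \<psi>\<close>,
  and its increments \<open>\<psi>(y \<cdot>) - \<psi>\<close> are bounded.  An invariant mean sends these increments to a
  homomorphism into the reals, so it sends \<open>P \<psi> - \<psi>\<close> to \<open>0\<close>, which contradicts \<open>P \<psi> - \<psi> \<le> - ln r\<close>.
\<close>

subsection \<open>Continuous functions with compact support\<close>

text \<open>Two obstacles shape the text. Haar measure need not be sigma-finite and Borel sets of
  the product need not lie in the product sigma-algebra, so neither the exchange of integrals nor
  the measurability of a convolution comes for free. Both are proved for continuous functions of
  compact support and then carried to functions that vanish off a sigma-finite set, as all functions
  in \<open>Lp\<close> do. Inversion may turn a null set into one that is only locally null; hence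
  the conditions on supports wherever it is used.

  In the converse, amenability enters only through a mean on bounded continuous functions; no almost
  invariant vectors are constructed. \<open>\<psi>\<close> may be unbounded, so the mean acts on its
  increments only, and the Harnack inequality is what bounds them. The reflection cancels the drift
  of \<open>\<mu>\<close>; it need not contract strictly, because averages never increase the norm.
  The Harnack inequality relates only points that the walk can connect, so \<open>U\<close> may
  vanish off an open subgroup, and it has to be replaced coset by coset before its logarithm is
  taken.\<close>

definition cc :: "('a::topological_space \<Rightarrow> real) \<Rightarrow> bool" where
  "cc f \<longleftrightarrow> continuous_on UNIV f \<and> (\<exists>K. compact K \<and> (\<forall>x. x \<notin> K \<longrightarrow> f x = 0))"

lemma continuous_on_compose_curry:
  assumes "continuous_on UNIV (\<lambda>(x,y). f x y)" "continuous_on A g" "continuous_on A h"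
  shows "continuous_on A (\<lambda>z. f (g z) (h z))"
  using continuous_on_compose2[OF assms(1), of A "\<lambda>z. (g z, h z)"] assms(2,3)
  by (auto intro!: continuous_intros)

lemma cc_continuous: "cc f \<Longrightarrow> continuous_on UNIV f"
  by (simp add: cc_def)

lemma ccE:
  assumes "cc f"
  obtains K where "compact K" "\<And>x. x \<notin> K \<Longrightarrow> f x = 0"
  using assms by (auto simp: cc_def)

lemma ccI: "continuous_on UNIV f \<Longrightarrow> compact K \<Longrightarrow> (\<And>x. x \<notin> K \<Longrightarrow> f x = 0) \<Longrightarrow> cc f"
  by (auto simp: cc_def)

lemma cc_bounded:
  assumes "cc f" obtains B where "B > 0" "\<And>x. \<bar>f x\<bar> \<le> B"
proof -
  obtain K where K: "compact K" "\<And>x. x \<notin> K \<Longrightarrow> f x = 0" using ccE[OF assms] by metis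
  have "compact (f ` K)"
    using K(1) cc_continuous[OF assms] by (meson compact_continuous_image continuous_on_subset subset_UNIV)
  then obtain B where B: "\<And>y. y \<in> f ` K \<Longrightarrow> norm y \<le> B"
    using compact_imp_bounded bounded_iff by metis
  have "\<bar>f x\<bar> \<le> max B 1" for x using B[of "f x"] K(2)[of x] by (cases "x \<in> K") auto
  then show thesis by (intro that[of "max B 1"]) auto
qed

lemma cc_mult_left: "cc f \<Longrightarrow> continuous_on UNIV g \<Longrightarrow> cc (\<lambda>x. g x * f x)"
  unfolding cc_def by (auto intro!: continuous_intros)

lemma cc_cmult: "cc f \<Longrightarrow> cc (\<lambda>x. c * f x)"
  by (rule cc_mult_left) auto

lemma cc_mult_right: "cc f \<Longrightarrow> continuous_on UNIV g \<Longrightarrow> cc (\<lambda>x. f x * g x)"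
  using cc_mult_left[of f g] by (simp add: mult.commute)

lemma cc_zero: "cc (\<lambda>_. 0)"
  by (rule ccI[of _ "{}"]) auto

lemma cc_add:
  assumes "cc f" "cc g" shows "cc (\<lambda>x. f x + g x)"
proof -
  obtain K where K: "compact K" "\<And>x. x \<notin> K \<Longrightarrow> f x = 0" using ccE[OF assms(1)] by metis
  obtain L where L: "compact L" "\<And>x. x \<notin> L \<Longrightarrow> g x = 0" using ccE[OF assms(2)] by metis
  show ?thesis
    by (rule ccI[of _ "K \<union> L"]) (use K L in \<open>auto intro!: continuous_intros assms[THEN cc_continuous]\<close>)
qed

lemma cc_powr:
  assumes "cc f" "\<And>x. 0 \<le> f x" "0 < p" shows "cc (\<lambda>x. f x powr p)"
proof -
  obtain K where K: "compact K" "\<And>x. x \<notin> K \<Longrightarrow> f x = 0" using ccE[OF assms(1)] by metis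
  show ?thesis
    by (rule ccI[OF _ K(1)])
      (use K assms in \<open>auto intro!: continuous_on_powr' assms(1)[THEN cc_continuous]\<close>)
qed

lemma borel_measurable_cc: "cc f \<Longrightarrow> f \<in> borel_measurable borel"
  by (intro borel_measurable_continuous_onI cc_continuous)

lemma integrable_cc:
  fixes f :: "'a::t2_space \<Rightarrow> real"
  assumes f: "cc f" and M: "sets M = sets borel" "\<And>K. compact K \<Longrightarrow> emeasure M K < \<infinity>"
  shows "integrable M f"
proof -
  obtain K where K: "compact K" "\<And>x. x \<notin> K \<Longrightarrow> f x = 0" using ccE[OF f] by metis
  obtain B where B: "\<And>x. \<bar>f x\<bar> \<le> B" using cc_bounded[OF f] by metis
  have Ks: "K \<in> sets M" using M(1) K(1) borel_compact by auto
  have "integrable M (\<lambda>x. indicator K x * B)"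
    using Ks M(2)[OF K(1)] by (intro integrable_mult_left) (auto simp: integrable_indicator_iff)
  moreover have "f \<in> borel_measurable M"
    using borel_measurable_cc[OF f] M(1) by (simp cong: measurable_cong_sets)
  ultimately show ?thesis
    by (rule Bochner_Integration.integrable_bound)
      (use B K(2) order_trans[OF abs_ge_zero B] in \<open>auto simp: indicator_def intro!: AE_I2\<close>)
qed

text \<open>
  The group need not be second countable, so Borel sets of the product need not lie in the product
  of the Borel sigma-algebras; compact support makes the function a uniform limit of measurable ones.
\<close>

lemma borel_measurable_compact_support_pair:
  fixes f :: "'a::t2_space \<Rightarrow> 'b::t2_space \<Rightarrow> real"
  assumes f: "continuous_on UNIV (\<lambda>(x,y). f x y)" and K: "compact K" "compact L"
    and 0: "\<And>x y. x \<notin> K \<or> y \<notin> L \<Longrightarrow> f x y = 0"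
  shows "(\<lambda>(x,y). f x y) \<in> borel_measurable (borel \<Otimes>\<^sub>M borel)"
proof -
  have appr: "\<exists>g. g \<in> borel_measurable (borel \<Otimes>\<^sub>M borel) \<and> (\<forall>x y. \<bar>f x y - g (x,y)\<bar> \<le> e)" if e: "e > 0" for e
  proof -
    \<comment> \<open>By compactness of \<open>K\<close>, the slices \<open>f _ y\<close> stay
      uniformly close to \<open>f _ y0\<close> for \<open>y\<close> near \<open>y0\<close>. Finitely
      many slices, selected by Borel conditions on \<open>y\<close> alone, therefore approximate
      \<open>f\<close>, and such a function is measurable for the product sigma-algebra.\<close>
    have "\<exists>V. y0 \<in> V \<and> open V \<and> (\<forall>y\<in>V. \<forall>x\<in>K. dist (f x y) (f x y0) \<le> e)" for y0
    proof -
      have "continuous_on (UNIV \<times> K) (\<lambda>(y,x). f x y)"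
        unfolding case_prod_beta by (rule continuous_on_compose_curry[OF f]) (auto intro!: continuous_intros)
      from continuous_on_prod_compactE[OF this K(1) UNIV_I e, of y0] show ?thesis by (metis Int_UNIV_right prod.case)
    qed
    then obtain V where V: "\<And>y. y \<in> V y \<and> open (V y) \<and> (\<forall>z\<in>V y. \<forall>x\<in>K. dist (f x z) (f x y) \<le> e)"
      by metis
    obtain I where I: "finite I" "L \<subseteq> (\<Union>i\<in>I. V i)"
      using compactE_image[OF K(2), of L V] V by (metis UN_I subsetI)
    have fx: "(\<lambda>z. f (fst z) i) \<in> borel_measurable (borel \<Otimes>\<^sub>M borel)" for i
    proof -
      have "continuous_on UNIV (\<lambda>x. f x i)"
        by (rule continuous_on_compose_curry[OF f]) (auto intro!: continuous_intros)
      from borel_measurable_continuous_onI[OF this] show ?thesis by measurable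
    qed
    have "\<exists>g. g \<in> borel_measurable (borel \<Otimes>\<^sub>M borel) \<and> (\<forall>x\<in>K. \<forall>y\<in>(\<Union>i\<in>I. V i). \<bar>f x y - g (x,y)\<bar> \<le> e)"
      using I(1)
    proof induction
      case empty then show ?case by (auto intro: exI[of _ "\<lambda>_. 0"])
    next
      case (insert i I)
      then obtain g where g[measurable]: "g \<in> borel_measurable (borel \<Otimes>\<^sub>M borel)"
        and g2: "\<And>x y. x\<in>K \<Longrightarrow> y\<in>(\<Union>i\<in>I. V i) \<Longrightarrow> \<bar>f x y - g (x,y)\<bar> \<le> e" by auto
      note fx[measurable]
      have [measurable]: "V i \<in> sets borel" using V by auto
      have "(\<lambda>z. if snd z \<in> V i then f (fst z) i else g z) \<in> borel_measurable (borel \<Otimes>\<^sub>M borel)"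
        by measurable
      moreover have "\<bar>f x y - (if snd (x,y) \<in> V i then f (fst (x,y)) i else g (x,y))\<bar> \<le> e"
        if "x \<in> K" "y \<in> (\<Union>i\<in>insert i I. V i)" for x y
        using V[of i] that g2[of x y] by (auto simp: dist_real_def)
      ultimately show ?case by blast
    qed
    then obtain g where g[measurable]: "g \<in> borel_measurable (borel \<Otimes>\<^sub>M borel)"
        and g2: "\<And>x y. x\<in>K \<Longrightarrow> y\<in>(\<Union>i\<in>I. V i) \<Longrightarrow> \<bar>f x y - g (x,y)\<bar> \<le> e" by auto
    have [measurable]: "K \<in> sets borel" "L \<in> sets borel" using K borel_compact by auto
    have "(\<lambda>z. if fst z \<in> K \<and> snd z \<in> L then g z else 0) \<in> borel_measurable (borel \<Otimes>\<^sub>M borel)"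
      by measurable
    moreover have "\<bar>f x y - (if fst (x,y) \<in> K \<and> snd (x,y) \<in> L then g (x,y) else 0)\<bar> \<le> e" for x y
      using g2[of x y] 0[of x y] I(2) e by auto
    ultimately show ?thesis by blast
  qed
  then have "\<exists>g. g \<in> borel_measurable (borel \<Otimes>\<^sub>M borel) \<and> (\<forall>x y. \<bar>f x y - g (x,y)\<bar> \<le> 1 / real (Suc n))" for n
    by simp
  then obtain g where g: "\<And>n. g n \<in> borel_measurable (borel \<Otimes>\<^sub>M borel)"
    "\<And>n x y. \<bar>f x y - g n (x,y)\<bar> \<le> 1 / real (Suc n)" by metis
  show ?thesis
  proof (rule borel_measurable_LIMSEQ_real[OF _ g(1)])
    fix z :: "'a \<times> 'b"
    have "(\<lambda>n. g n z - f (fst z) (snd z)) \<longlonglongrightarrow> 0"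
      by (rule Lim_null_comparison[OF _ LIMSEQ_Suc[OF lim_1_over_n]])
         (use g(2)[of "fst z" "snd z"] in \<open>auto simp: abs_minus_commute intro!: always_eventually\<close>)
    then show "(\<lambda>i. g i z) \<longlonglongrightarrow> (case z of (x, y) \<Rightarrow> f x y)"
      by (simp add: case_prod_beta LIM_zero_iff)
  qed
qed

text \<open>Cutting both measures down to the compact supports makes them finite, so the ordinary
  Fubini theorem applies. The integrand vanishes elsewhere, so the cut changes neither iterated
  integral.\<close>

lemma Fubini_compact_support:
  fixes f :: "'a::t2_space \<Rightarrow> 'b::t2_space \<Rightarrow> real"
  assumes f: "continuous_on UNIV (\<lambda>(x,y). f x y)" and K: "compact K" "compact L"
    and 0: "\<And>x y. x \<notin> K \<or> y \<notin> L \<Longrightarrow> f x y = 0"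
    and M: "sets M = sets borel" "\<And>K. compact K \<Longrightarrow> emeasure M K < \<infinity>"
    and N: "sets N = sets borel" "\<And>K. compact K \<Longrightarrow> emeasure N K < \<infinity>"
  shows "(\<integral>x. (\<integral>y. f x y \<partial>N) \<partial>M) = (\<integral>y. (\<integral>x. f x y \<partial>M) \<partial>N)"
proof -
  have s[measurable]: "K \<in> sets borel" "L \<in> sets borel" using K borel_compact by auto
  define M' where "M' = density M (indicator K)"
  define N' where "N' = density N (indicator L)"
  have sets': "sets M' = sets borel" "sets N' = sets borel" by (auto simp: M'_def N'_def M N)
  have eM: "emeasure M' UNIV = emeasure M K" "emeasure N' UNIV = emeasure N L"
    using s unfolding M'_def N'_def by (auto simp: emeasure_density M(1) N(1) nn_integral_indicator cong: measurable_cong_sets)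
  have fin: "finite_measure M'" "finite_measure N'"
    using M(2)[OF K(1)] N(2)[OF K(2)] eM sets'[THEN sets_eq_imp_space_eq] by (auto intro!: finite_measureI)
  interpret M': finite_measure M' by fact
  interpret N': finite_measure N' by fact
  interpret pair_sigma_finite M' N' ..
  have fm[measurable]: "(\<lambda>(x,y). f x y) \<in> borel_measurable (borel \<Otimes>\<^sub>M borel)"
    by (rule borel_measurable_compact_support_pair[OF f K 0])
  have c1: "continuous_on UNIV (\<lambda>x. f x y)" "continuous_on UNIV (\<lambda>y. f x y)" for x y
    by (rule continuous_on_compose_curry[OF f]; auto intro!: continuous_intros)+
  have m1: "(\<lambda>x. f x y) \<in> borel_measurable borel" "(\<lambda>y. f x y) \<in> borel_measurable borel" for x y
    using c1 borel_measurable_continuous_onI by blast+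
  have "compact (K \<times> L)" using K by (rule compact_Times)
  have ccf: "cc (\<lambda>(x,y). f x y)"
    by (rule ccI[OF f \<open>compact (K \<times> L)\<close>]) (use 0 in auto)
  then obtain B where B: "\<And>z. \<bar>case z of (x,y) \<Rightarrow> f x y\<bar> \<le> B" using cc_bounded by blast
  have int: "integrable (M' \<Otimes>\<^sub>M N') (\<lambda>(x,y). f x y)"
  proof -
    interpret P: finite_measure "M' \<Otimes>\<^sub>M N'" by (rule finite_measure_pair_measure) fact+
    show ?thesis
      by (rule P.integrable_const_bound[of _ B])
       (use B fm in \<open>auto simp: measurable_cong_sets[OF sets_pair_measure_cong[OF sets'] refl]\<close>)
  qed
  have meas: "(\<lambda>x. \<integral>y. f x y \<partial>N') \<in> borel_measurable borel" "(\<lambda>y. \<integral>x. f x y \<partial>M') \<in> borel_measurable borel"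
  proof -
    have [measurable]: "(\<lambda>(x,y). f x y) \<in> borel_measurable (borel \<Otimes>\<^sub>M N')"
      using fm by (simp add: measurable_cong_sets[OF sets_pair_measure_cong[OF refl sets'(2)] refl])
    show "(\<lambda>x. \<integral>y. f x y \<partial>N') \<in> borel_measurable borel" by measurable
    have "(\<lambda>(y,x). f x y) \<in> borel_measurable (borel \<Otimes>\<^sub>M borel)" by measurable
    then have [measurable]: "(\<lambda>(y,x). f x y) \<in> borel_measurable (borel \<Otimes>\<^sub>M M')"
      by (simp add: measurable_cong_sets[OF sets_pair_measure_cong[OF refl sets'(1)] refl])
    show "(\<lambda>y. \<integral>x. f x y \<partial>M') \<in> borel_measurable borel" by measurable
  qed
  have N'i: "(\<integral>y. g y \<partial>N') = (\<integral>y. g y \<partial>N)" if "g \<in> borel_measurable borel" "\<And>y. y \<notin> L \<Longrightarrow> g y = 0" for g :: "'b \<Rightarrow> real"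
  proof -
    have "(\<integral>y. g y \<partial>N') = (\<integral>y. indicator L y *\<^sub>R g y \<partial>N)"
      unfolding N'_def ennreal_indicator[symmetric]
      by (rule integral_density) (use that s N(1) in \<open>auto cong: measurable_cong_sets\<close>)
    also have "\<dots> = (\<integral>y. g y \<partial>N)" by (rule Bochner_Integration.integral_cong) (use that in \<open>auto simp: indicator_def\<close>)
    finally show ?thesis .
  qed
  have M'i: "(\<integral>y. g y \<partial>M') = (\<integral>y. g y \<partial>M)" if "g \<in> borel_measurable borel" "\<And>y. y \<notin> K \<Longrightarrow> g y = 0" for g :: "'a \<Rightarrow> real"
  proof -
    have "(\<integral>y. g y \<partial>M') = (\<integral>y. indicator K y *\<^sub>R g y \<partial>M)"
      unfolding M'_def ennreal_indicator[symmetric]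
      by (rule integral_density) (use that s M(1) in \<open>auto cong: measurable_cong_sets\<close>)
    also have "\<dots> = (\<integral>y. g y \<partial>M)" by (rule Bochner_Integration.integral_cong) (use that in \<open>auto simp: indicator_def\<close>)
    finally show ?thesis .
  qed
  have e1: "(\<integral>y. f x y \<partial>N') = (\<integral>y. f x y \<partial>N)" for x by (rule N'i) (use m1 0 in auto)
  have e2: "(\<integral>x. f x y \<partial>M') = (\<integral>x. f x y \<partial>M)" for y by (rule M'i) (use m1 0 in auto)
  have "(\<lambda>y. f x y) = (\<lambda>_. 0)" if "x \<notin> K" for x using 0 that by auto
  moreover have "(\<lambda>x. f x y) = (\<lambda>_. 0)" if "y \<notin> L" for y using 0 that by auto
  ultimately have z: "x \<notin> K \<Longrightarrow> (\<integral>y. f x y \<partial>N') = 0" "y \<notin> L \<Longrightarrow> (\<integral>x. f x y \<partial>M') = 0" for x y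
    by simp_all
  have "(\<integral>x. (\<integral>y. f x y \<partial>N) \<partial>M) = (\<integral>x. (\<integral>y. f x y \<partial>N') \<partial>M')"
    unfolding e1[symmetric] by (rule M'i[symmetric]) (use meas z in auto)
  also have "\<dots> = (\<integral>y. (\<integral>x. f x y \<partial>M') \<partial>N')"
    using Fubini_integral[OF int] by simp
  also have "\<dots> = (\<integral>y. (\<integral>x. f x y \<partial>M) \<partial>N)"
    unfolding e2[symmetric] by (rule N'i) (use meas z in auto)
  finally show ?thesis .
qed

subsection \<open>The modular function\<close>

lemma compact_plus_image:
  fixes K L :: "'a::{topological_group_add, t2_space} set"
  assumes "compact K" "compact L" shows "compact ((\<lambda>(x,y). x + y) ` (K \<times> L))"
  unfolding case_prod_beta
  by (intro compact_continuous_image compact_Times assms continuous_intros)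

lemma compact_uminus_image:
  fixes K :: "'a::{topological_group_add, t2_space} set"
  assumes "compact K" shows "compact (uminus ` K)"
  by (intro compact_continuous_image assms continuous_intros)

text \<open>The vanishing off \<open>K\<close> is only almost everywhere, so that the lemma also
  serves measures concentrated on a compact set, for which \<open>f\<close> itself need not vanish
  anywhere.\<close>

lemma integrable_continuous_AE_compact:
  fixes f :: "'a::t2_space \<Rightarrow> real"
  assumes f: "continuous_on UNIV f" and M: "sets M = sets borel" "\<And>K. compact K \<Longrightarrow> emeasure M K < \<infinity>"
    and K: "compact K" "AE x in M. x \<notin> K \<longrightarrow> f x = 0"
  shows "integrable M f"
proof -
  have "compact (f ` K)"
    using K(1) f by (meson compact_continuous_image continuous_on_subset subset_UNIV)
  then obtain B where B: "\<And>y. y \<in> f ` K \<Longrightarrow> norm y \<le> B"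
    using compact_imp_bounded bounded_iff by metis
  have Ks: "K \<in> sets M" using M(1) K(1) borel_compact by auto
  have "integrable M (\<lambda>x. indicator K x * B)"
    using Ks M(2)[OF K(1)] by (intro integrable_mult_left) (auto simp: integrable_indicator_iff)
  moreover have "f \<in> borel_measurable M"
    using borel_measurable_continuous_onI[OF f] M(1) by (simp cong: measurable_cong_sets)
  moreover have "AE x in M. norm (f x) \<le> norm (indicator K x * B)"
    using K(2) by eventually_elim (use B in \<open>force simp: indicator_def\<close>)
  ultimately show ?thesis by (rule Bochner_Integration.integrable_bound)
qed

text \<open>The parameter space need not be first countable, so continuity cannot be read off from
  sequences by dominated convergence. Near \<open>x0\<close> all integrands live on one compact set
  \<open>K\<close>, on which they are uniformly within \<open>d\<close> of the integrand at
  \<open>x0\<close>; the error is at most \<open>d\<close> times the measure of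
  \<open>K\<close>.\<close>

lemma continuous_on_integral_parameter:
  fixes f :: "'b::topological_space \<Rightarrow> 'a::t2_space \<Rightarrow> real"
  assumes f: "continuous_on UNIV (\<lambda>(x,y). f x y)"
    and M: "sets M = sets borel" "\<And>K. compact K \<Longrightarrow> emeasure M K < \<infinity>"
    and loc: "\<And>x0. \<exists>U K. open U \<and> x0 \<in> U \<and> compact K \<and> (\<forall>x\<in>U. AE y in M. y \<notin> K \<longrightarrow> f x y = 0)"
  shows "continuous_on UNIV (\<lambda>x. \<integral>y. f x y \<partial>M)"
proof -
  have c: "continuous_on UNIV (f x)" for x
    by (rule continuous_on_compose_curry[OF f]) (auto intro!: continuous_intros)
  have int: "integrable M (f x)" for x
    using loc[of x] integrable_continuous_AE_compact[OF c M] by metis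
  have "((\<lambda>x. \<integral>y. f x y \<partial>M) \<longlongrightarrow> (\<integral>y. f x0 y \<partial>M)) (at x0)" for x0
  proof (rule tendstoI)
    fix e :: real assume e: "e > 0"
    obtain U K where U: "open U" "x0 \<in> U" "compact K" "\<And>x. x\<in>U \<Longrightarrow> AE y in M. y \<notin> K \<longrightarrow> f x y = 0"
      using loc by metis
    define d where "d = e / (measure M K + 1)"
    have d: "d > 0" using e by (simp add: d_def add_nonneg_pos)
    have "continuous_on (UNIV \<times> K) (\<lambda>(x,y). f x y)" using f continuous_on_subset by blast
    from continuous_on_prod_compactE[OF this U(3) UNIV_I d, of x0]
    obtain V where V: "x0 \<in> V" "open V" "\<forall>x\<in>V. \<forall>y\<in>K. dist (f x y) (f x0 y) \<le> d"
      by (metis Int_UNIV_right prod.case)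
    have Ks: "K \<in> sets M" using M(1) U(3) borel_compact by auto
    have "dist (\<integral>y. f x y \<partial>M) (\<integral>y. f x0 y \<partial>M) < e" if x: "x \<in> U \<inter> V" for x
    proof -
      have "dist (\<integral>y. f x y \<partial>M) (\<integral>y. f x0 y \<partial>M) = \<bar>\<integral>y. f x y - f x0 y \<partial>M\<bar>"
        using int by (simp add: dist_real_def)
      also have "\<dots> \<le> (\<integral>y. \<bar>f x y - f x0 y\<bar> \<partial>M)" by (rule integral_abs_bound)
      also have "\<dots> \<le> (\<integral>y. indicator K y * d \<partial>M)"
      proof (rule integral_mono_AE)
        show "integrable M (\<lambda>y. indicator K y * d)"
          using Ks M(2)[OF U(3)] by (intro integrable_mult_left) (auto simp: integrable_indicator_iff)
        show "AE y in M. \<bar>f x y - f x0 y\<bar> \<le> indicator K y * d"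
          using U(4)[of x] U(4)[OF U(2)] x V(3) by (auto simp: dist_real_def indicator_def)
      qed (use int in auto)
      also have "\<dots> = measure M K * d" using Ks by simp
      also have "\<dots> < (measure M K + 1) * d" using d by simp
      also have "\<dots> = e" unfolding d_def using measure_nonneg[of M K] by (simp add: field_simps add_nonneg_eq_0_iff)
      finally show ?thesis .
    qed
    moreover have "eventually (\<lambda>x. x \<in> U \<inter> V) (at x0)"
      by (rule eventually_at_in_open') (use U V in auto)
    ultimately show "eventually (\<lambda>x. dist (\<integral>y. f x y \<partial>M) (\<integral>y. f x0 y \<partial>M) < e) (at x0)"
      by (auto elim!: eventually_mono)
  qed
  then show ?thesis by (simp add: continuous_on_def)
qed

lemma Hausdorff_space_euclidean_t2: "Hausdorff_space (euclidean :: 'a::t2_space topology)"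
  unfolding Hausdorff_space_def disjnt_def open_openin[symmetric] topspace_euclidean using hausdorff by blast

locale haar =
  fixes M :: "'a::{topological_group_add, t2_space} measure"
  assumes locally_compact: "locally_compact_space (euclidean :: 'a topology)"
    and left_haar: "left_haar_measure M"
begin

lemma sets_M[measurable_cong, simp]: "sets M = sets borel"
  and emeasure_UNIV_nonzero: "emeasure M UNIV \<noteq> 0"
  and emeasure_compact: "compact K \<Longrightarrow> emeasure M K < \<infinity>"
  and outer_regular: "A \<in> sets borel \<Longrightarrow> emeasure M A = (INF U\<in>{U. open U \<and> A \<subseteq> U}. emeasure M U)"
  and inner_regular: "open U \<Longrightarrow> emeasure M U = (SUP K\<in>{K. compact K \<and> K \<subseteq> U}. emeasure M K)"
  and emeasure_left_translate: "A \<in> sets borel \<Longrightarrow> emeasure M ((\<lambda>y. x + y) ` A) = emeasure M A"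
proof -
  note * = left_haar[unfolded left_haar_measure_def]
  note 1 = conjunct2[OF *] note 2 = conjunct2[OF 1] note 3 = conjunct2[OF 2]
  note 4 = conjunct2[OF 3] note 5 = conjunct2[OF 4]
  show "sets M = sets borel" using conjunct1[OF *] .
  show "emeasure M UNIV \<noteq> 0" using conjunct1[OF 1] .
  show "compact K \<Longrightarrow> emeasure M K < \<infinity>" using spec[OF conjunct1[OF 2], of K] by (rule mp)
  show "A \<in> sets borel \<Longrightarrow> emeasure M A = (INF U\<in>{U. open U \<and> A \<subseteq> U}. emeasure M U)"
    using conjunct1[OF 3] by (rule bspec)
  show "open U \<Longrightarrow> emeasure M U = (SUP K\<in>{K. compact K \<and> K \<subseteq> U}. emeasure M K)"
    using spec[OF conjunct1[OF 4], of U] by (rule mp)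
  show "A \<in> sets borel \<Longrightarrow> emeasure M ((\<lambda>y. x + y) ` A) = emeasure M A"
    using spec[OF 5, of x] by (rule bspec)
qed

lemma space_M[simp]: "space M = UNIV"
  using sets_M[THEN sets_eq_imp_space_eq] by simp

lemma measurable_M[simp]: "measurable M N = measurable borel N" "measurable N M = measurable N borel"
  by (simp_all cong: measurable_cong_sets)

lemma integrable_Cc: "cc f \<Longrightarrow> integrable M f"
  using integrable_cc[OF _ sets_M emeasure_compact] .

lemma compact_neighbourhood:
  fixes K :: "'a set"
  assumes "compact K" obtains V C where "open V" "compact C" "K \<subseteq> V" "V \<subseteq> C"
proof -
  have "\<exists>U C. open U \<and> compact C \<and> x \<in> U \<and> U \<subseteq> C" for x :: 'a
    using locally_compact unfolding locally_compact_space_def by simp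
  then obtain U C where UC: "\<And>x::'a. open (U x) \<and> compact (C x) \<and> x \<in> U x \<and> U x \<subseteq> C x" by metis
  obtain I where I: "finite I" "K \<subseteq> (\<Union>i\<in>I. U i)"
    using compactE_image[OF assms, of K U] UC by (metis UN_I subsetI)
  show thesis
    by (rule that[of "\<Union>i\<in>I. U i" "\<Union>i\<in>I. C i"]) (use I UC in auto)
qed

text \<open>A locally compact Hausdorff space is completely regular, which separates
  \<open>K\<close> from the complement of \<open>U \<inter> V\<close>. The relatively compact
  \<open>V\<close> is there to make the support compact.\<close>

lemma cc_bump:
  assumes "compact K" "open U" "K \<subseteq> U"
  obtains f :: "'a \<Rightarrow> real" where "cc f" "\<And>x. 0 \<le> f x" "\<And>x. f x \<le> 1" "\<And>x. x \<in> K \<Longrightarrow> f x = 1" "\<And>x. x \<notin> U \<Longrightarrow> f x = 0"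
proof -
  obtain V C where V: "open V" "compact C" "K \<subseteq> V" "V \<subseteq> C" using compact_neighbourhood[OF assms(1)] .
  have "completely_regular_space (euclidean :: 'a topology)"
    using locally_compact by (intro locally_compact_regular_imp_completely_regular_space disjI1
        Hausdorff_space_euclidean_t2)
  moreover have "closed (- (U \<inter> V))" "disjnt K (- (U \<inter> V))"
    using assms V by (auto simp: disjnt_def closed_def)
  ultimately obtain f where f: "continuous_map euclidean (subtopology euclidean {0..1::real}) f"
    "f ` (- (U \<inter> V)) \<subseteq> {0}" "f ` K \<subseteq> {1}"
    using Urysohn_completely_regular_compact_closed[of 0 1 "euclidean :: 'a topology" K "- (U \<inter> V)"] assms(1)
    by (metis closed_closedin compactin_euclidean_iff zero_le_one)
  have c: "continuous_on UNIV f" "\<And>x. f x \<in> {0..1}"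
    using f(1) by (auto simp: continuous_map_in_subtopology image_subset_iff)
  show thesis
  proof (rule that[of f])
    show "cc f" by (rule ccI[OF c(1) V(2)]) (use f V in blast)
  qed (use c f in \<open>force simp: image_subset_iff\<close>)+
qed

lemma cc_bump_point:
  obtains f :: "'a \<Rightarrow> real" where "cc f" "\<And>x. 0 \<le> f x" "f a = 1"
proof -
  show thesis by (rule cc_bump[of "{a}" UNIV]) (auto intro: that)
qed

lemma distr_left_translate: "distr M M (\<lambda>y. x + y) = M"
proof (rule measure_eqI)
  have [measurable]: "(\<lambda>y. x + y) \<in> borel_measurable borel"
    by (intro borel_measurable_continuous_onI continuous_intros)
  fix A assume "A \<in> sets (distr M M (\<lambda>y. x + y))"
  then have A: "A \<in> sets borel" by simp
  have "emeasure (distr M M (\<lambda>y. x + y)) A = emeasure M ((\<lambda>y. x + y) -` A)"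
    using A by (subst emeasure_distr) auto
  also have "(\<lambda>y. x + y) -` A = (\<lambda>y. - x + y) ` A"
    by (auto simp: image_iff add.assoc[symmetric] intro!: bexI[of _ "x + _"])
  also have "emeasure M \<dots> = emeasure M A" using emeasure_left_translate[OF A] .
  finally show "emeasure (distr M M (\<lambda>y. x + y)) A = emeasure M A" .
qed simp

lemma borel_measurable_translate[measurable]:
  "(\<lambda>y::'a. x + y) \<in> borel_measurable borel" "(\<lambda>y::'a. y + x) \<in> borel_measurable borel"
  "(\<lambda>y::'a. - y) \<in> borel_measurable borel"
  by (intro borel_measurable_continuous_onI continuous_intros)+

lemma nn_integral_left_translate:
  "f \<in> borel_measurable borel \<Longrightarrow> (\<integral>\<^sup>+y. f (x + y) \<partial>M) = (\<integral>\<^sup>+y. f y \<partial>M)"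
  by (subst (2) distr_left_translate[of x, symmetric], subst nn_integral_distr) auto

lemma integral_left_translate:
  fixes f :: "'a \<Rightarrow> real"
  shows "f \<in> borel_measurable borel \<Longrightarrow> (\<integral>y. f (x + y) \<partial>M) = (\<integral>y. f y \<partial>M)"
  by (subst (2) distr_left_translate[of x, symmetric], subst integral_distr) auto

lemma cc_translate:
  assumes "cc f" shows "cc (\<lambda>y::'a. f (x + y))" "cc (\<lambda>y::'a. f (y + x))" "cc (\<lambda>y::'a. f (- y))"
proof -
  obtain K where K: "compact K" "\<And>x. x \<notin> K \<Longrightarrow> f x = 0" using ccE[OF assms] by metis
  have c: "continuous_on UNIV f" using assms cc_continuous by blast
  have 1: "compact ((\<lambda>y. -x + y) ` K)" "compact ((\<lambda>y. y + -x) ` K)" "compact (uminus ` K)"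
    by (intro compact_continuous_image K continuous_intros)+
  show "cc (\<lambda>y::'a. f (x + y))"
    by (rule ccI[OF _ 1(1)], intro continuous_on_compose2[OF c] continuous_intros, simp)
       (rule K, auto simp: image_iff add.assoc[symmetric] dest: bspec[of _ _ "x + _"])
  show "cc (\<lambda>y::'a. f (y + x))"
    by (rule ccI[OF _ 1(2)], intro continuous_on_compose2[OF c] continuous_intros, simp)
       (rule K, auto simp: image_iff add.assoc dest: bspec[of _ _ "_ + x"])
  show "cc (\<lambda>y::'a. f (- y))"
    by (rule ccI[OF _ 1(3)], intro continuous_on_compose2[OF c] continuous_intros, simp)
       (rule K, auto simp: image_iff dest: bspec[of _ _ "- _"])
qed

text \<open>Finitely many left translates of a nonempty open set cover a compact set. If the open
  set were null, all compact sets would be null, and inner regularity would make the whole group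
  null.\<close>

lemma emeasure_open_pos:
  assumes "open U" "U \<noteq> {}" shows "emeasure M U > 0"
proof (rule ccontr)
  assume "\<not> emeasure M U > 0"
  then have U0: "emeasure M U = 0" by simp
  obtain u where u: "u \<in> U" using assms by auto
  have "emeasure M K = 0" if K: "compact K" for K
  proof -
    have o: "open ((\<lambda>y. x + y) ` U)" for x
    proof -
      have "(\<lambda>y. x + y) ` U = (\<lambda>y. -x + y) -` U"
        by (auto simp: image_iff add.assoc[symmetric] intro!: bexI[of _ "-x + _"])
      also have "open \<dots>" by (intro open_vimage assms continuous_intros)
      finally show ?thesis .
    qed
    have "K \<subseteq> (\<Union>x\<in>UNIV. (\<lambda>y. x + y) ` U)"
    proof
      fix k assume "k \<in> K"
      have "k = (k + - u) + u" by (simp add: add.assoc)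
      then show "k \<in> (\<Union>x\<in>UNIV. (\<lambda>y. x + y) ` U)" using u by blast
    qed
    then obtain I where I: "finite I" "K \<subseteq> (\<Union>x\<in>I. (\<lambda>y. x + y) ` U)"
      using compactE_image[OF K, of UNIV "\<lambda>x. (\<lambda>y. x + y) ` U"] o by metis
    have "emeasure M K \<le> emeasure M (\<Union>x\<in>I. (\<lambda>y. x + y) ` U)"
      using I o by (intro emeasure_mono) auto
    also have "\<dots> \<le> (\<Sum>x\<in>I. emeasure M ((\<lambda>y. x + y) ` U))"
      using I o by (intro emeasure_subadditive_finite) auto
    also have "\<dots> = 0" using emeasure_left_translate[of U] U0 assms by simp
    finally show ?thesis by simp
  qed
  then have "emeasure M UNIV \<le> 0" unfolding inner_regular[OF open_UNIV] by (intro SUP_least) simp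
  then show False using emeasure_UNIV_nonzero by simp
qed

lemma integral_cc_pos:
  assumes f: "cc f" and nn: "\<And>x. 0 \<le> f x" and x: "f x \<noteq> 0"
  shows "0 < (\<integral>y. f y \<partial>M)"
proof -
  have "open (f -` {0<..})" using cc_continuous[OF f] by (intro open_vimage) auto
  moreover have "f -` {0<..} \<noteq> {}" using x nn[of x] by (auto intro!: exI[of _ x] simp: less_le)
  ultimately have "emeasure M (f -` {0<..}) > 0" by (rule emeasure_open_pos)
  then have "\<not> (AE y in M. f y = 0)"
    using nn by (subst AE_iff_measurable[OF _ refl])
      (use borel_measurable_cc[OF f] in \<open>auto simp: vimage_def less_le cong: conj_cong\<close>)
  then have "(\<integral>y. f y \<partial>M) \<noteq> 0"
    using integral_nonneg_eq_0_iff_AE[OF integrable_Cc[OF f]] nn by auto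
  moreover have "(\<integral>y. f y \<partial>M) \<ge> 0" using nn by simp
  ultimately show ?thesis by simp
qed

lemma emeasure_le_integral_cc:
  assumes f: "cc f" and nn: "\<And>x. 0 \<le> f x" and K: "compact K" "\<And>x. x \<in> K \<Longrightarrow> 1 \<le> f x"
  shows "emeasure M K \<le> ennreal (\<integral>y. f y \<partial>M)"
proof -
  have "emeasure M K = (\<integral>\<^sup>+x. indicator K x \<partial>M)" using borel_compact[OF K(1)] by simp
  also have "\<dots> \<le> (\<integral>\<^sup>+x. ennreal (f x) \<partial>M)"
    using K by (intro nn_integral_mono) (auto simp: indicator_def)
  also have "\<dots> = ennreal (\<integral>y. f y \<partial>M)" using integrable_Cc[OF f] nn by (intro nn_integral_eq_integral) auto
  finally show ?thesis .
qed

lemma integral_cc_le_emeasure: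
  assumes f: "cc f" and nn: "\<And>x. 0 \<le> f x" "\<And>x. f x \<le> 1" and U: "U \<in> sets borel" "\<And>x. x \<notin> U \<Longrightarrow> f x = 0"
  shows "ennreal (\<integral>y. f y \<partial>M) \<le> emeasure M U"
proof -
  have "ennreal (\<integral>y. f y \<partial>M) = (\<integral>\<^sup>+x. ennreal (f x) \<partial>M)" using integrable_Cc[OF f] nn by (intro nn_integral_eq_integral[symmetric]) auto
  also have "\<dots> \<le> (\<integral>\<^sup>+x. indicator U x \<partial>M)"
    using U nn by (intro nn_integral_mono) (auto simp: indicator_def)
  also have "\<dots> = emeasure M U" using U by auto
  finally show ?thesis .
qed

text \<open>For \<open>v\<close> in \<open>W\<close> both terms vanish when \<open>x\<close> lies
  outside the compact set \<open>L\<close> of all \<open>- c + k\<close> with \<open>c\<close> in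
  \<open>C\<close> and \<open>k\<close> in \<open>K\<close>; on \<open>L\<close> continuity at
  \<open>v = 0\<close> is uniform.\<close>

lemma uniformly_continuous_left:
  assumes f: "cc f" and e: "(e::real) > 0"
  obtains V where "open V" "(0::'a) \<in> V" "\<And>v x. v \<in> V \<Longrightarrow> \<bar>f (v + x) - f x\<bar> \<le> e"
proof -
  obtain K where K: "compact K" "\<And>x. x \<notin> K \<Longrightarrow> f x = 0" using ccE[OF f] by metis
  obtain W C where W: "open W" "compact C" "{0::'a} \<subseteq> W" "W \<subseteq> C" using compact_neighbourhood[of "{0}"] by auto
  define L where "L = (\<lambda>(x,y). x + y) ` (uminus ` C \<times> K)"
  have L: "compact L" unfolding L_def by (intro compact_plus_image compact_uminus_image W K)
  have c: "continuous_on UNIV f" using f cc_continuous by blast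
  have "continuous_on (UNIV \<times> L) (\<lambda>(v,x). f (v + x))"
    unfolding case_prod_beta by (rule continuous_on_compose2[OF c]) (auto intro!: continuous_intros)
  from continuous_on_prod_compactE[OF this L UNIV_I e, of 0]
  obtain V where V: "0 \<in> V" "open V" "\<forall>v\<in>V. \<forall>x\<in>L. dist (f (v + x)) (f (0 + x)) \<le> e"
    by (metis Int_UNIV_right prod.case)
  show thesis
  proof (rule that[of "V \<inter> W"])
    fix v x assume v: "v \<in> V \<inter> W"
    show "\<bar>f (v + x) - f x\<bar> \<le> e"
    proof (cases "x \<in> L")
      case False
      have "v + x \<notin> K"
      proof
        assume "v + x \<in> K"
        then have "(- v) + (v + x) \<in> L" unfolding L_def using v W by (auto intro!: image_eqI[of _ _ "(-v, v + x)"])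
        then show False using False by (simp add: add.assoc[symmetric])
      qed
      moreover have "x \<notin> K"
      proof
        assume "x \<in> K"
        then have "(- 0) + x \<in> L" unfolding L_def using W by (intro image_eqI[of _ _ "(-0, x)"]) auto
        then show False using False by simp
      qed
      ultimately show ?thesis using K e by simp
    qed (use V v in \<open>auto simp: dist_real_def\<close>)
  qed (use V W in auto)
qed

section \<open>Right translates of test functions, inversion and the homomorphism
  \<open>D\<close>\<close>

lemma continuous_on_translate_integral:
  assumes f: "cc f" shows "continuous_on UNIV (\<lambda>s. \<integral>t. f (t + s) \<partial>M)"
proof (rule continuous_on_integral_parameter[OF _ sets_M emeasure_compact])
  have c: "continuous_on UNIV f" using f cc_continuous by blast
  show "continuous_on UNIV (\<lambda>(s,t). f (t + s))"
    unfolding case_prod_beta by (rule continuous_on_compose2[OF c]) (auto intro!: continuous_intros)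
  fix s0 :: 'a
  obtain K where K: "compact K" "\<And>x. x \<notin> K \<Longrightarrow> f x = 0" using ccE[OF f] by metis
  obtain W C where W: "open W" "compact C" "{s0::'a} \<subseteq> W" "W \<subseteq> C" using compact_neighbourhood[of "{s0}"] by auto
  define L where "L = (\<lambda>(x,y). x + y) ` (K \<times> uminus ` C)"
  have L: "compact L" unfolding L_def by (intro compact_plus_image compact_uminus_image W K)
  have "f (t + s) = 0" if "s \<in> W" "t \<notin> L" for s t
  proof (rule K, rule)
    assume "t + s \<in> K"
    then have "(t + s) + - s \<in> L" unfolding L_def using that W by (intro image_eqI[of _ _ "(t+s, -s)"]) auto
    then show False using that by (simp add: add.assoc)
  qed
  then show "\<exists>U K. open U \<and> s0 \<in> U \<and> compact K \<and> (\<forall>x\<in>U. AE y in M. y \<notin> K \<longrightarrow> f (y + x) = 0)"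
    using W L by (intro exI[of _ W] exI[of _ L]) auto
qed

text \<open>
  The left-hand side does not see how the translates of \<open>f\<close> vary, so these integrals are all
  proportional to the integral of \<open>f\<close>, with a factor that does not depend on \<open>f\<close>.  The modular
  function and the formula for the inverse measure come out without uniqueness of Haar measure.
\<close>

lemma integral_product_translate:
  assumes f: "cc f" and g: "cc g"
  shows "(\<integral>s. f s \<partial>M) * (\<integral>t. g (- t) \<partial>M) = (\<integral>s. g s * (\<integral>t. f (t + s) \<partial>M) \<partial>M)"
proof -
  obtain K where K: "compact K" "\<And>x. x \<notin> K \<Longrightarrow> f x = 0" using ccE[OF f] by metis
  obtain L where L: "compact L" "\<And>x. x \<notin> L \<Longrightarrow> g x = 0" using ccE[OF g] by metis
  define N where "N = (\<lambda>(x,y). x + y) ` (K \<times> uminus ` L)"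
  have N: "compact N" unfolding N_def by (intro compact_plus_image compact_uminus_image K L)
  have c: "continuous_on UNIV f" "continuous_on UNIV g" using f g cc_continuous by blast+
  have mf[measurable]: "f \<in> borel_measurable borel" "g \<in> borel_measurable borel"
    using f g borel_measurable_cc by blast+
  have "(\<integral>s. f s \<partial>M) * (\<integral>t. g (- t) \<partial>M) = (\<integral>s. f s * (\<integral>t. g (- t) \<partial>M) \<partial>M)" by simp
  \<comment> \<open>Left invariance, applied to \<open>\<lambda>t. g (- t)\<close> with the
    translation \<open>- s\<close>, inserts \<open>s\<close> on the right of \<open>- t\<close>. The
    exchanges of integrals below move this dependence over to \<open>f\<close>.\<close>
  also have "\<dots> = (\<integral>s. f s * (\<integral>t. g (- t + s) \<partial>M) \<partial>M)"
  proof -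
    have "(\<integral>t. g (- t) \<partial>M) = (\<integral>t. g (- t + s) \<partial>M)" for s
      using integral_left_translate[of "\<lambda>t. g (- t)" "- s"] by (simp add: minus_add)
    then show ?thesis by simp
  qed
  also have "\<dots> = (\<integral>s. (\<integral>t. f s * g (- t + s) \<partial>M) \<partial>M)" by simp
  also have "\<dots> = (\<integral>t. (\<integral>s. f s * g (- t + s) \<partial>M) \<partial>M)"
  proof (rule Fubini_compact_support[OF _ K(1) N _ sets_M emeasure_compact sets_M emeasure_compact])
    show "continuous_on UNIV (\<lambda>(s,t). f s * g (- t + s))"
      unfolding case_prod_beta
      by (intro continuous_intros continuous_on_compose2[OF c(1)] continuous_on_compose2[OF c(2)]) auto
    fix s t :: 'a assume st: "s \<notin> K \<or> t \<notin> N"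
    have "t \<in> N" if "s \<in> K" "- t + s \<in> L"
      unfolding N_def using that by (intro image_eqI[of _ _ "(s, - (- t + s))"]) (auto simp: minus_add add.assoc[symmetric] image_iff intro!: bexI[of _ "- t + s"])
    then show "f s * g (- t + s) = 0" using st K L by auto
  qed
  also have "\<dots> = (\<integral>t. (\<integral>s. f (t + s) * g s \<partial>M) \<partial>M)"
  proof (rule Bochner_Integration.integral_cong[OF refl])
    fix t
    show "(\<integral>s. f s * g (- t + s) \<partial>M) = (\<integral>s. f (t + s) * g s \<partial>M)"
      using integral_left_translate[of "\<lambda>s. f s * g (- t + s)" t] by (simp add: add.assoc[symmetric])
  qed
  also have "\<dots> = (\<integral>s. (\<integral>t. f (t + s) * g s \<partial>M) \<partial>M)"
  proof (rule Fubini_compact_support[OF _ N L(1) _ sets_M emeasure_compact sets_M emeasure_compact])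
    show "continuous_on UNIV (\<lambda>(t,s). f (t + s) * g s)"
      unfolding case_prod_beta
      by (intro continuous_intros continuous_on_compose2[OF c(1)] continuous_on_compose2[OF c(2)]) auto
    fix s t :: 'a assume st: "t \<notin> N \<or> s \<notin> L"
    have "t \<in> N" if "t + s \<in> K" "s \<in> L"
      unfolding N_def using that by (intro image_eqI[of _ _ "(t + s, - s)"]) (auto simp: add.assoc)
    then show "f (t + s) * g s = 0" using st K L by auto
  qed
  also have "\<dots> = (\<integral>s. g s * (\<integral>t. f (t + s) \<partial>M) \<partial>M)" by (simp add: mult.commute)
  finally show ?thesis .
qed

lemma cc_integral_nonzero_exists: obtains f :: "'a \<Rightarrow> real" where "cc f" "\<And>x. 0 \<le> f x" "(\<integral>x. f x \<partial>M) > 0"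
proof -
  obtain f :: "'a \<Rightarrow> real" where f: "cc f" "\<And>x. 0 \<le> f x" "f 0 = 1" using cc_bump_point by metis
  show thesis by (rule that[OF f(1,2) integral_cc_pos[OF f(1,2), of 0]]) (use f in auto)
qed

text \<open>The left side of the product formula sees only the integral of \<open>f\<close>. Hence
  the combination \<open>h\<close> of the translate integrals of \<open>f\<close> and of a fixed
  \<open>k\<close> integrates to zero against every test function, and being continuous it vanishes.
  The factor is the quotient for \<open>k\<close>.\<close>

lemma right_translate_functional:
  "\<exists>D. continuous_on UNIV D \<and> (\<forall>f s. cc f \<longrightarrow> (\<integral>t. f (t + s) \<partial>M) = D s * (\<integral>t. f t \<partial>M))"
proof -
  obtain k :: "'a \<Rightarrow> real" where k: "cc k" "(\<integral>x. k x \<partial>M) > 0" using cc_integral_nonzero_exists by metis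
  have "(\<integral>t. f (t + s) \<partial>M) = ((\<integral>t. k (t + s) \<partial>M) / (\<integral>x. k x \<partial>M)) * (\<integral>t. f t \<partial>M)" if f: "cc f" for f s
  proof -
    define h where "h s = (\<integral>x. k x \<partial>M) * (\<integral>t. f (t + s) \<partial>M) - (\<integral>x. f x \<partial>M) * (\<integral>t. k (t + s) \<partial>M)" for s
    have ch: "continuous_on UNIV h" unfolding h_def
      by (intro continuous_intros continuous_on_translate_integral k f)
    have z: "(\<integral>s. g s * h s \<partial>M) = 0" if g: "cc g" for g
    proof -
      have i: "integrable M (\<lambda>s. g s * (\<integral>t. f (t + s) \<partial>M))" "integrable M (\<lambda>s. g s * (\<integral>t. k (t + s) \<partial>M))"
        by (intro integrable_Cc cc_mult_right g continuous_on_translate_integral f k)+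
      have "(\<integral>s. g s * h s \<partial>M) = (\<integral>s. (\<integral>x. k x \<partial>M) * (g s * (\<integral>t. f (t + s) \<partial>M)) - (\<integral>x. f x \<partial>M) * (g s * (\<integral>t. k (t + s) \<partial>M)) \<partial>M)"
        by (simp add: h_def algebra_simps)
      also have "\<dots> = 0" using i by (simp add: integral_product_translate[OF f g, symmetric] integral_product_translate[OF k(1) g, symmetric])
      finally show ?thesis .
    qed
    have "h s = 0"
    proof (rule ccontr)
      assume "h s \<noteq> 0"
      \<comment> \<open>Tested against \<open>b * h\<close>, the function \<open>h\<close> would
        give the integral of \<open>b * h * h\<close>, which is positive if
        \<open>h s \<noteq> 0\<close>.\<close>
      obtain b :: "'a \<Rightarrow> real" where b: "cc b" "\<And>x. 0 \<le> b x" "b s = 1" using cc_bump_point by metis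
      have "0 < (\<integral>x. b x * (h x * h x) \<partial>M)"
        by (rule integral_cc_pos[of _ s]) (use b ch \<open>h s \<noteq> 0\<close> in \<open>auto intro!: cc_mult_right continuous_intros\<close>)
      moreover have "(\<integral>x. (b x * h x) * h x \<partial>M) = 0"
        by (rule z) (use b ch in \<open>auto intro!: cc_mult_right\<close>)
      ultimately show False by (simp add: mult.assoc)
    qed
    then show ?thesis using k(2) by (simp add: h_def field_simps)
  qed
  moreover have "continuous_on UNIV (\<lambda>s. (\<integral>t. k (t + s) \<partial>M) / (\<integral>x. k x \<partial>M))"
    using k by (intro continuous_intros continuous_on_translate_integral) auto
  ultimately show ?thesis by (intro exI[of _ "\<lambda>s. (\<integral>t. k (t + s) \<partial>M) / (\<integral>x. k x \<partial>M)"]) blast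
qed

text \<open>In the notation of the modular function, \<open>D x\<close> is \<open>\<Delta>(x\<^sup>-\<^sup>1)\<close>, see \<open>modular_function_eq\<close>.\<close>

definition D :: "'a \<Rightarrow> real" where
  "D = (SOME D. continuous_on UNIV D \<and> (\<forall>f s. cc f \<longrightarrow> (\<integral>t. f (t + s) \<partial>M) = D s * (\<integral>t. f t \<partial>M)))"

lemma continuous_D: "continuous_on UNIV D"
  and integral_right_translate: "cc f \<Longrightarrow> (\<integral>t. f (t + s) \<partial>M) = D s * (\<integral>t. f t \<partial>M)"
  using someI_ex[OF right_translate_functional] unfolding D_def by blast+

lemma D_pos: "D s > 0"
proof -
  obtain f :: "'a \<Rightarrow> real" where f: "cc f" "\<And>x. 0 \<le> f x" "f 0 = 1" using cc_bump_point by metis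
  have "0 < (\<integral>t. f (t + s) \<partial>M)"
    by (rule integral_cc_pos[of _ "-s"]) (use f in \<open>auto intro!: cc_translate\<close>)
  moreover have "0 < (\<integral>t. f t \<partial>M)"
    by (rule integral_cc_pos[of _ 0]) (use f in \<open>auto intro!: cc_translate\<close>)
  ultimately show ?thesis by (simp add: integral_right_translate[OF f(1)] zero_less_mult_iff)
qed

lemma D_add: "D (a + b) = D a * D b"
proof -
  obtain f :: "'a \<Rightarrow> real" where f: "cc f" "(\<integral>x. f x \<partial>M) > 0" using cc_integral_nonzero_exists by metis
  have "D (a + b) * (\<integral>x. f x \<partial>M) = (\<integral>t. f (t + (a + b)) \<partial>M)" by (simp add: integral_right_translate[OF f(1)])
  also have "\<dots> = (\<integral>t. f ((t + a) + b) \<partial>M)" by (simp add: add.assoc)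
  also have "\<dots> = D a * (\<integral>t. f (t + b) \<partial>M)"
    using integral_right_translate[OF cc_translate(2)[OF f(1), of b], of a] .
  also have "\<dots> = D a * D b * (\<integral>t. f t \<partial>M)" by (simp add: integral_right_translate[OF f(1)])
  finally show ?thesis using f by simp
qed

lemma D_0: "D 0 = 1"
  using D_add[of 0 0] D_pos[of 0] by simp

lemma D_uminus: "D (- a) = 1 / D a"
  using D_add[of a "-a"] D_pos[of a] D_0 by (simp add: field_simps)

lemma borel_measurable_D[measurable]: "D \<in> borel_measurable borel"
  by (rule borel_measurable_continuous_onI[OF continuous_D])

text \<open>With the proportionality factor \<open>D s\<close> put into the product formula, the
  integral of \<open>f\<close> is a common factor on both sides; \<open>f\<close> is chosen so that
  it can be cancelled.\<close>

lemma integral_uminus: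
  assumes g: "cc g" shows "(\<integral>t. g (- t) \<partial>M) = (\<integral>s. g s * D s \<partial>M)"
proof -
  obtain f :: "'a \<Rightarrow> real" where f: "cc f" "(\<integral>x. f x \<partial>M) > 0" using cc_integral_nonzero_exists by metis
  have "(\<integral>x. f x \<partial>M) * (\<integral>t. g (- t) \<partial>M) = (\<integral>s. (g s * D s) * (\<integral>x. f x \<partial>M) \<partial>M)"
    unfolding integral_product_translate[OF f(1) g] integral_right_translate[OF f(1)] by (simp add: mult.assoc)
  also have "\<dots> = (\<integral>s. g s * D s \<partial>M) * (\<integral>x. f x \<partial>M)" by simp
  finally show ?thesis using f by simp
qed

end

section \<open>Right translation and inversion of Borel sets, approximation by compact sets\<close>

context haar begin

lemma cc_translate_diff: "cc f \<Longrightarrow> cc (\<lambda>y::'a. f (y - x))"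
  using cc_translate(2)[of f "- x"] by simp

lemma right_translate_image: "(\<lambda>y::'a. y + x) ` A = (\<lambda>y. y + - x) -` A"
  by (auto simp: image_iff add.assoc intro!: bexI[of _ "_ + - x"])

lemma right_translate_borel: "A \<in> sets borel \<Longrightarrow> (\<lambda>y::'a. y + x) ` A \<in> sets borel"
  using measurable_sets[OF borel_measurable_translate(2)[of "- x"], of A] by (simp add: right_translate_image)

lemma open_right_translate: "open U \<Longrightarrow> open ((\<lambda>y::'a. y + x) ` U)"
  unfolding right_translate_image by (intro open_vimage continuous_intros)

lemma uminus_image: "uminus ` A = uminus -` (A :: 'a set)"
  by (auto simp: image_iff intro!: bexI[of _ "- _"])

lemma uminus_borel: "A \<in> sets borel \<Longrightarrow> uminus ` (A :: 'a set) \<in> sets borel"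
  using measurable_sets[OF borel_measurable_translate(3), of A] by (simp add: uminus_image)

lemma open_uminus: "open U \<Longrightarrow> open (uminus ` (U :: 'a set))"
  unfolding uminus_image by (intro open_vimage continuous_intros)

lemma emeasure_right_translate_le:
  assumes "open U" shows "emeasure M U \<le> ennreal (D x) * emeasure M ((\<lambda>y. y + x) ` U)"
  unfolding inner_regular[OF assms]
proof (rule SUP_least, clarsimp)
  fix K assume K: "compact K" "K \<subseteq> U"
  obtain f where f: "cc f" "\<And>x. 0 \<le> f x" "\<And>x. f x \<le> 1" "\<And>x. x \<in> K \<Longrightarrow> f x = 1" "\<And>x. x \<notin> U \<Longrightarrow> f x = 0"
    using cc_bump[OF K(1) assms K(2)] by blast
  have "emeasure M K \<le> ennreal (\<integral>y. f y \<partial>M)"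
    by (rule emeasure_le_integral_cc) (use f K in auto)
  also have "(\<integral>y. f y \<partial>M) = D x * (\<integral>y. f (y + - x) \<partial>M)"
    using integral_right_translate[OF f(1), of "- x"] D_pos[of x] by (simp add: D_uminus)
  also have "ennreal \<dots> = ennreal (D x) * ennreal (\<integral>y. f (y + - x) \<partial>M)"
    using D_pos[of x] f by (intro ennreal_mult) (auto simp: less_imp_le)
  also have "ennreal (\<integral>y. f (y + - x) \<partial>M) \<le> emeasure M ((\<lambda>y. y + x) ` U)"
    by (rule integral_cc_le_emeasure) (use f assms in \<open>auto simp: right_translate_image intro!: cc_translate_diff borel_open open_vimage continuous_intros\<close>)
  finally show "emeasure M K \<le> ennreal (D x) * emeasure M ((\<lambda>y. y + x) ` U)"
    by (simp add: mult_left_mono)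
qed

lemma D_mult_uminus: "ennreal (D x) * (ennreal (D (- x)) * c) = c" "ennreal (D (- x)) * (ennreal (D x) * c) = c"
proof -
  have "ennreal (D x) * ennreal (D (- x)) = 1"
    using D_pos[of x] D_pos[of "-x"] by (simp add: ennreal_mult[symmetric] D_uminus less_imp_le)
  then show "ennreal (D x) * (ennreal (D (- x)) * c) = c" "ennreal (D (- x)) * (ennreal (D x) * c) = c"
    by (metis mult.assoc mult.commute mult_1)+
qed

text \<open>Outer regularity carries the inequality from open sets to Borel sets; applied to the
  translated set and \<open>- x\<close>, it becomes the reverse inequality.\<close>

lemma emeasure_right_translate:
  assumes A: "A \<in> sets borel" shows "emeasure M ((\<lambda>y. y + x) ` A) = ennreal (D (- x)) * emeasure M A"
proof -
  have translate_back: "(\<lambda>y. y + - x) ` (\<lambda>y. y + x) ` A = A" for x :: 'a and A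
    by (simp add: image_image add.assoc)
  have 1: "emeasure M ((\<lambda>y. y + x) ` U) \<le> ennreal (D (- x)) * emeasure M U" if "open U" for U x
    using emeasure_right_translate_le[OF open_right_translate[OF that], of x "- x"] by (simp only: translate_back)
  have 2: "ennreal (D x) * emeasure M ((\<lambda>y. y + x) ` A) \<le> emeasure M A" if A: "A \<in> sets borel" for A x
    unfolding outer_regular[OF A]
  proof (rule INF_greatest, clarsimp)
    fix U assume U: "open U" "A \<subseteq> U"
    have "emeasure M ((\<lambda>y. y + x) ` A) \<le> emeasure M ((\<lambda>y. y + x) ` U)"
      using U by (intro emeasure_mono) (auto intro: right_translate_borel)
    also have "\<dots> \<le> ennreal (D (- x)) * emeasure M U" using 1[OF U(1)] .
    finally have "ennreal (D x) * emeasure M ((\<lambda>y. y + x) ` A) \<le> ennreal (D x) * (ennreal (D (- x)) * emeasure M U)"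
      by (rule mult_left_mono) simp
    then show "ennreal (D x) * emeasure M ((\<lambda>y. y + x) ` A) \<le> emeasure M U" by (simp add: D_mult_uminus)
  qed
  have "ennreal (D (- x)) * emeasure M ((\<lambda>y. y + - x) ` (\<lambda>y. y + x) ` A) \<le> emeasure M ((\<lambda>y. y + x) ` A)"
    by (rule 2) (rule right_translate_borel[OF A])
  then have "ennreal (D (- x)) * emeasure M A \<le> emeasure M ((\<lambda>y. y + x) ` A)" by (simp only: translate_back)
  moreover have "ennreal (D (- x)) * (ennreal (D x) * emeasure M ((\<lambda>y. y + x) ` A)) \<le> ennreal (D (- x)) * emeasure M A"
    by (intro mult_left_mono 2 A) simp
  ultimately show ?thesis by (simp add: D_mult_uminus)
qed

lemma modular_function_eq: "modular_function M x = D (- x)"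
  unfolding modular_function_def
proof (rule the_equality)
  show "0 < D (- x) \<and> (\<forall>E\<in>sets borel. emeasure M ((\<lambda>y. y + x) ` E) = ennreal (D (- x)) * emeasure M E)"
    using D_pos emeasure_right_translate by blast
  fix d assume d: "0 < d \<and> (\<forall>E\<in>sets borel. emeasure M ((\<lambda>y. y + x) ` E) = ennreal d * emeasure M E)"
  \<comment> \<open>Uniqueness of the factor needs a set whose measure is neither \<open>0\<close>
    nor \<open>\<infinity>\<close>; a relatively compact open set is one.\<close>
  obtain V C where V: "open V" "compact C" "{0::'a} \<subseteq> V" "V \<subseteq> C" using compact_neighbourhood[of "{0}"] by auto
  have "emeasure M V \<le> emeasure M C" using V borel_compact[OF V(2)] by (intro emeasure_mono) auto
  then have fin: "emeasure M V < \<infinity>" using emeasure_compact[OF V(2)] by (rule le_less_trans)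
  have pos: "emeasure M V > 0" using V by (intro emeasure_open_pos) auto
  have "ennreal d * emeasure M V = ennreal (D (- x)) * emeasure M V"
    using d V emeasure_right_translate[of V x] by (metis borel_open)
  moreover obtain v where v: "emeasure M V = ennreal v" "v > 0"
    using fin pos by (cases "emeasure M V") auto
  ultimately have "ennreal (d * v) = ennreal (D (- x) * v)"
    using d D_pos[of "-x"] by (simp add: ennreal_mult less_imp_le)
  then show "d = D (- x)" using d v D_pos[of "-x"] by (simp add: less_imp_le)
qed

lemma inner_regular_open:
  assumes U: "open U" "emeasure M U < \<infinity>" and d: "(d::real) > 0"
  obtains K where "compact K" "K \<subseteq> U" "emeasure M U \<le> emeasure M K + ennreal d"
proof (cases "emeasure M U \<le> ennreal d")
  case True then show ?thesis by (intro that[of "{}"]) auto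
next
  case False
  then have "emeasure M U \<noteq> 0" by auto
  then have "emeasure M U - ennreal d < emeasure M U"
    using U d by (intro ennreal_between) (auto simp: less_top zero_less_iff_neq_zero)
  then obtain K where "compact K" "K \<subseteq> U" "emeasure M U - ennreal d < emeasure M K"
    by (subst (asm) (2) inner_regular[OF U(1)]) (auto simp: less_SUP_iff)
  moreover from this(3) have "emeasure M U \<le> ennreal d + emeasure M K"
    using ennreal_minus_le_iff less_imp_le by blast
  ultimately show ?thesis by (intro that[of K]) (simp_all add: add.commute)
qed

text \<open>The two sides, \<open>A\<close> and \<open>B\<close>, are compared inside a relatively
  compact open \<open>U0\<close>, on which \<open>D\<close> is bounded. Test functions and inner
  regularity give \<open>A \<le> B\<close> on open sets and equality on \<open>U0\<close>; outer
  regularity extends \<open>A \<le> B\<close> to Borel subsets of \<open>U0\<close>. The same bound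
  for the complement in \<open>U0\<close>, together with the finite total, forces equality.\<close>

lemma emeasure_uminus_eq:
  fixes C :: "'a set"
  assumes C: "compact C" and E: "E \<in> sets borel" "E \<subseteq> C"
  shows "emeasure M (uminus ` E) = (\<integral>\<^sup>+y. ennreal (D y) * indicator E y \<partial>M)"
proof -
  obtain U0 C0 where U0: "open U0" "compact C0" "C \<subseteq> U0" "U0 \<subseteq> C0" using compact_neighbourhood[OF C] .
  obtain b where b: "\<And>y. y \<in> C0 \<Longrightarrow> D y \<le> b" "b > 0"
  proof -
    have "compact (D ` C0)" using U0(2) continuous_D by (meson compact_continuous_image continuous_on_subset subset_UNIV)
    then obtain b where "\<And>y. y \<in> D ` C0 \<Longrightarrow> norm y \<le> b" using compact_imp_bounded bounded_iff by metis
    then show thesis by (intro that[of "max b 1"]) (auto simp: abs_le_iff le_max_iff_disj)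
  qed
  define A where "A E = emeasure M (uminus ` E)" for E :: "'a set"
  define B where "B E = (\<integral>\<^sup>+y. ennreal (D y) * indicator E y \<partial>M)" for E
  have Bmono: "E \<subseteq> F \<Longrightarrow> B E \<le> B F" for E F
    unfolding B_def by (intro nn_integral_mono) (auto simp: indicator_def)
  have Amono: "E \<subseteq> F \<Longrightarrow> F \<in> sets borel \<Longrightarrow> A E \<le> A F" for E F
    unfolding A_def by (intro emeasure_mono) (auto intro: uminus_borel)
  have Badd: "B F = B E + B (F - E)" if "E \<subseteq> F" "E \<in> sets borel" "F \<in> sets borel" for E F
  proof -
    have "B F = (\<integral>\<^sup>+y. ennreal (D y) * indicator E y + ennreal (D y) * indicator (F - E) y \<partial>M)"
      unfolding B_def using that(1) by (intro nn_integral_cong) (auto simp: indicator_def)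
    also have "\<dots> = B E + B (F - E)" unfolding B_def using that by (intro nn_integral_add) auto
    finally show ?thesis .
  qed
  have Aadd: "A F = A E + A (F - E)" if "E \<subseteq> F" "E \<in> sets borel" "F \<in> sets borel" for E F
  proof -
    have "uminus ` F = uminus ` E \<union> uminus ` (F - E)" using that by auto
    then show ?thesis unfolding A_def using that uminus_borel[of E] uminus_borel[of "F - E"]
      by (subst plus_emeasure) auto
  qed
  have Bb: "B E \<le> ennreal b * emeasure M E" if "E \<subseteq> C0" "E \<in> sets borel" for E
  proof -
    have "B E \<le> (\<integral>\<^sup>+y. ennreal b * indicator E y \<partial>M)"
      unfolding B_def by (intro nn_integral_mono) (use that b in \<open>auto simp: indicator_def ennreal_leI\<close>)
    also have "\<dots> = ennreal b * emeasure M E" using that by (subst nn_integral_cmult_indicator) auto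
    finally show ?thesis .
  qed
  have fin: "emeasure M E < \<infinity>" if "E \<subseteq> C0" for E
    using emeasure_mono[of E C0 M] that borel_compact[OF U0(2)] emeasure_compact[OF U0(2)] by (auto intro: le_less_trans)
  have ccD: "cc (\<lambda>y. f y * D y)" if "cc f" for f using that continuous_D by (rule cc_mult_right)
  have 1: "A U \<le> B U" if U: "open U" for U
    unfolding A_def inner_regular[OF open_uminus[OF U]]
  proof (rule SUP_least, clarsimp)
    fix K assume K: "compact K" "K \<subseteq> uminus ` U"
    have K': "compact (uminus ` K)" "uminus ` K \<subseteq> U" using K compact_uminus_image by auto
    obtain f where f: "cc f" "\<And>x. 0 \<le> f x" "\<And>x. f x \<le> 1" "\<And>x. x \<in> uminus ` K \<Longrightarrow> f x = 1" "\<And>x. x \<notin> U \<Longrightarrow> f x = 0"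
      using cc_bump[OF K'(1) U K'(2)] by blast
    have "emeasure M K \<le> ennreal (\<integral>y. f (- y) \<partial>M)"
      by (rule emeasure_le_integral_cc) (use f K in \<open>auto intro: cc_translate\<close>)
    also have "\<dots> = ennreal (\<integral>y. f y * D y \<partial>M)" by (simp add: integral_uminus[OF f(1)])
    also have "\<dots> = (\<integral>\<^sup>+y. ennreal (f y * D y) \<partial>M)"
      using f D_pos by (intro nn_integral_eq_integral[symmetric] integrable_Cc ccD) (auto simp: less_imp_le)
    also have "\<dots> \<le> B U" unfolding B_def
      using f D_pos by (intro nn_integral_mono) (auto simp: indicator_def ennreal_leI less_imp_le mult_left_le_one_le)
    finally show "emeasure M K \<le> B U" .
  qed
  have 2: "B U0 \<le> A U0"
  proof (rule ennreal_le_epsilon)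
    fix e :: real assume e: "e > 0"
    have m: "emeasure M U0 < \<infinity>" using U0 by (intro fin)
    obtain K where K: "compact K" "K \<subseteq> U0" "emeasure M U0 \<le> emeasure M K + ennreal (e / b)"
      using inner_regular_open[OF U0(1) m, of "e / b"] e b by auto
    obtain f where f: "cc f" "\<And>x. 0 \<le> f x" "\<And>x. f x \<le> 1" "\<And>x. x \<in> K \<Longrightarrow> f x = 1" "\<And>x. x \<notin> U0 \<Longrightarrow> f x = 0"
      using cc_bump[OF K(1) U0(1) K(2)] by blast
    have "B K \<le> (\<integral>\<^sup>+y. ennreal (f y * D y) \<partial>M)" unfolding B_def
      by (intro nn_integral_mono) (use f in \<open>auto simp: indicator_def\<close>)
    also have "\<dots> = ennreal (\<integral>y. f y * D y \<partial>M)"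
      using f D_pos by (intro nn_integral_eq_integral integrable_Cc ccD) (auto simp: less_imp_le)
    also have "\<dots> = ennreal (\<integral>y. f (- y) \<partial>M)" by (simp add: integral_uminus[OF f(1)])
    also have "\<dots> \<le> A U0" unfolding A_def
      by (rule integral_cc_le_emeasure) (use f U0 borel_open[OF open_uminus[OF U0(1)]] in \<open>auto intro: cc_translate simp: uminus_image\<close>)
    finally have BK: "B K \<le> A U0" .
    have Kb: "K \<in> sets borel" using borel_compact K by blast
    have "emeasure M (U0 - K) = emeasure M U0 - emeasure M K"
      using K fin[of K] U0 Kb by (intro emeasure_Diff) (auto simp: less_top)
    also have "\<dots> \<le> ennreal (e / b)"
      using K(3) m by (auto simp: ennreal_minus_le_iff less_top)
    finally have d: "emeasure M (U0 - K) \<le> ennreal (e / b)" .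
    have "B U0 = B K + B (U0 - K)" using K Kb U0 by (intro Badd) auto
    also have "B (U0 - K) \<le> ennreal b * ennreal (e / b)"
      using U0 Kb d by (intro order_trans[OF Bb] mult_left_mono) auto
    also have "\<dots> = ennreal e" using e b by (simp add: ennreal_mult[symmetric])
    finally show "B U0 \<le> A U0 + ennreal e" using BK by (meson add_mono order_refl order_trans)
  qed
  have 3: "A E \<le> B E" if E: "E \<in> sets borel" "E \<subseteq> U0" for E
  proof (rule ennreal_le_epsilon)
    fix e :: real assume e: "e > 0"
    have m: "emeasure M E < \<infinity>" using E U0 by (intro fin) auto
    then have "emeasure M E < emeasure M E + ennreal (e / b)" using e b by (simp add: less_top)
    then obtain U where U: "open U" "E \<subseteq> U" "emeasure M U < emeasure M E + ennreal (e / b)"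
      by (subst (asm) outer_regular[OF E(1)]) (auto simp: INF_less_iff)
    define W where "W = U \<inter> U0"
    have W: "open W" "E \<subseteq> W" "W \<subseteq> U0" using U U0 E by (auto simp: W_def)
    have "emeasure M W \<le> emeasure M U" using U by (intro emeasure_mono) (auto simp: W_def)
    with U have mW: "emeasure M W \<le> emeasure M E + ennreal (e / b)" by (meson le_less_trans less_imp_le)
    have "emeasure M (W - E) = emeasure M W - emeasure M E"
      using W E m by (intro emeasure_Diff) (auto simp: less_top)
    also have "\<dots> \<le> ennreal (e / b)" using mW m by (auto simp: ennreal_minus_le_iff less_top)
    finally have d: "emeasure M (W - E) \<le> ennreal (e / b)" .
    have "A E \<le> A W" using W by (intro Amono) auto
    also have "\<dots> \<le> B W" by (rule 1[OF W(1)])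
    also have "B W = B E + B (W - E)" using W E by (intro Badd) auto
    also have "B (W - E) \<le> ennreal b * ennreal (e / b)"
      using U0 E W d by (intro order_trans[OF Bb] mult_left_mono) auto
    also have "\<dots> = ennreal e" using e b by (simp add: ennreal_mult[symmetric])
    finally show "A E \<le> B E + ennreal e" by simp
  qed
  have E0: "E \<subseteq> U0" using E U0 by auto
  have finB: "B U0 < \<infinity>"
    using Bb[of U0] fin[of U0] U0 b by (auto intro!: le_less_trans[OF Bb] simp: ennreal_mult_less_top)
  have BUA: "B U0 = A U0" using 1[OF U0(1)] 2 by (rule antisym[rotated])
  have "B E + B (U0 - E) = A E + A (U0 - E)"
    using BUA Badd[OF E0 E(1)] Aadd[OF E0 E(1)] U0 by simp
  also have "\<dots> \<le> A E + B (U0 - E)" using E U0 by (intro add_left_mono 3) auto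
  finally have "B E \<le> A E"
    using finB Bmono[of "U0 - E" U0] by (subst (asm) add.commute, subst (asm) (2) add.commute)
      (auto simp: ennreal_add_left_cancel_le top_unique)
  with 3[OF E(1) E0] have "A E = B E" by simp
  then show ?thesis by (simp add: A_def B_def)
qed

lemma nn_integral_uminus:
  fixes f :: "'a \<Rightarrow> ennreal"
  assumes f[measurable]: "f \<in> borel_measurable borel" and C: "compact C" "\<And>x. x \<notin> C \<Longrightarrow> f x = 0"
  shows "(\<integral>\<^sup>+y. f (- y) \<partial>M) = (\<integral>\<^sup>+y. f y * ennreal (D y) \<partial>M)"
proof -
  have [measurable]: "C \<in> sets borel" using C borel_compact by blast
  define \<alpha> where "\<alpha> = density (distr M borel uminus) (indicator C)"
  define \<beta> where "\<beta> = density M (\<lambda>y. indicator C y * ennreal (D y))"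
  have "\<alpha> = \<beta>"
  proof (rule measure_eqI)
    show "sets \<alpha> = sets \<beta>" by (simp add: \<alpha>_def \<beta>_def)
    fix A assume "A \<in> sets \<alpha>"
    then have A[measurable]: "A \<in> sets borel" by (simp add: \<alpha>_def)
    have "emeasure \<alpha> A = emeasure M (uminus -` (A \<inter> C))"
      unfolding \<alpha>_def
      by (simp add: emeasure_density indicator_inter_arith[symmetric] mult.commute emeasure_distr del: vimage_Int)
    also have "\<dots> = emeasure M (uminus ` (A \<inter> C))" by (simp add: uminus_image)
    also have "\<dots> = (\<integral>\<^sup>+y. ennreal (D y) * indicator (A \<inter> C) y \<partial>M)"
      by (rule emeasure_uminus_eq[OF C(1)]) auto
    also have "\<dots> = emeasure \<beta> A" unfolding \<beta>_def
      by (subst emeasure_density) (auto intro!: nn_integral_cong simp: indicator_def)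
    finally show "emeasure \<alpha> A = emeasure \<beta> A" .
  qed
  then have "(\<integral>\<^sup>+y. f y \<partial>\<alpha>) = (\<integral>\<^sup>+y. f y \<partial>\<beta>)" by simp
  moreover have "(\<integral>\<^sup>+y. f y \<partial>\<alpha>) = (\<integral>\<^sup>+y. indicator C (- y) * f (- y) \<partial>M)"
    unfolding \<alpha>_def by (simp add: nn_integral_density nn_integral_distr)
  moreover have "\<dots> = (\<integral>\<^sup>+y. f (- y) \<partial>M)"
    by (rule nn_integral_cong) (use C in \<open>auto simp: indicator_def\<close>)
  moreover have "(\<integral>\<^sup>+y. f y \<partial>\<beta>) = (\<integral>\<^sup>+y. f y * ennreal (D y) \<partial>M)"
    unfolding \<beta>_def by (simp add: nn_integral_density) (rule nn_integral_cong, use C in \<open>auto simp: indicator_def mult_ac\<close>)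
  ultimately show ?thesis by simp
qed

text \<open>On a compact set the inverse measure has density \<open>D\<close>, so inversion keeps
  the relevant part of \<open>N\<close> null, and a left translation does no harm.\<close>

lemma AE_compact_inverse_translate:
  assumes N: "N \<in> null_sets M" and C: "compact C"
  shows "AE y in M. y \<in> C \<longrightarrow> - y + x \<notin> N"
proof -
  define C' where "C' = (\<lambda>z. - x + z) ` C"
  have C': "compact C'" unfolding C'_def by (intro compact_continuous_image C continuous_intros)
  have [measurable]: "N \<in> sets borel" "C' \<in> sets borel" "uminus ` C' \<in> sets borel"
    using N borel_compact[OF C'] borel_compact[OF compact_uminus_image[OF C']] by auto
  have "(\<integral>\<^sup>+y. indicator (N \<inter> uminus ` C') (- y) \<partial>M) = (\<integral>\<^sup>+y. indicator (N \<inter> uminus ` C') y * ennreal (D y) \<partial>M)"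
    by (rule nn_integral_uminus[OF _ compact_uminus_image[OF C']]) auto
  also have "\<dots> = (\<integral>\<^sup>+y. 0 \<partial>M)"
    by (rule nn_integral_cong_AE) (use AE_not_in[OF N] in \<open>auto elim!: eventually_mono simp: indicator_def\<close>)
  finally have "(\<integral>\<^sup>+y. indicator (N \<inter> uminus ` C') (- y) \<partial>M) = 0" by simp
  moreover have "(\<integral>\<^sup>+y. indicator (N \<inter> uminus ` C') (- y) \<partial>M) = (\<integral>\<^sup>+y. indicator (N \<inter> uminus ` C') (- (- x + y)) \<partial>M)"
    by (rule nn_integral_left_translate[symmetric]) measurable
  ultimately have "(\<integral>\<^sup>+y. indicator (N \<inter> uminus ` C') (- (- x + y)) \<partial>M) = 0" by metis
  then have "AE y in M. indicator (N \<inter> uminus ` C') (- (- x + y)) = (0::ennreal)"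
    by (subst (asm) nn_integral_0_iff_AE) auto
  then show ?thesis
    by eventually_elim (auto simp: indicator_def minus_add C'_def image_iff split: if_splits)
qed

text \<open>Inner regularity is assumed for open sets only. A compact \<open>C\<close> that nearly
  fills an open \<open>U\<close> around \<open>E\<close> may stick out of \<open>E\<close>; removing
  a small open \<open>W\<close> around \<open>U - E\<close> keeps it compact and pushes it into
  \<open>E\<close>. The loss is at most \<open>d\<close> from \<open>C\<close> and
  \<open>2 * d\<close> from \<open>W\<close>.\<close>

lemma inner_regular_compact:
  assumes E: "E \<in> sets borel" "emeasure M E < \<infinity>" and e: "(e::real) > 0"
  obtains K where "compact K" "K \<subseteq> E" "emeasure M (E - K) \<le> ennreal e"
proof -
  define d where "d = e / 3"
  have d: "d > 0" using e by (simp add: d_def)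
  have "emeasure M E < emeasure M E + ennreal d" using E d by (simp add: less_top)
  then obtain U where U: "open U" "E \<subseteq> U" "emeasure M U < emeasure M E + ennreal d"
    by (subst (asm) outer_regular[OF E(1)]) (auto simp: INF_less_iff)
  have Uf: "emeasure M U < \<infinity>" using U(3) by (rule less_trans) (use E in \<open>simp add: less_top\<close>)
  have UE: "emeasure M (U - E) \<le> ennreal d"
    using U E by (subst emeasure_Diff) (auto simp: less_top ennreal_minus_le_iff less_imp_le)
  then have "emeasure M (U - E) < ennreal (2 * d)" by (rule le_less_trans) (use d in \<open>simp add: ennreal_less_iff\<close>)
  then obtain W where W: "open W" "U - E \<subseteq> W" "emeasure M W < ennreal (2 * d)"
    using U E by (subst (asm) outer_regular) (auto simp: INF_less_iff)
  obtain C where C: "compact C" "C \<subseteq> U" "emeasure M U \<le> emeasure M C + ennreal d"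
    using inner_regular_open[OF U(1) Uf d] .
  have Cb: "C \<in> sets borel" using C borel_compact by blast
  have UC: "emeasure M (U - C) \<le> ennreal d"
    using U C Cb emeasure_compact[OF C(1)] by (subst emeasure_Diff) (auto simp: less_top ennreal_minus_le_iff)
  have K: "compact (C - W)" using C W by (simp add: compact_diff)
  have "emeasure M (E - (C - W)) \<le> emeasure M ((U - C) \<union> W)"
    using U W C Cb by (intro emeasure_mono) auto
  also have "\<dots> \<le> emeasure M (U - C) + emeasure M W" using U W Cb by (intro emeasure_subadditive) auto
  also have "\<dots> \<le> ennreal d + ennreal (2 * d)" using UC W(3) by (intro add_mono) auto
  also have "\<dots> = ennreal e" using d by (simp add: ennreal_plus[symmetric] d_def)
  finally show thesis using K U W C by (intro that[of "C - W"]) auto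
qed

lemma finite_measure_sigma_compact:
  assumes E: "E \<in> sets borel" "emeasure M E < \<infinity>"
  obtains K :: "nat \<Rightarrow> 'a set" where "\<And>n. compact (K n)" "\<And>n. K n \<subseteq> E" "incseq K" "E - (\<Union>n. K n) \<in> null_sets M"
proof -
  have "\<exists>K. compact K \<and> K \<subseteq> E \<and> emeasure M (E - K) \<le> ennreal (1 / real (Suc n))" for n
    using inner_regular_compact[OF E, of "1 / real (Suc n)"] by (metis of_nat_0_less_iff zero_less_Suc zero_less_divide_1_iff)
  then obtain L where L: "\<And>n. compact (L n)" "\<And>n. L n \<subseteq> E" "\<And>n. emeasure M (E - L n) \<le> ennreal (1 / real (Suc n))" by metis
  have Lb: "L n \<in> sets borel" for n using L borel_compact by blast
  define K where "K n = (\<Union>i\<le>n. L i)" for n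
  have UK: "(\<Union>n. K n) = (\<Union>n. L n)" by (auto simp: K_def)
  have "emeasure M (E - (\<Union>n. K n)) \<le> 0"
  proof (rule ennreal_le_epsilon)
    fix e :: real assume "e > 0"
    then obtain n where n: "1 / real (Suc n) < e" using nat_approx_posE by metis
    have "emeasure M (E - (\<Union>n. K n)) \<le> emeasure M (E - L n)" unfolding UK using E Lb by (intro emeasure_mono) auto
    also have "\<dots> \<le> ennreal (1 / real (Suc n))" by (rule L)
    also have "\<dots> \<le> ennreal e" using n by (intro ennreal_leI) simp
    finally show "emeasure M (E - (\<Union>n. K n)) \<le> 0 + ennreal e" by simp
  qed
  then have "E - (\<Union>n. K n) \<in> null_sets M" using E Lb by (auto simp: UK intro!: null_setsI)
  then show thesis using L by (intro that[of K]) (auto simp: K_def incseq_def intro!: compact_UN, fastforce)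
qed

end

subsection \<open>Tonelli's theorem for convolutions\<close>

context haar begin

text \<open>Takes the place of sigma-finiteness of the measure: every function some power of which
  has a finite integral satisfies it, whatever the group.\<close>

definition sigma_finite_support :: "('a \<Rightarrow> 'b::zero) \<Rightarrow> bool" where
  "sigma_finite_support f \<longleftrightarrow>
     (\<exists>A::nat \<Rightarrow> 'a set. (\<forall>n. A n \<in> sets borel \<and> emeasure M (A n) < \<infinity>) \<and> {x. f x \<noteq> 0} \<subseteq> (\<Union>n. A n))"

lemma sigma_finite_support_mono:
  assumes "sigma_finite_support f" "\<And>x. g x \<noteq> 0 \<Longrightarrow> f x \<noteq> 0"
  shows "sigma_finite_support g"
proof -
  obtain A where "\<forall>n::nat. A n \<in> sets borel \<and> emeasure M (A n) < \<infinity>" "{x. f x \<noteq> 0} \<subseteq> (\<Union>n. A n)"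
    using assms(1) unfolding sigma_finite_support_def by (elim exE conjE)
  then show ?thesis unfolding sigma_finite_support_def
    using assms(2) by (intro exI[of _ A] conjI) auto
qed

lemma sigma_finite_support_of_nn_integral:
  assumes f[measurable]: "f \<in> borel_measurable borel" and fin: "(\<integral>\<^sup>+x. f x \<partial>M) < \<infinity>"
  shows "sigma_finite_support f"
proof -
  define A where "A n = {x \<in> space M. 1 \<le> of_nat (Suc n) * f x}" for n
  have "emeasure M (A n) < \<infinity>" for n
  proof -
    have "emeasure M ({x \<in> UNIV. 1 \<le> of_nat (Suc n) * f x}) \<le> of_nat (Suc n) * (\<integral>\<^sup>+x. f x * indicator UNIV x \<partial>M)"
      by (rule nn_integral_Markov_inequality) auto
    also have "\<dots> < \<infinity>" using fin by (simp add: ennreal_mult_less_top of_nat_less_top)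
    finally show ?thesis by (simp add: A_def)
  qed
  moreover have "{x. f x \<noteq> 0} \<subseteq> (\<Union>n. A n)"
  proof
    fix x assume "x \<in> {x. f x \<noteq> 0}"
    then have x: "f x \<noteq> 0" by simp
    show "x \<in> (\<Union>n. A n)"
    proof (cases "f x = \<infinity>")
      case True
      then show ?thesis by (auto simp: A_def ennreal_mult_top)
    next
      case False
      then obtain r where r: "f x = ennreal r" "r > 0" using x by (cases "f x") auto
      obtain n where "1 / real (Suc n) < r" using nat_approx_posE[OF r(2)] by metis
      then have "1 \<le> real (Suc n) * r" by (simp add: field_simps)
      then have "1 \<le> of_nat (Suc n) * f x"
        using r by (simp add: ennreal_of_nat_eq_real_of_nat ennreal_mult[symmetric] del: of_nat_Suc)
      then show ?thesis by (auto simp: A_def)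
    qed
  qed
  moreover have "A n \<in> sets borel" for n unfolding A_def by simp
  ultimately show ?thesis unfolding sigma_finite_support_def by blast
qed

lemma sigma_finite_support_compacts:
  assumes "sigma_finite_support f"
  obtains K where "\<And>n::nat. compact (K n)" "incseq K" "AE x in M. f x \<noteq> 0 \<longrightarrow> x \<in> (\<Union>n. K n)"
proof -
  obtain A :: "nat \<Rightarrow> 'a set" where A: "\<And>n. A n \<in> sets borel" "\<And>n. emeasure M (A n) < \<infinity>" "{x. f x \<noteq> 0} \<subseteq> (\<Union>n. A n)"
    using assms unfolding sigma_finite_support_def by blast
  have "\<exists>K::nat \<Rightarrow> 'a set. (\<forall>m. compact (K m)) \<and> A n - (\<Union>m. K m) \<in> null_sets M" for n
    using finite_measure_sigma_compact[OF A(1,2)] by metis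
  then obtain L :: "nat \<Rightarrow> nat \<Rightarrow> 'a set" where L: "\<And>n m. compact (L n m)" "\<And>n. A n - (\<Union>m. L n m) \<in> null_sets M" by metis
  define K where "K n = (\<Union>i\<le>n. \<Union>j\<le>n. L i j)" for n
  have LK: "L i j \<subseteq> K (max i j)" for i j unfolding K_def by force
  show thesis
  proof (rule that[of K])
    show "compact (K n)" for n unfolding K_def using L by (intro compact_UN) auto
    show "incseq K" unfolding incseq_def K_def by fastforce
    have "AE x in M. \<forall>n. x \<notin> A n - (\<Union>m. L n m)"
      unfolding AE_all_countable using AE_not_in[OF L(2)] by simp
    then show "AE x in M. f x \<noteq> 0 \<longrightarrow> x \<in> (\<Union>n. K n)"
    proof eventually_elim
      case (elim x)
      show ?case
      proof
        assume "f x \<noteq> 0"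
        then obtain n where "x \<in> A n" using A(3) by auto
        with elim obtain m where "x \<in> L n m" by auto
        then show "x \<in> (\<Union>n. K n)" using LK by auto
      qed
    qed
  qed
qed

text \<open>
  The inverse of a null set is in general only locally null, whence the assumption on the support.
\<close>

lemma AE_inverse_translate:
  assumes "sigma_finite_support f" "N \<in> null_sets M"
  shows "AE y in M. f y \<noteq> 0 \<longrightarrow> - y + x \<notin> N"
proof -
  obtain K where K: "\<And>n::nat. compact (K n)" "incseq K" "AE x in M. f x \<noteq> 0 \<longrightarrow> x \<in> (\<Union>n. K n)"
    using sigma_finite_support_compacts[OF assms(1)] by metis
  have "AE y in M. \<forall>n. y \<in> K n \<longrightarrow> - y + x \<notin> N"
    unfolding AE_all_countable using AE_compact_inverse_translate[OF assms(2) K(1)] by simp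
  with K(3) show ?thesis by eventually_elim auto
qed

definition conv_nn :: "('a \<Rightarrow> ennreal) \<Rightarrow> ('a \<Rightarrow> ennreal) \<Rightarrow> 'a \<Rightarrow> ennreal" where
  "conv_nn g f x = (\<integral>\<^sup>+y. g y * f (- y + x) \<partial>M)"

text \<open>Measurability and the product formula are bundled because neither can be obtained from a
  product measure here; together they pass through sums, multiples and monotone limits in either
  argument.\<close>

definition tonelli :: "('a \<Rightarrow> ennreal) \<Rightarrow> ('a \<Rightarrow> ennreal) \<Rightarrow> bool" where
  "tonelli g f \<longleftrightarrow> conv_nn g f \<in> borel_measurable borel \<and>
     (\<integral>\<^sup>+x. conv_nn g f x \<partial>M) = (\<integral>\<^sup>+x. g x \<partial>M) * (\<integral>\<^sup>+x. f x \<partial>M)"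

lemma borel_measurable_inverse_translate[measurable]: "(\<lambda>y::'a. - y + x) \<in> borel_measurable borel"
  by (intro borel_measurable_continuous_onI continuous_intros)

lemma conv_nn_cong_right:
  assumes "sigma_finite_support g" "AE x in M. f x = f' x"
  shows "conv_nn g f = conv_nn g f'"
proof
  fix x
  obtain N where N: "N \<in> null_sets M" "\<And>x. x \<notin> N \<Longrightarrow> f x = f' x"
    using assms(2) by (auto elim!: AE_E3)
  show "conv_nn g f x = conv_nn g f' x" unfolding conv_nn_def
    by (rule nn_integral_cong_AE) (use AE_inverse_translate[OF assms(1) N(1), of x] N(2) in \<open>auto elim!: eventually_mono\<close>)
qed

lemma tonelli_cong_right:
  assumes "sigma_finite_support g" "AE x in M. f x = f' x" "tonelli g f"
  shows "tonelli g f'"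
  using assms conv_nn_cong_right[OF assms(1,2)] nn_integral_cong_AE[OF assms(2)] by (simp add: tonelli_def)

lemma conv_nn_cong_left:
  assumes "AE x in M. g x = g' x"
  shows "conv_nn g f = conv_nn g' f"
proof
  fix x
  show "conv_nn g f x = conv_nn g' f x" unfolding conv_nn_def
    by (rule nn_integral_cong_AE) (use assms in \<open>auto elim!: eventually_mono\<close>)
qed

lemma tonelli_cong_left:
  assumes "AE x in M. g x = g' x" "tonelli g f"
  shows "tonelli g' f"
  using assms conv_nn_cong_left[OF assms(1)] nn_integral_cong_AE[OF assms(1)] by (simp add: tonelli_def)

lemma tonelli_SUP_right:
  assumes g[measurable]: "g \<in> borel_measurable borel" and f[measurable]: "\<And>n. f n \<in> borel_measurable borel"
    and inc: "incseq (f :: nat \<Rightarrow> 'a \<Rightarrow> ennreal)" and t: "\<And>n. tonelli g (f n)"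
  shows "tonelli g (\<lambda>x. SUP n. f n x)"
proof -
  have mono: "f m x \<le> f n x" if "m \<le> n" for m n x using inc that by (auto simp: incseq_def le_fun_def)
  have eq: "conv_nn g (\<lambda>x. SUP n. f n x) x = (SUP n. conv_nn g (f n) x)" for x
  proof -
    have "conv_nn g (\<lambda>x. SUP n. f n x) x = (\<integral>\<^sup>+y. (SUP n. g y * f n (- y + x)) \<partial>M)"
      unfolding conv_nn_def by (simp add: SUP_mult_left_ennreal)
    also have "\<dots> = (SUP n. conv_nn g (f n) x)"
      unfolding conv_nn_def by (intro nn_integral_monotone_convergence_SUP) (auto simp: incseq_def le_fun_def intro!: mult_left_mono mono)
    finally show ?thesis .
  qed
  have [measurable]: "conv_nn g (f n) \<in> borel_measurable borel" for n using t by (simp add: tonelli_def)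
  have inc': "incseq (\<lambda>n. conv_nn g (f n))"
    by (auto simp: incseq_def le_fun_def conv_nn_def intro!: nn_integral_mono mult_left_mono mono)
  have "conv_nn g (\<lambda>x. SUP n. f n x) \<in> borel_measurable borel" unfolding eq[abs_def] by measurable
  moreover have "(\<integral>\<^sup>+x. conv_nn g (\<lambda>x. SUP n. f n x) x \<partial>M) = (SUP n. (\<integral>\<^sup>+x. conv_nn g (f n) x \<partial>M))"
    unfolding eq by (intro nn_integral_monotone_convergence_SUP inc') simp
  moreover have "\<dots> = (SUP n. (\<integral>\<^sup>+x. g x \<partial>M) * (\<integral>\<^sup>+x. f n x \<partial>M))" using t by (simp add: tonelli_def)
  moreover have "\<dots> = (\<integral>\<^sup>+x. g x \<partial>M) * (\<integral>\<^sup>+x. (SUP n. f n x) \<partial>M)"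
    by (subst nn_integral_monotone_convergence_SUP[OF inc]) (simp_all add: SUP_mult_left_ennreal)
  ultimately show ?thesis by (simp add: tonelli_def)
qed

lemma tonelli_SUP_left:
  assumes g[measurable]: "\<And>n. g n \<in> borel_measurable borel" and f[measurable]: "f \<in> borel_measurable borel"
    and inc: "incseq (g :: nat \<Rightarrow> 'a \<Rightarrow> ennreal)" and t: "\<And>n. tonelli (g n) f"
  shows "tonelli (\<lambda>x. SUP n. g n x) f"
proof -
  have mono: "g m x \<le> g n x" if "m \<le> n" for m n x using inc that by (auto simp: incseq_def le_fun_def)
  have eq: "conv_nn (\<lambda>x. SUP n. g n x) f x = (SUP n. conv_nn (g n) f x)" for x
  proof -
    have "conv_nn (\<lambda>x. SUP n. g n x) f x = (\<integral>\<^sup>+y. (SUP n. g n y * f (- y + x)) \<partial>M)"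
      unfolding conv_nn_def by (simp add: SUP_mult_right_ennreal)
    also have "\<dots> = (SUP n. conv_nn (g n) f x)"
      unfolding conv_nn_def by (intro nn_integral_monotone_convergence_SUP) (auto simp: incseq_def le_fun_def intro!: mult_right_mono mono)
    finally show ?thesis .
  qed
  have [measurable]: "conv_nn (g n) f \<in> borel_measurable borel" for n using t by (simp add: tonelli_def)
  have inc': "incseq (\<lambda>n. conv_nn (g n) f)"
    by (auto simp: incseq_def le_fun_def conv_nn_def intro!: nn_integral_mono mult_right_mono mono)
  have "conv_nn (\<lambda>x. SUP n. g n x) f \<in> borel_measurable borel" unfolding eq[abs_def] by measurable
  moreover have "(\<integral>\<^sup>+x. conv_nn (\<lambda>x. SUP n. g n x) f x \<partial>M) = (SUP n. (\<integral>\<^sup>+x. conv_nn (g n) f x \<partial>M))"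
    unfolding eq by (intro nn_integral_monotone_convergence_SUP inc') simp
  moreover have "\<dots> = (SUP n. (\<integral>\<^sup>+x. g n x \<partial>M) * (\<integral>\<^sup>+x. f x \<partial>M))" using t by (simp add: tonelli_def)
  moreover have "\<dots> = (\<integral>\<^sup>+x. (SUP n. g n x) \<partial>M) * (\<integral>\<^sup>+x. f x \<partial>M)"
    by (subst nn_integral_monotone_convergence_SUP[OF inc]) (simp_all add: SUP_mult_right_ennreal)
  ultimately show ?thesis by (simp add: tonelli_def)
qed

text \<open>With \<open>g\<close> turned into a density, the convolution is a parameter integral of
  a continuous function, hence again in \<open>cc\<close>. The bump \<open>b\<close>, equal to
  \<open>1\<close> on \<open>C\<close>, gives the integrand compact support in both variables, so
  that Fubini and left invariance apply.\<close>

lemma tonelli_cc: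
  assumes g[measurable]: "g \<in> borel_measurable borel" and fin: "(\<integral>\<^sup>+x. g x \<partial>M) < \<infinity>"
    and C: "compact C" "\<And>x. x \<notin> C \<Longrightarrow> g x = 0" and f: "cc f" "\<And>x. 0 \<le> f x"
  shows "tonelli g (\<lambda>x. ennreal (f x))"
proof -
  obtain K where K: "compact K" "\<And>x. x \<notin> K \<Longrightarrow> f x = 0" using ccE[OF f(1)] by metis
  obtain b :: "'a \<Rightarrow> real" where b: "cc b" "\<And>x. 0 \<le> b x" "\<And>x. b x \<le> 1" "\<And>x. x \<in> C \<Longrightarrow> b x = 1"
    using cc_bump[OF C(1) open_UNIV] by auto
  obtain L where L: "compact L" "\<And>x. x \<notin> L \<Longrightarrow> b x = 0" using ccE[OF b(1)] by metis
  define N where "N = density M g"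
  have sN: "sets N = sets borel" by (simp add: N_def)
  have eN: "emeasure N A \<le> (\<integral>\<^sup>+x. g x \<partial>M)" if "A \<in> sets borel" for A
    unfolding N_def using that by (subst emeasure_density) (auto intro!: nn_integral_mono simp: indicator_def)
  have cN: "emeasure N K < \<infinity>" if "compact K" for K
    using eN[of K] fin borel_compact[OF that] by (auto intro: le_less_trans)
  have "0 < g x \<Longrightarrow> x \<in> C" for x using C(2)[of x] by fastforce
  then have AEC: "AE y in N. y \<in> C" unfolding N_def by (subst AE_density) auto
  have fm[measurable]: "f \<in> borel_measurable borel" using borel_measurable_cc f by blast
  have bm[measurable]: "b \<in> borel_measurable borel" using borel_measurable_cc b by blast
  have c: "continuous_on UNIV f" "continuous_on UNIV b" using f b cc_continuous by blast+
  have int: "integrable N (\<lambda>y. f (- y + x))" for x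
    by (rule integrable_continuous_AE_compact[OF _ sN cN C(1)])
       (use AEC in \<open>auto intro!: continuous_on_compose2[OF c(1)] continuous_intros elim!: eventually_mono\<close>)
  define h where "h x = (\<integral>y. f (- y + x) \<partial>N)" for x
  have h0: "h x \<ge> 0" for x unfolding h_def using f by simp
  have eq: "conv_nn g (\<lambda>x. ennreal (f x)) x = ennreal (h x)" for x
  proof -
    have "conv_nn g (\<lambda>x. ennreal (f x)) x = (\<integral>\<^sup>+y. ennreal (f (- y + x)) \<partial>N)"
      unfolding conv_nn_def N_def by (subst nn_integral_density) auto
    also have "\<dots> = ennreal (h x)" unfolding h_def using int f by (intro nn_integral_eq_integral) auto
    finally show ?thesis .
  qed
  define Q where "Q = (\<lambda>(x,y). x + y) ` (L \<times> K)"
  have Q: "compact Q" unfolding Q_def by (intro compact_plus_image L K)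
  have hQ: "f (- y + x) * b y = 0" if "x \<notin> Q \<or> y \<notin> L" for x y
  proof -
    have "x \<in> Q" if "- y + x \<in> K" "y \<in> L"
      unfolding Q_def using that by (intro image_eqI[of _ _ "(y, - y + x)"]) (auto simp: add.assoc[symmetric])
    then show ?thesis using that K L by fastforce
  qed
  have hb: "h x = (\<integral>y. f (- y + x) * b y \<partial>N)" for x
    unfolding h_def by (rule integral_cong_AE) (use AEC b in \<open>auto elim!: eventually_mono simp: measurable_cong_sets[OF sN refl] borel_measurable_cc\<close>)
  have cch: "cc h"
  proof (rule ccI[OF _ Q])
    show "continuous_on UNIV h" unfolding h_def
    proof (rule continuous_on_integral_parameter[OF _ sN cN])
      show "continuous_on UNIV (\<lambda>(x, y). f (- y + x))" unfolding case_prod_beta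
        by (intro continuous_on_compose2[OF c(1)] continuous_intros) auto
      have "\<forall>x\<in>UNIV. AE y in N. y \<notin> C \<longrightarrow> f (- y + x) = 0" using AEC by (auto elim!: eventually_mono)
      then show "\<exists>U K. open U \<and> x0 \<in> U \<and> compact K \<and> (\<forall>x\<in>U. AE y in N. y \<notin> K \<longrightarrow> f (- y + x) = 0)" for x0
        using C(1) by (intro exI[of _ UNIV] exI[of _ C] conjI) auto
    qed
    show "h x = 0" if "x \<notin> Q" for x
    proof -
      have "(\<lambda>y. f (- y + x) * b y) = (\<lambda>_. 0)" using hQ[of x] that by blast
      then show ?thesis unfolding hb by simp
    qed
  qed
  have "(\<integral>\<^sup>+x. conv_nn g (\<lambda>x. ennreal (f x)) x \<partial>M) = ennreal (\<integral>x. h x \<partial>M)"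
    unfolding eq using integrable_Cc[OF cch] h0 by (intro nn_integral_eq_integral) auto
  also have "(\<integral>x. h x \<partial>M) = (\<integral>x. (\<integral>y. f (- y + x) * b y \<partial>N) \<partial>M)" by (simp add: hb)
  also have "\<dots> = (\<integral>y. (\<integral>x. f (- y + x) * b y \<partial>M) \<partial>N)"
    by (rule Fubini_compact_support[OF _ Q L(1) hQ sets_M emeasure_compact sN cN])
      (auto simp: case_prod_beta intro!: continuous_intros continuous_on_compose2[OF c(1)] continuous_on_compose2[OF c(2)])
  also have "\<dots> = (\<integral>y. (\<integral>x. f x \<partial>M) * b y \<partial>N)" using integral_left_translate[OF fm] by simp
  also have "\<dots> = (\<integral>x. f x \<partial>M) * (\<integral>y. b y \<partial>N)" by simp
  also have "ennreal \<dots> = ennreal (\<integral>x. f x \<partial>M) * ennreal (\<integral>y. b y \<partial>N)"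
    using f b by (intro ennreal_mult) auto
  also have "ennreal (\<integral>x. f x \<partial>M) = (\<integral>\<^sup>+x. ennreal (f x) \<partial>M)"
    using f integrable_Cc by (intro nn_integral_eq_integral[symmetric]) auto
  also have "ennreal (\<integral>y. b y \<partial>N) = (\<integral>\<^sup>+y. ennreal (b y) \<partial>N)"
    using b by (intro nn_integral_eq_integral[symmetric] integrable_cc[OF b(1) sN cN]) auto
  also have "\<dots> = (\<integral>\<^sup>+y. 1 \<partial>N)" by (rule nn_integral_cong_AE) (use AEC b in \<open>auto elim!: eventually_mono\<close>)
  also have "\<dots> = (\<integral>\<^sup>+x. g x \<partial>M)" unfolding N_def by (subst nn_integral_density) auto
  finally show ?thesis unfolding tonelli_def eq[abs_def]
    using borel_measurable_cc[OF cch] by (simp add: mult.commute)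
qed

lemma incseq_cc_open:
  assumes U: "open U" "emeasure M U < \<infinity>"
  obtains f :: "nat \<Rightarrow> 'a \<Rightarrow> real" where "\<And>n. cc (f n)" "\<And>n x. 0 \<le> f n x" "\<And>m n x. m \<le> n \<Longrightarrow> f m x \<le> f n x"
    "AE x in M. (SUP n. ennreal (f n x)) = indicator U x"
proof -
  obtain K :: "nat \<Rightarrow> 'a set" where K: "\<And>n. compact (K n)" "\<And>n. K n \<subseteq> U" "incseq K" "U - (\<Union>n. K n) \<in> null_sets M"
    using finite_measure_sigma_compact[OF borel_open[OF U(1)] U(2)] by blast
  have "\<exists>f. cc f \<and> (\<forall>x. 0 \<le> f x) \<and> (\<forall>x. f x \<le> 1) \<and> (\<forall>x\<in>K n. f x = 1) \<and> (\<forall>x. x \<notin> U \<longrightarrow> f x = 0)" for n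
    using cc_bump[OF K(1) U(1) K(2)] by metis
  then obtain f where f: "\<And>n. cc (f n)" "\<And>n x. 0 \<le> f n x" "\<And>n x. f n x \<le> 1" "\<And>n x. x \<in> K n \<Longrightarrow> f n x = 1"
    "\<And>n x. x \<notin> U \<Longrightarrow> f n x = 0" by metis
  \<comment> \<open>Like a running maximum of the \<open>f i\<close>, this increases with
    \<open>n\<close>, stays between \<open>0\<close> and \<open>1\<close>, and equals
    \<open>1\<close> as soon as some \<open>f i\<close> does; the product form gives the simple
    recursion \<open>hS\<close>.\<close>
  define h where "h n x = 1 - (\<Prod>i\<le>n. 1 - f i x)" for n x
  have hS: "h (Suc n) x = h n x + f (Suc n) x * (1 - h n x)" for n x
    by (simp add: h_def algebra_simps)
  have hcc: "cc (h n)" for n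
  proof (induction n)
    case 0 then show ?case using f(1)[of 0] by (simp add: h_def)
  next
    case (Suc n)
    have "cc (\<lambda>x. h n x + f (Suc n) x * (1 - h n x))"
      by (intro cc_add cc_mult_right Suc f continuous_intros cc_continuous)
    then show ?case by (simp add: hS[abs_def])
  qed
  have h01: "0 \<le> h n x \<and> h n x \<le> 1" for n x
    unfolding h_def using f by (auto intro!: prod_le_1 prod_nonneg)
  have inc: "h n x \<le> h (Suc n) x" for n x unfolding hS using f h01[of n x] by simp
  show thesis
  proof (rule that[of h])
    show "m \<le> n \<Longrightarrow> h m x \<le> h n x" for m n x by (rule lift_Suc_mono_le[of "\<lambda>n. h n x"]) (use inc in auto)
    have "AE x in M. x \<notin> U - (\<Union>n. K n)" using K(4) by (rule AE_not_in)
    then show "AE x in M. (SUP n. ennreal (h n x)) = indicator U x"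
    proof eventually_elim
      case (elim x)
      show ?case
      proof (cases "x \<in> U")
        case True
        with elim obtain n where n: "x \<in> K n" by auto
        have "h n x = 1" unfolding h_def using f(4)[OF n] by (auto simp: prod_zero_iff intro!: bexI[of _ n])
        then have "ennreal (h n x) = 1" by simp
        moreover have "ennreal (h n x) \<le> 1" for n using h01[of n x] by (simp add: ennreal_le_1)
        ultimately show ?thesis using True by (intro antisym SUP_least) (auto intro: SUP_upper2[of n])
      next
        case False
        then have "h n x = 0" for n unfolding h_def using f(5) by simp
        then show ?thesis using False by simp
      qed
    qed
  qed (use hcc h01 in auto)
qed

text \<open>Open sets are reached from below by test functions, compact sets as differences of open
  sets, and Borel sets of finite measure from below by compact sets, up to a null set. The
  subtraction is legitimate because the integral of \<open>g\<close> and the measures of the open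
  sets are finite.\<close>

lemma tonelli_indicator:
  assumes g[measurable]: "g \<in> borel_measurable borel" and fin: "(\<integral>\<^sup>+x. g x \<partial>M) < \<infinity>"
    and C: "compact C" "\<And>x. x \<notin> C \<Longrightarrow> g x = 0" and E: "E \<in> sets borel" "emeasure M E < \<infinity>"
  shows "tonelli g (indicator E)"
proof -
  have s: "sigma_finite_support g" by (rule sigma_finite_support_of_nn_integral[OF g fin])
  have 1: "tonelli g (indicator U)" if U: "open U" "emeasure M U < \<infinity>" for U
  proof -
    obtain f :: "nat \<Rightarrow> 'a \<Rightarrow> real" where f: "\<And>n. cc (f n)" "\<And>n x. 0 \<le> f n x" "\<And>m n x. m \<le> n \<Longrightarrow> f m x \<le> f n x"
      "AE x in M. (SUP n. ennreal (f n x)) = indicator U x" using incseq_cc_open[OF U] by blast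
    have "tonelli g (\<lambda>x. SUP n. ennreal (f n x))"
      by (rule tonelli_SUP_right)
         (use f borel_measurable_cc[OF f(1)] in \<open>auto intro!: tonelli_cc[OF g fin C] simp: incseq_def le_fun_def ennreal_leI\<close>)
    then show ?thesis by (rule tonelli_cong_right[OF s f(4)])
  qed
  have bound: "conv_nn g (indicator A) x \<le> (\<integral>\<^sup>+x. g x \<partial>M)" for A x
    unfolding conv_nn_def by (intro nn_integral_mono) (auto simp: indicator_def)
  have 2: "tonelli g (indicator K)" if K: "compact K" for K
  proof -
    have Kb[measurable]: "K \<in> sets borel" using borel_compact K .
    obtain U0 C0 where U0: "open U0" "compact C0" "K \<subseteq> U0" "U0 \<subseteq> C0" using compact_neighbourhood[OF K] .
    have Uf: "emeasure M U0 < \<infinity>"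
      using emeasure_mono[of U0 C0 M] U0 borel_compact[OF U0(2)] emeasure_compact[OF U0(2)] by (auto intro: le_less_trans)
    have o: "open (U0 - K)" using U0 K by (simp add: open_Diff compact_imp_closed)
    have "emeasure M (U0 - K) \<le> emeasure M U0" using U0 by (intro emeasure_mono) auto
    then have t1: "tonelli g (indicator (U0 - K))" using o Uf by (intro 1) (auto intro: le_less_trans)
    have t0: "tonelli g (indicator U0)" using 1[OF U0(1) Uf] .
    note [measurable] = t0[unfolded tonelli_def, THEN conjunct1] t1[unfolded tonelli_def, THEN conjunct1]
    have [measurable]: "U0 \<in> sets borel" using U0 by auto
    have add: "conv_nn g (indicator U0) x = conv_nn g (indicator K) x + conv_nn g (indicator (U0 - K)) x" for x
    proof -
      have "conv_nn g (indicator U0) x = (\<integral>\<^sup>+y. g y * indicator K (- y + x) + g y * indicator (U0 - K) (- y + x) \<partial>M)"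
        unfolding conv_nn_def by (intro nn_integral_cong) (use U0 in \<open>auto simp: indicator_def\<close>)
      then show ?thesis unfolding conv_nn_def by (subst (asm) nn_integral_add) auto
    qed
    have fin': "conv_nn g (indicator A) x < \<infinity>" for A x using bound fin by (rule le_less_trans)
    have eq: "conv_nn g (indicator K) x = conv_nn g (indicator U0) x - conv_nn g (indicator (U0 - K)) x" for x
      unfolding add using fin'[of "U0 - K" x] by (simp add: less_top)
    have m: "conv_nn g (indicator K) \<in> borel_measurable borel" unfolding eq[abs_def] by measurable
    have "(\<integral>\<^sup>+x. conv_nn g (indicator U0) x \<partial>M) = (\<integral>\<^sup>+x. conv_nn g (indicator K) x \<partial>M) + (\<integral>\<^sup>+x. conv_nn g (indicator (U0 - K)) x \<partial>M)"
      unfolding add using m by (intro nn_integral_add) auto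
    then have e: "(\<integral>\<^sup>+x. g x \<partial>M) * emeasure M U0 = (\<integral>\<^sup>+x. conv_nn g (indicator K) x \<partial>M) + (\<integral>\<^sup>+x. g x \<partial>M) * emeasure M (U0 - K)"
      using t0 t1 by (simp add: tonelli_def)
    have "emeasure M U0 = emeasure M K + emeasure M (U0 - K)"
      using U0 by (subst plus_emeasure) (auto simp: Un_absorb1)
    then have "(\<integral>\<^sup>+x. g x \<partial>M) * emeasure M K + (\<integral>\<^sup>+x. g x \<partial>M) * emeasure M (U0 - K) =
      (\<integral>\<^sup>+x. conv_nn g (indicator K) x \<partial>M) + (\<integral>\<^sup>+x. g x \<partial>M) * emeasure M (U0 - K)"
      using e by (simp add: distrib_left)
    moreover have "(\<integral>\<^sup>+x. g x \<partial>M) * emeasure M (U0 - K) < \<infinity>"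
      using fin Uf emeasure_mono[of "U0 - K" U0 M] by (auto simp: ennreal_mult_less_top intro: le_less_trans)
    ultimately have "(\<integral>\<^sup>+x. conv_nn g (indicator K) x \<partial>M) = (\<integral>\<^sup>+x. g x \<partial>M) * emeasure M K"
      by (metis add.commute ennreal_add_left_cancel infinity_ennreal_def less_irrefl)
    then show ?thesis using m by (simp add: tonelli_def)
  qed
  obtain K :: "nat \<Rightarrow> 'a set" where K: "\<And>n. compact (K n)" "\<And>n. K n \<subseteq> E" "incseq K" "E - (\<Union>n. K n) \<in> null_sets M"
    using finite_measure_sigma_compact[OF E] by blast
  have "tonelli g (\<lambda>x. SUP n. indicator (K n) x)"
    using K(3) by (intro tonelli_SUP_right 2 K(1) g borel_measurable_indicator borel_compact)
      (fastforce simp: incseq_def le_fun_def split: split_indicator)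
  moreover have "AE x in M. (SUP n. indicator (K n) x) = (indicator E x :: ennreal)"
    using AE_not_in[OF K(4)]
  proof eventually_elim
    case (elim x)
    have "(SUP n. indicator (K n) x) = (indicator (\<Union>n. K n) x :: ennreal)"
    proof (cases "x \<in> (\<Union>n. K n)")
      case True
      then obtain n where n: "x \<in> K n" by auto
      then show ?thesis by (intro antisym SUP_least SUP_upper2[of n]) (auto split: split_indicator)
    qed (auto simp: indicator_def)
    then show ?case using elim K(2) by (auto simp: indicator_def)
  qed
  ultimately show ?thesis by (rule tonelli_cong_right[OF s, rotated])
qed

lemma tonelli_cmult_right:
  assumes [measurable]: "g \<in> borel_measurable borel" "f \<in> borel_measurable borel" and t: "tonelli g f"
  shows "tonelli g (\<lambda>x. c * f x)"
proof -
  have eq: "conv_nn g (\<lambda>x. c * f x) x = c * conv_nn g f x" for x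
    unfolding conv_nn_def by (subst nn_integral_cmult[symmetric]) (auto simp: mult_ac)
  have [measurable]: "conv_nn g f \<in> borel_measurable borel" using t by (simp add: tonelli_def)
  show ?thesis unfolding tonelli_def eq[abs_def]
    using t by (simp add: nn_integral_cmult tonelli_def mult_ac)
qed

lemma tonelli_add_right:
  assumes [measurable]: "g \<in> borel_measurable borel" "f \<in> borel_measurable borel" "h \<in> borel_measurable borel"
    and t: "tonelli g f" "tonelli g h"
  shows "tonelli g (\<lambda>x. f x + h x)"
proof -
  have eq: "conv_nn g (\<lambda>x. f x + h x) x = conv_nn g f x + conv_nn g h x" for x
    unfolding conv_nn_def by (subst nn_integral_add[symmetric]) (auto simp: distrib_left)
  have [measurable]: "conv_nn g f \<in> borel_measurable borel" "conv_nn g h \<in> borel_measurable borel"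
    using t by (simp_all add: tonelli_def)
  show ?thesis unfolding tonelli_def eq[abs_def]
    using t by (simp add: nn_integral_add tonelli_def distrib_left)
qed

text \<open>The factor \<open>indicator A\<close> is carried through the induction because
  indicators are covered only for sets of finite measure. It is removed at the end by exhausting the
  support of \<open>f\<close> with the sets \<open>B n\<close>.\<close>

lemma tonelli_compact_support:
  assumes g[measurable]: "g \<in> borel_measurable borel" and fin: "(\<integral>\<^sup>+x. g x \<partial>M) < \<infinity>"
    and C: "compact C" "\<And>x. x \<notin> C \<Longrightarrow> g x = 0"
    and f: "f \<in> borel_measurable borel" "sigma_finite_support f"
  shows "tonelli g f"
proof -
  have 1: "tonelli g (\<lambda>x. f x * indicator A x)" if A[measurable]: "A \<in> sets borel" and Af: "emeasure M A < \<infinity>"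
    and "f \<in> borel_measurable borel" for A and f :: "'a \<Rightarrow> ennreal"
    using \<open>f \<in> borel_measurable borel\<close>
  proof (induction f rule: borel_measurable_induct)
    case (cong f h)
    then have "f = h" by auto
    then show ?case using cong by simp
  next
    case (set E)
    have "emeasure M (E \<inter> A) \<le> emeasure M A" using set by (intro emeasure_mono) auto
    then have "tonelli g (indicator (E \<inter> A))" using set Af
      by (intro tonelli_indicator[OF g fin C]) (auto intro: le_less_trans)
    moreover have "indicator (E \<inter> A) = (\<lambda>x. indicator E x * indicator A x :: ennreal)"
      by (auto simp: indicator_def)
    ultimately show ?case by simp
  next
    case (mult u c)
    then have "tonelli g (\<lambda>x. c * (u x * indicator A x))" by (intro tonelli_cmult_right) auto
    then show ?case by (simp add: mult.assoc)
  next
    case (add u v)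
    then have "tonelli g (\<lambda>x. u x * indicator A x + v x * indicator A x)" by (intro tonelli_add_right) auto
    then show ?case by (simp add: distrib_right add.commute)
  next
    case (seq U)
    then have "tonelli g (\<lambda>x. SUP i. U i x * indicator A x)"
      by (intro tonelli_SUP_right) (auto simp: incseq_def le_fun_def intro!: mult_right_mono)
    then show ?case by (simp add: SUP_mult_right_ennreal image_comp)
  qed
  obtain A where A: "\<forall>n::nat. A n \<in> sets borel \<and> emeasure M (A n) < \<infinity>" "{x. f x \<noteq> 0} \<subseteq> (\<Union>n. A n)"
    using f(2) unfolding sigma_finite_support_def by (elim exE conjE)
  define B where "B n = (\<Union>i\<le>n. A i)" for n
  have [measurable]: "B n \<in> sets borel" for n unfolding B_def using A by auto
  have "emeasure M (B n) < \<infinity>" for n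
  proof -
    have "emeasure M (B n) \<le> (\<Sum>i\<le>n. emeasure M (A i))"
      unfolding B_def using A by (intro emeasure_subadditive_finite) auto
    also have "\<dots> < \<infinity>" using A by (simp add: less_top)
    finally show ?thesis .
  qed
  moreover have "incseq B" unfolding incseq_def B_def by fastforce
  ultimately have "tonelli g (\<lambda>x. SUP n. f x * indicator (B n) x)"
    using f by (intro tonelli_SUP_right 1) (auto simp: incseq_def le_fun_def indicator_def intro!: mult_left_mono)
  moreover have "(SUP n. f x * indicator (B n) x) = f x" for x
  proof (cases "f x = 0")
    case False
    then obtain n where "x \<in> A n" using A(2) by auto
    then have "x \<in> B n" by (auto simp: B_def)
    then show ?thesis by (intro antisym SUP_least) (auto simp: indicator_def intro!: SUP_upper2[of n])
  qed simp
  ultimately show ?thesis by simp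
qed

text \<open>Up to a null set, \<open>g\<close> is the increasing limit of its truncations at height
  \<open>n\<close> to compact sets \<open>K n\<close>; each truncation is bounded with compact
  support, hence has a finite integral, even where \<open>g\<close> is infinite.\<close>

theorem tonelli_sigma_finite_support:
  assumes g[measurable]: "g \<in> borel_measurable borel" "sigma_finite_support g"
    and f: "f \<in> borel_measurable borel" "sigma_finite_support f"
  shows "tonelli g f"
proof -
  obtain K where K: "\<And>n::nat. compact (K n)" "incseq K" "AE x in M. g x \<noteq> 0 \<longrightarrow> x \<in> (\<Union>n. K n)"
    using sigma_finite_support_compacts[OF g(2)] by blast
  have [measurable]: "K n \<in> sets borel" for n using K borel_compact by blast
  define h where "h n x = min (g x) (of_nat n) * indicator (K n) x" for n x
  have hm[measurable]: "h n \<in> borel_measurable borel" for n unfolding h_def by measurable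
  have fin: "(\<integral>\<^sup>+x. h n x \<partial>M) < \<infinity>" for n
  proof -
    have "(\<integral>\<^sup>+x. h n x \<partial>M) \<le> (\<integral>\<^sup>+x. of_nat n * indicator (K n) x \<partial>M)"
      unfolding h_def by (intro nn_integral_mono mult_right_mono) auto
    also have "\<dots> = of_nat n * emeasure M (K n)" by (simp add: nn_integral_cmult_indicator)
    also have "\<dots> < \<infinity>" using emeasure_compact[OF K(1)] by (simp add: ennreal_mult_less_top of_nat_less_top)
    finally show ?thesis .
  qed
  have inc: "incseq h"
    using K(2) by (auto simp: incseq_def le_fun_def h_def indicator_def intro!: min.coboundedI2)
  have "tonelli (\<lambda>x. SUP n. h n x) f"
  proof (rule tonelli_SUP_left[OF hm f(1) inc])
    show "tonelli (h n) f" for n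
      by (rule tonelli_compact_support[OF hm fin K(1)[of n] _ f]) (simp add: h_def)
  qed
  moreover have "AE x in M. (SUP n. h n x) = g x"
    using K(3)
  proof eventually_elim
    case (elim x)
    show ?case
    proof (cases "g x = 0")
      case False
      then obtain m where m: "x \<in> K m" using elim by auto
      have "g x = (SUP n. min (g x) (of_nat n))"
      proof (cases "g x")
        case (real r)
        obtain n where n: "r \<le> real n" using real_arch_simple by blast
        have "min (g x) (of_nat n) = g x"
          using n real by (simp add: ennreal_of_nat_eq_real_of_nat ennreal_leI min_absorb1)
        then show ?thesis by (intro antisym SUP_least SUP_upper2[of n]) auto
      next
        case top
        then show ?thesis by (simp only: top min_top ennreal_SUP_of_nat_eq_top)
      qed
      also have "\<dots> \<le> (SUP n. h n x)"
      proof (rule SUP_least)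
        fix n
        have "x \<in> K (max m n)" using m incseqD[OF K(2), of m "max m n"] by auto
        then have "min (g x) (of_nat n) \<le> h (max m n) x" by (auto simp: h_def intro!: min.coboundedI2)
        then show "min (g x) (of_nat n) \<le> (SUP n. h n x)" by (rule SUP_upper2[rotated]) simp
      qed
      finally show ?thesis by (intro antisym SUP_least) (auto simp: h_def indicator_def)
    qed (simp add: h_def)
  qed
  ultimately show ?thesis by (rule tonelli_cong_left[rotated])
qed

end

subsection \<open>Averages of left translates\<close>

definition avg :: "'a::{topological_group_add, t2_space} measure \<Rightarrow> ('a \<Rightarrow> real) \<Rightarrow> 'a \<Rightarrow> real" where
  "avg \<nu> F x = (\<integral>t. F (t + x) \<partial>\<nu>)"

text \<open>
  Integrated over \<open>t\<close> with \<open>s\<close> the mean of \<open>t\<close>, this is the inequality of Jensen or Hoelder.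
\<close>

lemma young_tangent:
  fixes p s t :: real assumes "1 < p" "0 \<le> s" "0 \<le> t"
  shows "p * s powr (p - 1) * t \<le> t powr p + (p - 1) * s powr p"
proof (cases "s = 0")
  case False
  then have s: "s > 0" using assms by simp
  have "(s powr (p - 1)) * t \<le> (s powr (p - 1)) powr (p / (p - 1)) / (p / (p - 1)) + t powr p / p"
    by (rule Youngs_inequality) (use assms s in \<open>auto simp: field_simps\<close>)
  also have "(s powr (p - 1)) powr (p / (p - 1)) = s powr p" using assms by (simp add: powr_powr)
  finally have "p * ((s powr (p - 1)) * t) \<le> p * (s powr p / (p / (p - 1)) + t powr p / p)"
    using assms by (intro mult_left_mono) auto
  also have "\<dots> = t powr p + (p - 1) * s powr p" using assms by (simp add: field_simps)
  finally show ?thesis by (simp add: mult.assoc)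
qed (use assms in auto)

lemma powr_midpoint:
  fixes a b p :: real assumes p: "1 < p" and ab: "0 \<le> a" "0 \<le> b"
  shows "((a + b) / 2) powr p \<le> (a powr p + b powr p) / 2"
proof -
  define s where "s = (a + b) / 2"
  have s: "0 \<le> s" using ab by (simp add: s_def)
  have "p * s powr (p - 1) * (a + b) \<le> a powr p + b powr p + 2 * ((p - 1) * s powr p)"
    using young_tangent[OF p s ab(1)] young_tangent[OF p s ab(2)] by (simp add: distrib_left)
  moreover have "s powr (p - 1) * s = s powr p"
    using s powr_mult_base[of s "p - 1"] by (cases "s = 0") (auto simp: mult.commute)
  then have "p * s powr (p - 1) * (a + b) = 2 * (p * s powr p)"
    by (simp add: s_def mult.assoc)
  ultimately show ?thesis unfolding s_def[symmetric] by (simp add: algebra_simps)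
qed

text \<open>No regularity is asked of \<open>\<nu>\<close>. Concentration on a compact set already
  makes every continuous function integrable, bounded or not, and lets averages preserve compact
  support.\<close>

locale compact_prob =
  fixes \<nu> :: "'a::{topological_group_add, t2_space} measure" and K :: "'a set"
  assumes sets_nu: "sets \<nu> = sets borel" and total: "emeasure \<nu> UNIV = 1"
    and compact_K: "compact K" and AE_K: "AE x in \<nu>. x \<in> K"
begin

lemma space_nu: "space \<nu> = UNIV"
  using sets_nu[THEN sets_eq_imp_space_eq] by simp

lemma finite_nu: "finite_measure \<nu>"
  by (rule finite_measureI) (simp add: space_nu total)

lemma measure_UNIV: "measure \<nu> UNIV = 1"
  using total by (simp add: measure_def)

lemma emeasure_nu: "emeasure \<nu> A < \<infinity>"
  using finite_measure.emeasure_finite[OF finite_nu, of A] by (simp add: less_top)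

lemma measurable_nu: "measurable \<nu> N = measurable borel N"
  by (simp cong: measurable_cong_sets add: sets_nu)

lemma integrable_continuous: "continuous_on UNIV f \<Longrightarrow> integrable \<nu> (f :: 'a \<Rightarrow> real)"
  by (erule integrable_continuous_AE_compact[OF _ sets_nu emeasure_nu compact_K])
    (rule eventually_mono[OF AE_K], simp)

lemma integrable_const: "integrable \<nu> (\<lambda>_. c :: real)"
  by (rule finite_measure.integrable_const[OF finite_nu])

lemma continuous_translate:
  "continuous_on UNIV f \<Longrightarrow> continuous_on UNIV (\<lambda>t::'a. f (t + x) :: real)"
  by (rule continuous_on_compose2[of UNIV f]) (auto intro!: continuous_intros)

lemma integrable_translate: "continuous_on UNIV f \<Longrightarrow> integrable \<nu> (\<lambda>t. f (t + x) :: real)"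
  by (intro integrable_continuous continuous_translate)

lemma integral_const: "(\<integral>t. c \<partial>\<nu>) = (c :: real)"
  by (simp add: space_nu measure_UNIV)

lemma continuous_avg:
  assumes F: "continuous_on UNIV F" shows "continuous_on UNIV (avg \<nu> F)"
  unfolding avg_def[abs_def]
proof (rule continuous_on_integral_parameter[OF _ sets_nu emeasure_nu])
  show "continuous_on UNIV (\<lambda>(x, t). F (t + x))" unfolding case_prod_beta
    by (rule continuous_on_compose2[OF F]) (auto intro!: continuous_intros)
  have "\<forall>x\<in>UNIV. AE y in \<nu>. y \<notin> K \<longrightarrow> F (y + x) = 0" using AE_K by (auto elim!: eventually_mono)
  then show "\<exists>U K. open U \<and> x0 \<in> U \<and> compact K \<and> (\<forall>x\<in>U. AE y in \<nu>. y \<notin> K \<longrightarrow> F (y + x) = 0)" for x0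
    using compact_K by (intro exI[of _ UNIV] exI[of _ K] conjI) auto
qed

lemma cc_avg:
  assumes F: "cc F" shows "cc (avg \<nu> F)"
proof -
  obtain L where L: "compact L" "\<And>x. x \<notin> L \<Longrightarrow> F x = 0" using ccE[OF F] by metis
  define Q where "Q = (\<lambda>(x,y). x + y) ` (uminus ` K \<times> L)"
  have Q: "compact Q" unfolding Q_def by (intro compact_plus_image compact_uminus_image L compact_K)
  show ?thesis
  proof (rule ccI[OF continuous_avg[OF cc_continuous[OF F]] Q])
    fix x assume x: "x \<notin> Q"
    have "F (t + x) = 0" if "t \<in> K" for t
    proof (rule L, rule)
      assume "t + x \<in> L"
      then have "- t + (t + x) \<in> Q" unfolding Q_def using that by (intro image_eqI[of _ _ "(-t, t + x)"]) auto
      then show False using x by (simp add: add.assoc[symmetric])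
    qed
    then have "AE t in \<nu>. F (t + x) = 0" using AE_K by (auto elim!: eventually_mono)
    then have "(\<integral>t. F (t + x) \<partial>\<nu>) = 0" by (rule integral_eq_zero_AE)
    then show "avg \<nu> F x = 0" by (simp add: avg_def)
  qed
qed

lemma avg_nonneg: "(\<And>x. 0 \<le> F x) \<Longrightarrow> 0 \<le> avg \<nu> F x"
  unfolding avg_def by simp

lemma avg_mono:
  "continuous_on UNIV F \<Longrightarrow> continuous_on UNIV G \<Longrightarrow> (\<And>x. F x \<le> G x) \<Longrightarrow> avg \<nu> F x \<le> avg \<nu> G x"
  unfolding avg_def by (intro integral_mono integrable_translate)

lemma avg_diff:
  "continuous_on UNIV F \<Longrightarrow> continuous_on UNIV G \<Longrightarrow> avg \<nu> (\<lambda>x. F x - G x) x = avg \<nu> F x - avg \<nu> G x"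
  unfolding avg_def by (intro Bochner_Integration.integral_diff integrable_translate)

lemma avg_jensen:
  assumes F: "continuous_on UNIV F" "\<And>x. 0 \<le> F x" and p: "1 < p"
  shows "avg \<nu> F x powr p \<le> avg \<nu> (\<lambda>x. F x powr p) x"
proof -
  define s where "s = avg \<nu> F x"
  have s: "s \<ge> 0" unfolding s_def by (rule avg_nonneg[OF F(2)])
  have c: "continuous_on UNIV (\<lambda>x. F x powr p)" using F p by (auto intro!: continuous_on_powr')
  note i = integrable_translate[OF F(1), of x] integrable_translate[OF c, of x]
  have "(\<integral>t. (p * s powr (p - 1)) * F (t + x) \<partial>\<nu>) \<le> (\<integral>t. F (t + x) powr p + (p - 1) * s powr p \<partial>\<nu>)"
    using young_tangent[OF p s F(2)] i integrable_const
    by (intro integral_mono integrable_mult_right Bochner_Integration.integrable_add) (auto simp: mult.assoc)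
  also have "\<dots> = avg \<nu> (\<lambda>x. F x powr p) x + (p - 1) * s powr p"
    using i by (subst Bochner_Integration.integral_add) (simp_all add: avg_def space_nu measure_UNIV integrable_const)
  also have "(\<integral>t. (p * s powr (p - 1)) * F (t + x) \<partial>\<nu>) = p * (s powr (p - 1) * s)"
    using i by (simp add: s_def avg_def)
  also have "s powr (p - 1) * s = s powr p"
    using s powr_mult_base[of s "p - 1"] by (cases "s = 0") (auto simp: mult.commute)
  finally show ?thesis using p by (simp add: s_def algebra_simps)
qed

lemma avg_pos:
  assumes F: "continuous_on UNIV F" "\<And>x. 0 < F x" shows "0 < avg \<nu> F x"
proof -
  have "avg \<nu> F x \<noteq> 0"
  proof
    assume "avg \<nu> F x = 0"
    then have "AE t in \<nu>. F (t + x) = 0"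
      using integral_nonneg_eq_0_iff_AE[OF integrable_translate[OF F(1)]] F(2) by (simp add: avg_def less_imp_le)
    then have "AE t in \<nu>. False" by (rule eventually_mono) (use F(2) in \<open>metis less_irrefl\<close>)
    then have "emeasure \<nu> (space \<nu>) = 0" by (subst (asm) AE_iff_measurable[of "space \<nu>"]) auto
    then have "emeasure \<nu> UNIV = 0" by (simp add: space_nu)
    then show False using total by simp
  qed
  moreover have "0 \<le> avg \<nu> F x" using F by (intro avg_nonneg) (auto simp: less_imp_le)
  ultimately show ?thesis by simp
qed

text \<open>The tangent of \<open>ln\<close> at the mean \<open>a\<close> lies above
  \<open>ln\<close> and integrates to \<open>ln a\<close>.\<close>

lemma avg_ln:
  assumes F: "continuous_on UNIV F" "\<And>x. 0 < F x"
  shows "avg \<nu> (\<lambda>x. ln (F x)) x \<le> ln (avg \<nu> F x)"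
proof -
  define a where "a = avg \<nu> F x"
  have a: "a > 0" unfolding a_def by (rule avg_pos[OF F])
  have "continuous_on UNIV (\<lambda>x. ln (F x))" using F by (intro continuous_intros) (auto simp: less_imp_neq[THEN not_sym])
  note i = integrable_translate[OF this, of x] integrable_translate[OF F(1), of x]
  have "avg \<nu> (\<lambda>x. ln (F x)) x \<le> (\<integral>t. F (t + x) / a + (ln a - 1) \<partial>\<nu>)"
    unfolding avg_def
  proof (rule integral_mono[OF i(1)])
    show "integrable \<nu> (\<lambda>t. F (t + x) / a + (ln a - 1))"
      using i integrable_const by (intro Bochner_Integration.integrable_add) simp_all
    fix t
    have "ln (F (t + x) / a) \<le> F (t + x) / a - 1" using F a by (intro ln_le_minus_one) simp
    then show "ln (F (t + x)) \<le> F (t + x) / a + (ln a - 1)"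
      using F(2)[of "t + x"] a by (simp add: ln_div)
  qed
  also have "\<dots> = (\<integral>t. F (t + x) \<partial>\<nu>) / a + (ln a - 1)"
    using i by (subst Bochner_Integration.integral_add) (simp_all add: space_nu measure_UNIV integrable_const)
  also have "\<dots> = ln a" using a by (simp add: a_def avg_def)
  finally show ?thesis by (simp add: a_def)
qed

lemma avg_limit:
  assumes F: "\<And>n. continuous_on UNIV (F n)" "continuous_on UNIV G"
    and b: "\<And>n x. 0 \<le> F n x" "\<And>n x. F n x \<le> G x" and lim: "\<And>x. (\<lambda>n. F n x) \<longlonglongrightarrow> G x"
  shows "(\<lambda>n. avg \<nu> (F n) x) \<longlonglongrightarrow> avg \<nu> G x"
  unfolding avg_def
proof (rule integral_dominated_convergence[where w = "\<lambda>t. G (t + x)"])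
  show "integrable \<nu> (\<lambda>t. G (t + x))" by (rule integrable_translate[OF F(2)])
qed (use b lim F continuous_translate in \<open>auto simp: measurable_nu intro!: borel_measurable_continuous_onI\<close>)

lemma compact_prob_uminus: "compact_prob (distr \<nu> borel uminus) (uminus ` K)"
proof
  have m[measurable]: "uminus \<in> measurable \<nu> (borel :: 'a measure)"
    unfolding measurable_nu by (intro borel_measurable_continuous_onI continuous_intros)
  show "emeasure (distr \<nu> borel uminus) UNIV = 1" by (subst emeasure_distr[OF m]) (auto simp: space_nu total)
  show c: "compact (uminus ` K)" by (rule compact_uminus_image[OF compact_K])
  show "AE x in distr \<nu> borel uminus. x \<in> uminus ` K"
    using AE_K borel_compact[OF c] by (subst AE_distr_iff[OF m]) (auto elim!: eventually_mono)
qed simp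

text \<open>Nodes and weights depend on the cover and the measure but not on the integrand. One
  choice can therefore serve infinitely many functions at once, such as all the
  \<open>\<lambda>t. \<phi> (t + x)\<close> for varying \<open>x\<close>.\<close>

lemma simple_approximation:
  assumes V: "\<And>y. y \<in> K \<Longrightarrow> open (V y) \<and> y \<in> V y"
  shows "\<exists>(n::nat) ys (w::nat \<Rightarrow> real). (\<forall>k<n. ys k \<in> K) \<and>
    (\<forall>f e. integrable \<nu> f \<longrightarrow> (\<forall>y\<in>K. \<forall>t\<in>V y. \<bar>f t - f y\<bar> \<le> e) \<longrightarrow>
       \<bar>(\<integral>t. f t \<partial>\<nu>) - (\<Sum>k<n. w k * f (ys k))\<bar> \<le> e)"
proof -
  obtain I where I: "I \<subseteq> K" "finite I" "K \<subseteq> (\<Union>i\<in>I. V i)"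
    using compactE_image[OF compact_K, of K V] V by (metis UN_I subsetI)
  obtain n and ys :: "nat \<Rightarrow> 'a" where ys: "I = ys ` {i. i < n}" using finite_imp_nat_seg_image_inj_on[OF I(2)] by metis
  \<comment> \<open>A point goes to the first \<open>V (ys k)\<close> that contains it, so the
    \<open>B k\<close> are disjoint and the sum over \<open>k\<close> picks exactly one node for
    each \<open>t\<close> in \<open>K\<close>.\<close>
  define B where "B k = {t. t \<in> V (ys k) \<and> (\<forall>j<k. t \<notin> V (ys j))}" for k
  have ysK: "ys k \<in> K" if "k < n" for k using I ys that by auto
  have Bm: "B k \<in> sets \<nu>" if "k < n" for k
  proof -
    have "B k = V (ys k) - (\<Union>j<k. V (ys j))" by (auto simp: B_def)
    also have "\<dots> \<in> sets borel" using V ysK that by (intro sets.Diff borel_open open_UN) auto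
    finally show ?thesis by (simp add: sets_nu)
  qed
  have one: "(\<Sum>k<n. indicator (B k) t * (c k :: real)) = c (LEAST k. t \<in> V (ys k))"
    "t \<in> V (ys (LEAST k. t \<in> V (ys k)))" "(LEAST k. t \<in> V (ys k)) < n" if t: "t \<in> K" for t and c
  proof -
    obtain k where k: "k < n" "t \<in> V (ys k)" using I t unfolding ys by auto
    define l where "l = (LEAST k. t \<in> V (ys k))"
    have l: "t \<in> V (ys l)" "l \<le> k" unfolding l_def using k by (auto intro: LeastI Least_le)
    have nl: "t \<notin> V (ys j)" if "j < l" for j using that not_less_Least unfolding l_def by blast
    have "indicator (B j) t = (if j = l then 1 else 0 :: real)" for j
      using l nl by (auto simp: B_def indicator_def) (metis linorder_neqE_nat)+
    then show "(\<Sum>k<n. indicator (B k) t * (c k :: real)) = c (LEAST k. t \<in> V (ys k))"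
      using l k by (simp add: l_def[symmetric] if_distrib[of "\<lambda>x. x * _"] cong: if_cong)
    show "t \<in> V (ys (LEAST k. t \<in> V (ys k)))" "(LEAST k. t \<in> V (ys k)) < n" using l k by (auto simp: l_def)
  qed
  have intB: "integrable \<nu> (\<lambda>t. indicator (B k) t * c)" if "k < n" for k and c :: real
    using Bm[OF that] emeasure_nu by (intro integrable_mult_left) (auto simp: integrable_indicator_iff)
  have iB: "(\<integral>t. (\<Sum>k<n. indicator (B k) t * c k) \<partial>\<nu>) = (\<Sum>k<n. measure \<nu> (B k) * c k)" for c :: "nat \<Rightarrow> real"
    using Bm intB by (subst Bochner_Integration.integral_sum) auto
  show ?thesis
  proof (intro exI[of _ n] exI[of _ ys] exI[of _ "\<lambda>k. measure \<nu> (B k)"] conjI allI impI)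
    show "ys k \<in> K" if "k < n" for k using ysK[OF that] .
  next
    fix f :: "'a \<Rightarrow> real" and e
    assume f: "integrable \<nu> f" and fe: "\<forall>y\<in>K. \<forall>t\<in>V y. \<bar>f t - f y\<bar> \<le> e"
    have isum: "integrable \<nu> (\<lambda>t. \<Sum>k<n. indicator (B k) t * f (ys k))"
      by (intro Bochner_Integration.integrable_sum intB) auto
    have "\<bar>(\<integral>t. f t \<partial>\<nu>) - (\<Sum>k<n. measure \<nu> (B k) * f (ys k))\<bar>
      = \<bar>\<integral>t. f t - (\<Sum>k<n. indicator (B k) t * f (ys k)) \<partial>\<nu>\<bar>"
      by (subst Bochner_Integration.integral_diff[OF f isum]) (simp only: iB)
    also have "\<dots> \<le> (\<integral>t. \<bar>f t - (\<Sum>k<n. indicator (B k) t * f (ys k))\<bar> \<partial>\<nu>)" by (rule integral_abs_bound)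
    also have "\<dots> \<le> (\<integral>t. e \<partial>\<nu>)"
    proof (rule integral_mono_AE)
      show "AE t in \<nu>. \<bar>f t - (\<Sum>k<n. indicator (B k) t * f (ys k))\<bar> \<le> e"
        using AE_K
      proof eventually_elim
        case (elim t)
        show ?case unfolding one(1)[OF elim] using fe ysK[OF one(3)[OF elim]] one(2)[OF elim] by blast
      qed
    qed (use f isum integrable_const in auto)
    finally show "\<bar>(\<integral>t. f t \<partial>\<nu>) - (\<Sum>k<n. measure \<nu> (B k) * f (ys k))\<bar> \<le> e" by (simp add: space_nu measure_UNIV)
  qed
qed

end

context haar begin

lemma integral_avg:
  assumes "compact_prob \<nu> K" and F: "cc F"
  shows "(\<integral>x. avg \<nu> F x \<partial>M) = (\<integral>x. F x \<partial>M)"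
proof -
  interpret compact_prob \<nu> K by fact
  obtain L where L: "compact L" "\<And>x. x \<notin> L \<Longrightarrow> F x = 0" using ccE[OF F] by metis
  \<comment> \<open>The cutoff is \<open>1\<close> on \<open>K\<close>, so it does not change the
    average, but it gives the integrand compact support in both variables.\<close>
  obtain b :: "'a \<Rightarrow> real" where b: "cc b" "\<And>x. x \<in> K \<Longrightarrow> b x = 1"
    using cc_bump[OF compact_K open_UNIV] by (metis top_greatest)
  obtain B where B: "compact B" "\<And>x. x \<notin> B \<Longrightarrow> b x = 0" using ccE[OF b(1)] by metis
  define Q where "Q = (\<lambda>(x,y). x + y) ` (uminus ` B \<times> L)"
  have Q: "compact Q" unfolding Q_def by (intro compact_plus_image compact_uminus_image L B)
  have c: "continuous_on UNIV F" "continuous_on UNIV b" using F b cc_continuous by blast+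
  have cb: "continuous_on UNIV (\<lambda>t. b t * F (t + x))" for x
    by (intro continuous_intros c continuous_on_compose2[OF c(1)]) auto
  have "avg \<nu> F x = (\<integral>t. b t * F (t + x) \<partial>\<nu>)" for x unfolding avg_def
    using AE_K b(2) cb[of x] continuous_translate[OF c(1), of x]
    by (intro integral_cong_AE) (auto simp: measurable_nu intro: borel_measurable_continuous_onI elim!: eventually_mono)
  then have "(\<integral>x. avg \<nu> F x \<partial>M) = (\<integral>x. (\<integral>t. b t * F (t + x) \<partial>\<nu>) \<partial>M)" by simp
  also have "\<dots> = (\<integral>t. (\<integral>x. b t * F (t + x) \<partial>M) \<partial>\<nu>)"
  proof (rule Fubini_compact_support[OF _ Q B(1) _ sets_M emeasure_compact sets_nu emeasure_nu])
    show "continuous_on UNIV (\<lambda>(x, t). b t * F (t + x))" unfolding case_prod_beta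
      by (intro continuous_intros continuous_on_compose2[OF c(1)] continuous_on_compose2[OF c(2)]) auto
    fix x t assume xt: "x \<notin> Q \<or> t \<notin> B"
    have "x \<in> Q" if "t + x \<in> L" "t \<in> B"
      unfolding Q_def using that by (intro image_eqI[of _ _ "(- t, t + x)"]) (auto simp: add.assoc[symmetric])
    then show "b t * F (t + x) = 0" using xt L B by auto
  qed
  also have "\<dots> = (\<integral>t. b t * (\<integral>x. F x \<partial>M) \<partial>\<nu>)"
    using integral_left_translate[OF borel_measurable_cc[OF F]] by simp
  also have "\<dots> = (\<integral>t. 1 * (\<integral>x. F x \<partial>M) \<partial>\<nu>)"
    using b(2) borel_measurable_cc[OF b(1)]
    by (intro integral_cong_AE eventually_mono[OF AE_K]) (auto simp: measurable_nu)
  finally show ?thesis by (simp add: space_nu measure_UNIV)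
qed

text \<open>Pointwise Jensen, then left invariance. Because of this bound, further averages can be
  composed with a strict contraction without loss.\<close>

lemma avg_contraction:
  assumes "compact_prob \<nu> K" and F: "cc F" "\<And>x. 0 \<le> F x" and p: "1 < p"
  shows "(\<integral>x. avg \<nu> F x powr p \<partial>M) \<le> (\<integral>x. F x powr p \<partial>M)"
proof -
  interpret compact_prob \<nu> K by fact
  have Fp: "cc (\<lambda>x. F x powr p)" using F p by (intro cc_powr) auto
  have "(\<integral>x. avg \<nu> F x powr p \<partial>M) \<le> (\<integral>x. avg \<nu> (\<lambda>x. F x powr p) x \<partial>M)"
    using F p Fp by (intro integral_mono integrable_Cc cc_powr cc_avg avg_nonneg avg_jensen cc_continuous) auto
  also have "\<dots> = (\<integral>x. F x powr p \<partial>M)" by (rule integral_avg[OF assms(1) Fp])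
  finally show ?thesis .
qed

end

section \<open>Convolution with a kernel, and a symmetric kernel with a Harnack inequality\<close>

context haar begin

definition cv :: "('a \<Rightarrow> real) \<Rightarrow> ('a \<Rightarrow> real) \<Rightarrow> 'a \<Rightarrow> real" where
  "cv b F x = (\<integral>s. b s * F (- s + x) \<partial>M)"

lemma cc_cv_integrand:
  fixes b F :: "'a \<Rightarrow> real"
  assumes b: "cc b" and F: "continuous_on UNIV F" shows "cc (\<lambda>s. b s * F (- s + x) :: real)"
  by (rule cc_mult_right[OF b], rule continuous_on_compose2[OF F]) (auto intro!: continuous_intros)

lemma continuous_cv:
  assumes b: "cc b" and F: "continuous_on UNIV F" shows "continuous_on UNIV (cv b F)"
  unfolding cv_def[abs_def]
proof (rule continuous_on_integral_parameter[OF _ sets_M emeasure_compact])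
  obtain B where B: "compact B" "\<And>x. x \<notin> B \<Longrightarrow> b x = 0" using ccE[OF b] by metis
  show "continuous_on UNIV (\<lambda>(x, t). b t * F (- t + x))" unfolding case_prod_beta
    by (intro continuous_intros continuous_on_compose2[OF F] continuous_on_compose2[OF cc_continuous[OF b]]) auto
  show "\<exists>U K. open U \<and> x0 \<in> U \<and> compact K \<and> (\<forall>x\<in>U. AE y in M. y \<notin> K \<longrightarrow> b y * F (- y + x) = 0)" for x0
    using B by (intro exI[of _ UNIV] exI[of _ B] conjI) auto
qed

lemma cc_cv:
  assumes b: "cc b" and F: "cc F" shows "cc (cv b F)"
proof -
  obtain B where B: "compact B" "\<And>x. x \<notin> B \<Longrightarrow> b x = 0" using ccE[OF b] by metis
  obtain L where L: "compact L" "\<And>x. x \<notin> L \<Longrightarrow> F x = 0" using ccE[OF F] by metis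
  define Q where "Q = (\<lambda>(x,y). x + y) ` (B \<times> L)"
  have Q: "compact Q" unfolding Q_def by (intro compact_plus_image L B)
  show ?thesis
  proof (rule ccI[OF continuous_cv[OF b cc_continuous[OF F]] Q])
    fix x assume x: "x \<notin> Q"
    have "b s * F (- s + x) = 0" for s
    proof (rule ccontr)
      assume "b s * F (- s + x) \<noteq> 0"
      then have "s \<in> B" "- s + x \<in> L" using B L by force+
      then have "s + (- s + x) \<in> Q" unfolding Q_def by force
      then show False using x by (simp add: add.assoc[symmetric])
    qed
    then have "(\<lambda>s. b s * F (- s + x)) = (\<lambda>_. 0)" by blast
    then show "cv b F x = 0" by (simp add: cv_def)
  qed
qed

lemma cv_nonneg: "(\<And>x. 0 \<le> b x) \<Longrightarrow> (\<And>x. 0 \<le> F x) \<Longrightarrow> 0 \<le> cv b F x"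
  unfolding cv_def by simp

lemma cv_mono:
  assumes "cc b" "\<And>x. 0 \<le> b x" "continuous_on UNIV F" "continuous_on UNIV G" "\<And>x. F x \<le> G x"
  shows "cv b F x \<le> cv b G x"
  unfolding cv_def by (intro integral_mono integrable_Cc cc_cv_integrand assms mult_left_mono)

lemma cv_assoc:
  assumes b: "cc b" and c: "cc c" and F: "continuous_on UNIV F"
  shows "cv b (cv c F) x = cv (cv b c) F x"
proof -
  obtain B where B: "compact B" "\<And>x. x \<notin> B \<Longrightarrow> b x = 0" using ccE[OF b] by metis
  obtain L where L: "compact L" "\<And>x. x \<notin> L \<Longrightarrow> c x = 0" using ccE[OF c] by metis
  define Q where "Q = (\<lambda>(x,y). x + y) ` (B \<times> L)"
  have Q: "compact Q" unfolding Q_def by (intro compact_plus_image L B)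
  have "cv b (cv c F) x = (\<integral>s. (\<integral>t. b s * (c (- s + t) * F (- t + x)) \<partial>M) \<partial>M)"
    unfolding cv_def
  proof (rule Bochner_Integration.integral_cong[OF refl])
    fix s
    have "(\<integral>t. c t * F (- t + (- s + x)) \<partial>M) = (\<integral>t. c (- s + t) * F (- (- s + t) + (- s + x)) \<partial>M)"
      by (rule integral_left_translate[symmetric]) (intro borel_measurable_cc cc_cv_integrand c F)
    also have "\<dots> = (\<integral>t. c (- s + t) * F (- t + x) \<partial>M)" by (simp add: minus_add add.assoc)
    finally show "b s * (\<integral>t. c t * F (- t + (- s + x)) \<partial>M) = (\<integral>t. b s * (c (- s + t) * F (- t + x)) \<partial>M)" by simp
  qed
  also have "\<dots> = (\<integral>t. (\<integral>s. b s * (c (- s + t) * F (- t + x)) \<partial>M) \<partial>M)"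
  proof (rule Fubini_compact_support[OF _ B(1) Q _ sets_M emeasure_compact sets_M emeasure_compact])
    show "continuous_on UNIV (\<lambda>(s, t). b s * (c (- s + t) * F (- t + x)))" unfolding case_prod_beta
      by (intro continuous_intros continuous_on_compose2[OF F] continuous_on_compose2[OF cc_continuous[OF b]]
          continuous_on_compose2[OF cc_continuous[OF c]]) auto
    fix s t assume st: "s \<notin> B \<or> t \<notin> Q"
    have "t \<in> Q" if "s \<in> B" "- s + t \<in> L"
      unfolding Q_def using that by (intro image_eqI[of _ _ "(s, - s + t)"]) (auto simp: add.assoc[symmetric])
    then show "b s * (c (- s + t) * F (- t + x)) = 0" using st L B by auto
  qed
  also have "\<dots> = (\<integral>t. (\<integral>s. (b s * c (- s + t)) * F (- t + x) \<partial>M) \<partial>M)" by (simp only: mult.assoc)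
  also have "\<dots> = cv (cv b c) F x" by (simp add: cv_def)
  finally show ?thesis .
qed

lemma cv_pos:
  assumes b: "cc b" and c: "continuous_on UNIV c" and nn: "\<And>x. 0 \<le> b x" "\<And>x. 0 \<le> c x"
    and pos: "b s > 0" "c (- s + x) > 0"
  shows "cv b c x > 0"
  unfolding cv_def using nn pos by (intro integral_cc_pos[of _ s] cc_cv_integrand b c) auto

lemma cv_translate:
  assumes b: "cc b" and F: "continuous_on UNIV F"
  shows "cv b F (y + x) = cv (\<lambda>s. b (y + s)) F x"
proof -
  have "cv b F (y + x) = (\<integral>s. b (y + s) * F (- (y + s) + (y + x)) \<partial>M)"
    unfolding cv_def by (rule integral_left_translate[symmetric]) (intro borel_measurable_cc cc_cv_integrand b F)
  moreover have "- (y + s) + (y + x) = - s + x" for s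
    by (simp only: minus_add add.assoc minus_add_cancel)
  ultimately show ?thesis by (simp add: cv_def)
qed

text \<open>
  The fourth convolution power of \<open>b\<close> is positive on the supports of all translates of \<open>b\<close> by
  points of \<open>S\<close>; this is the source of the Harnack inequality.
\<close>

lemma kernel_exists:
  assumes K: "compact K"
  obtains b :: "'a \<Rightarrow> real" and S where "cc b" "\<And>x. 0 \<le> b x" "(\<integral>x. b x \<partial>M) = 1" "\<And>s. b (- s) * D s = b s" "b 0 > 0"
    "compact S" "K \<subseteq> S" "\<And>x. x \<notin> S \<Longrightarrow> b x = 0" "\<And>x. x \<in> S \<Longrightarrow> - x \<in> S" "0 \<in> S"
    "\<exists>C>0. \<forall>y\<in>S. \<forall>s. b (y + s) \<le> C * cv (cv b b) (cv b b) s"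
    "\<And>e. e > 0 \<Longrightarrow> \<exists>V. open V \<and> 0 \<in> V \<and> V \<subseteq> S \<and> (\<forall>v\<in>V. \<forall>s. \<bar>b (v + s) - b s\<bar> \<le> e * cv (cv b b) (cv b b) s)"
proof -
  define K1 where "K1 = K \<union> uminus ` K \<union> {0}"
  have K1: "compact K1" unfolding K1_def by (intro compact_Un K compact_uminus_image) simp
  obtain b0 :: "'a \<Rightarrow> real" where b0: "cc b0" "\<And>x. 0 \<le> b0 x" "\<And>x. x \<in> K1 \<Longrightarrow> b0 x = 1"
    using cc_bump[OF K1 open_UNIV] by (metis top_greatest)
  \<comment> \<open>The second term makes \<open>b1 (- s) * D s = b1 s\<close>, so the measure with
    this density is invariant under inversion.\<close>
  define b1 where "b1 s = b0 s + b0 (- s) * D s" for s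
  have b1: "cc b1" "\<And>x. 0 \<le> b1 x" "\<And>x. x \<in> K1 \<Longrightarrow> b1 x > 0"
    unfolding b1_def using b0 D_pos
    by (auto intro!: cc_add cc_mult_right cc_translate continuous_D add_nonneg_nonneg add_pos_nonneg simp: less_imp_le)
  define a where "a = (\<integral>x. b1 x \<partial>M)"
  have a: "a > 0" unfolding a_def using b1(3)[of 0] by (intro integral_cc_pos[of _ 0] b1) (auto simp: K1_def)
  define b where "b s = 1 / a * b1 s" for s
  have b: "cc b" unfolding b_def by (rule cc_cmult[OF b1(1)])
  have bn: "0 \<le> b x" for x unfolding b_def using a b1 by simp
  have bp: "b x > 0" if "x \<in> K1" for x unfolding b_def using a b1(3)[OF that] by simp
  have bi: "(\<integral>x. b x \<partial>M) = 1" unfolding b_def using a by (simp add: a_def[symmetric])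
  have bs: "b (- s) * D s = b s" for s
  proof -
    have "b1 (- s) * D s = b1 s" using D_pos[of s] by (simp add: b1_def D_uminus field_simps)
    then show ?thesis by (simp add: b_def mult.assoc)
  qed
  define U where "U = {s. b s > 0}"
  have U: "open U" unfolding U_def using cc_continuous[OF b] by (intro open_Collect_less) auto
  have U0: "0 \<in> U" using bp[of 0] by (auto simp: U_def K1_def)
  have Um: "- s \<in> U" if "s \<in> U" for s
    using that bs[of s] D_pos[of s] bn[of "-s"] by (auto simp: U_def less_le)
  define S where "S = closure U"
  obtain L where L: "compact L" "\<And>x. x \<notin> L \<Longrightarrow> b x = 0" using ccE[OF b] by metis
  have US: "U \<subseteq> S" unfolding S_def by (rule closure_subset)
  have "U \<subseteq> L" using L by (force simp: U_def)
  then have "S \<subseteq> L" unfolding S_def using L(1) compact_imp_closed by (intro closure_minimal) auto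
  then have S: "compact S" using L(1) unfolding S_def by (metis closed_closure compact_Int_closed inf.absorb2)
  have Sm: "- x \<in> S" if "x \<in> S" for x
  proof -
    have "closed (uminus -` S)" unfolding S_def by (rule closed_vimage) (auto intro!: continuous_intros)
    then have "closure U \<subseteq> uminus -` S" using Um US by (intro closure_minimal) auto
    then show ?thesis using that by (auto simp: S_def)
  qed
  have Sb: "b x = 0" if "x \<notin> S" for x using that US bn[of x] by (auto simp: U_def less_le subset_iff)
  define b2 where "b2 = cv b b"
  define b4 where "b4 = cv b2 b2"
  have b2: "cc b2" "\<And>x. 0 \<le> b2 x" unfolding b2_def using b bn by (auto intro!: cc_cv cv_nonneg)
  have b4: "cc b4" "\<And>x. 0 \<le> b4 x" unfolding b4_def using b2 by (auto intro!: cc_cv cv_nonneg)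
  \<comment> \<open>For \<open>z\<close> in the closure of \<open>U\<close>, the points
    \<open>w\<close> with \<open>- w + z \<in> U\<close> form a neighbourhood of \<open>z\<close>,
    which therefore meets \<open>U\<close>; the integrand of \<open>cv b b\<close> is positive at a
    common point. So \<open>b2\<close> is positive on \<open>S\<close>, boundary included.\<close>
  have b2p: "b2 z > 0" if "z \<in> S" for z
  proof -
    have "open ((\<lambda>w. - w + z) -` U)" by (intro open_vimage U continuous_intros)
    moreover have "z \<in> (\<lambda>w. - w + z) -` U" using U0 by simp
    ultimately have "(\<lambda>w. - w + z) -` U \<inter> U \<noteq> {}" 
      using that open_Int_closure_eq_empty[of "(\<lambda>w. - w + z) -` U" U] unfolding S_def by blast
    then obtain w where "w \<in> U" "- w + z \<in> U" by auto
    then show ?thesis unfolding b2_def by (intro cv_pos[OF b cc_continuous[OF b] bn bn, of w]) (auto simp: U_def)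
  qed
  define N where "N = (\<lambda>(x,y). x + y) ` (S \<times> S)"
  have N: "compact N" unfolding N_def by (intro compact_plus_image S)
  have S0: "0 \<in> S" using U0 US by auto
  have N0: "N \<noteq> {}" unfolding N_def using S0 by auto
  have b4p: "b4 z > 0" if z: "z \<in> N" for z
  proof -
    obtain x y where xy: "x \<in> S" "y \<in> S" "z = x + y" using z unfolding N_def by (elim imageE SigmaE) auto
    then show ?thesis unfolding b4_def using b2p
      by (intro cv_pos[OF b2(1) cc_continuous[OF b2(1)] b2(2) b2(2), of x]) (auto simp: add.assoc[symmetric])
  qed
  \<comment> \<open>The minimum of \<open>b4\<close> on the compact \<open>N\<close> is positive.
    Together with the upper bound \<open>B\<close> of \<open>b\<close> it gives the Harnack constant
    \<open>B / c\<close>.\<close>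
  obtain z0 where z0: "z0 \<in> N" "\<And>z. z \<in> N \<Longrightarrow> b4 z0 \<le> b4 z"
    using continuous_attains_inf[OF N N0, of b4] cc_continuous[OF b4(1)] continuous_on_subset by blast
  define c where "c = b4 z0"
  have c: "c > 0" unfolding c_def using b4p z0 by auto
  obtain B where B: "B > 0" "\<And>x. \<bar>b x\<bar> \<le> B" using cc_bounded[OF b] by metis
  \<comment> \<open>By symmetry of \<open>S\<close>, a point \<open>s\<close> outside
    \<open>N\<close> has \<open>y + s \<notin> S\<close> for every \<open>y\<close> in
    \<open>S\<close>, so \<open>b (y + s) = 0\<close> and only \<open>s\<close> in \<open>N\<close>
    needs an estimate.\<close>
  have inN: "s \<in> N" if "y \<in> S" "y + s \<in> S" for y s
  proof -
    have "- y + (y + s) \<in> N" unfolding N_def using Sm that by (intro image_eqI[of _ _ "(- y, y + s)"]) auto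
    then show ?thesis by (simp add: add.assoc[symmetric])
  qed
  have H1: "b (y + s) \<le> B / c * b4 s" if "y \<in> S" for y s
  proof (cases "y + s \<in> S")
    case True
    then have "c \<le> b4 s" using inN[OF that] z0 by (simp add: c_def)
    then have "B / c * c \<le> B / c * b4 s" using B c by (intro mult_left_mono) auto
    then show ?thesis using B(2)[of "y + s"] c by simp
  next
    case False
    then show ?thesis using Sb B c b4(2)[of s] by simp
  qed
  show thesis
  proof (rule that[OF b bn bi bs _ S _ Sb Sm S0])
    show "b 0 > 0" using bp[of 0] by (simp add: K1_def)
    show "K \<subseteq> S" using bp US by (auto simp: K1_def U_def subset_iff)
    show "\<exists>C>0. \<forall>y\<in>S. \<forall>s. b (y + s) \<le> C * cv (cv b b) (cv b b) s"
      using H1 B c by (intro exI[of _ "B / c"]) (auto simp: b4_def b2_def)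
    fix e :: real assume e: "e > 0"
    \<comment> \<open>The absolute modulus \<open>e * c\<close> is a modulus relative to
      \<open>b4\<close> on \<open>N\<close>, where \<open>c \<le> b4 s\<close>; off \<open>N\<close>
      both values of \<open>b\<close> vanish.\<close>
    obtain V where V: "open V" "0 \<in> V" "\<And>v x. v \<in> V \<Longrightarrow> \<bar>b (v + x) - b x\<bar> \<le> e * c"
      using uniformly_continuous_left[OF b, of "e * c"] e c by (metis mult_pos_pos)
    have "\<bar>b (v + s) - b s\<bar> \<le> e * b4 s" if v: "v \<in> V \<inter> U" for v s
    proof (cases "s \<in> N")
      case True
      then have "e * c \<le> e * b4 s" using z0 e by (simp add: c_def)
      then show ?thesis using V(3)[of v s] v by auto
    next
      case False
      then have "v + s \<notin> S" "0 + s \<notin> S" using inN[of v s] inN[of 0 s] v US S0 by auto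
      then show ?thesis using Sb e b4 by simp
    qed
    then show "\<exists>V. open V \<and> 0 \<in> V \<and> V \<subseteq> S \<and> (\<forall>v\<in>V. \<forall>s. \<bar>b (v + s) - b s\<bar> \<le> e * cv (cv b b) (cv b b) s)"
      using V U U0 US by (intro exI[of _ "V \<inter> U"]) (auto simp: b4_def b2_def)
  qed
qed

end

text \<open>The setting of an argument by contradiction: \<open>contraction\<close> with
  \<open>\<rho> < 1\<close> will be refuted by a mean. \<open>harnack\<close> and
  \<open>modulus\<close> compare translates of \<open>b\<close> with its fourth convolution power,
  since \<open>b\<close> itself may vanish where a translate does not.\<close>

locale walk = haar M + mu: compact_prob \<mu> K
  for M \<mu> :: "'a::{topological_group_add, t2_space} measure" and K +
  fixes b :: "'a \<Rightarrow> real" and S :: "'a set" and p \<rho> :: real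
  assumes b: "cc b" and b_nonneg: "\<And>x. 0 \<le> b x" and b_integral: "(\<integral>x. b x \<partial>M) = 1"
    and b_sym: "\<And>s. b (- s) * D s = b s" and b_0: "b 0 > 0"
    and S: "compact S" and K_S: "K \<subseteq> S" and b_S: "\<And>x. x \<notin> S \<Longrightarrow> b x = 0"
    and S_uminus: "\<And>x. x \<in> S \<Longrightarrow> - x \<in> S" and S_0: "0 \<in> S"
    and harnack: "\<exists>C>0. \<forall>y\<in>S. \<forall>s. b (y + s) \<le> C * cv (cv b b) (cv b b) s"
    and modulus: "\<And>e. e > 0 \<Longrightarrow> \<exists>V. open V \<and> 0 \<in> V \<and> V \<subseteq> S \<and> (\<forall>v\<in>V. \<forall>s. \<bar>b (v + s) - b s\<bar> \<le> e * cv (cv b b) (cv b b) s)"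
    and p: "1 < p" and \<rho>: "0 \<le> \<rho>" "\<rho> < 1"
    and contraction: "\<And>F. cc F \<Longrightarrow> (\<And>x. 0 \<le> F x) \<Longrightarrow> (\<integral>x. avg \<mu> F x powr p \<partial>M) \<le> \<rho> * (\<integral>x. F x powr p \<partial>M)"
begin

definition \<beta> :: "'a measure" where "\<beta> = density M b"
definition \<mu>' :: "'a measure" where "\<mu>' = distr \<mu> borel uminus"

lemma AE_\<beta>: "AE x in \<beta>. x \<in> S"
proof -
  have "0 < b x \<Longrightarrow> x \<in> S" for x using b_S[of x] by fastforce
  then show ?thesis unfolding \<beta>_def using borel_measurable_cc[OF b] by (subst AE_density) auto
qed

sublocale beta: compact_prob \<beta> S
proof
  have "emeasure \<beta> UNIV = (\<integral>\<^sup>+x. ennreal (b x) \<partial>M)"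
    unfolding \<beta>_def using borel_measurable_cc[OF b] by (subst emeasure_density) auto
  also have "\<dots> = 1" using b_integral integrable_Cc[OF b] b_nonneg by (subst nn_integral_eq_integral) auto
  finally show "emeasure \<beta> UNIV = 1" .
qed (use S AE_\<beta> in \<open>auto simp: \<beta>_def\<close>)

sublocale mu': compact_prob \<mu>' "uminus ` K"
  unfolding \<mu>'_def by (rule mu.compact_prob_uminus)

lemma integral_\<beta>: "continuous_on UNIV F \<Longrightarrow> (\<integral>x. F x \<partial>\<beta>) = (\<integral>x. b x * F x \<partial>M)"
  unfolding \<beta>_def using borel_measurable_cc[OF b] b_nonneg borel_measurable_continuous_onI[of F]
  by (subst integral_density) auto

lemma integral_\<beta>_uminus:
  fixes F :: "'a \<Rightarrow> real"
  assumes F: "continuous_on UNIV F" shows "(\<integral>x. F (- x) \<partial>\<beta>) = (\<integral>x. F x \<partial>\<beta>)"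
proof -
  have "(\<integral>x. F (- x) \<partial>\<beta>) = (\<integral>x. b x * F (- x) \<partial>M)"
    by (rule integral_\<beta>) (intro continuous_on_compose2[OF F] continuous_intros, simp)
  also have "\<dots> = (\<integral>x. b (- x) * F x * D x \<partial>M)"
    using integral_uminus[of "\<lambda>x. b (- x) * F x"] F b by (simp add: cc_mult_right cc_translate)
  also have "\<dots> = (\<integral>x. (b (- x) * D x) * F x \<partial>M)" by (simp add: mult_ac)
  also have "\<dots> = (\<integral>x. b x * F x \<partial>M)" by (simp add: b_sym)
  finally show ?thesis using integral_\<beta>[OF F] by simp
qed

text \<open>The symmetry of \<open>\<beta>\<close> under inversion absorbs the sign in
  \<open>cv\<close>.\<close>

lemma avg_\<beta>:
  assumes F: "continuous_on UNIV F" shows "avg \<beta> F x = cv b F x"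
proof -
  have "avg \<beta> F x = (\<integral>s. F (- s + x) \<partial>\<beta>)"
    unfolding avg_def using integral_\<beta>_uminus[OF beta.continuous_translate[OF F], of x] by simp
  also have "\<dots> = cv b F x" unfolding cv_def
    by (rule integral_\<beta>) (intro continuous_on_compose2[OF F] continuous_intros, simp)
  finally show ?thesis .
qed

text \<open>
  The summand \<open>F\<close> in \<open>W\<close> keeps a superharmonic function above multiples of its convolution powers
  with \<open>b\<close>.
\<close>

definition W :: "('a \<Rightarrow> real) \<Rightarrow> 'a \<Rightarrow> real" where
  "W F x = (avg \<mu>' (avg \<mu> F) x + F x) / 2"

definition P :: "('a \<Rightarrow> real) \<Rightarrow> 'a \<Rightarrow> real" where
  "P F = avg \<beta> (W F)"

lemma continuous_W: "continuous_on UNIV F \<Longrightarrow> continuous_on UNIV (W F)"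
  unfolding W_def[abs_def] by (intro continuous_intros mu'.continuous_avg mu.continuous_avg) auto

lemma cc_W: "cc F \<Longrightarrow> cc (W F)"
proof -
  assume "cc F"
  then have "cc (\<lambda>x. 1 / 2 * (avg \<mu>' (avg \<mu> F) x + F x))" by (intro cc_cmult cc_add mu'.cc_avg mu.cc_avg)
  then show "cc (W F)" by (simp add: W_def[abs_def])
qed

lemma cc_P: "cc F \<Longrightarrow> cc (P F)"
  unfolding P_def by (intro beta.cc_avg cc_W)

lemma W_nonneg: "(\<And>x. 0 \<le> F x) \<Longrightarrow> 0 \<le> W F x"
  unfolding W_def by (auto intro!: add_nonneg_nonneg mu'.avg_nonneg mu.avg_nonneg)

lemma P_nonneg: "(\<And>x. 0 \<le> F x) \<Longrightarrow> 0 \<le> P F x"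
  unfolding P_def by (intro beta.avg_nonneg W_nonneg)

lemma W_mono: "continuous_on UNIV F \<Longrightarrow> continuous_on UNIV G \<Longrightarrow> (\<And>x. F x \<le> G x) \<Longrightarrow> W F x \<le> W G x"
  unfolding W_def by (intro divide_right_mono add_mono mu'.avg_mono mu.avg_mono mu.continuous_avg) auto

lemma P_diff:
  assumes "continuous_on UNIV F" "continuous_on UNIV G"
  shows "P (\<lambda>x. F x - G x) x = P F x - P G x"
proof -
  have "avg \<mu> (\<lambda>x. F x - G x) = (\<lambda>x. avg \<mu> F x - avg \<mu> G x)"
    using mu.avg_diff[OF assms] by auto
  then have "avg \<mu>' (avg \<mu> (\<lambda>x. F x - G x)) x = avg \<mu>' (avg \<mu> F) x - avg \<mu>' (avg \<mu> G) x" for x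
    using mu'.avg_diff[OF mu.continuous_avg[OF assms(1)] mu.continuous_avg[OF assms(2)]] by simp
  then have "W (\<lambda>x. F x - G x) = (\<lambda>x. W F x - W G x)"
    by (intro ext) (simp add: W_def diff_divide_distrib add_divide_distrib)
  then show ?thesis unfolding P_def using beta.avg_diff[OF continuous_W[OF assms(1)] continuous_W[OF assms(2)]] by simp
qed

definition \<theta> :: real where "\<theta> = (\<rho> + 1) / 2"

lemma \<theta>: "0 < \<theta>" "\<theta> < 1" using \<rho> by (auto simp: \<theta>_def)

text \<open>\<open>\<mu>'\<close> and \<open>\<beta>\<close> do not increase p-th power integrals
  and \<open>\<mu>\<close> gains the factor \<open>\<rho>\<close>. Convexity at the midpoint leaves
  the mean of \<open>\<rho>\<close> and of the factor \<open>1\<close> of the identity summand,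
  which is \<open>\<theta>\<close>.\<close>

lemma P_contraction:
  assumes F: "cc F" "\<And>x. 0 \<le> F x"
  shows "(\<integral>x. P F x powr p \<partial>M) \<le> \<theta> * (\<integral>x. F x powr p \<partial>M)"
proof -
  have c: "cc (avg \<mu>' (avg \<mu> F))" "\<And>x. 0 \<le> avg \<mu>' (avg \<mu> F) x"
    using F by (auto intro!: mu'.cc_avg mu.cc_avg mu'.avg_nonneg mu.avg_nonneg)
  have i: "integrable M (\<lambda>x. avg \<mu>' (avg \<mu> F) x powr p)" "integrable M (\<lambda>x. F x powr p)" "integrable M (\<lambda>x. W F x powr p)"
    using F c p by (auto intro!: integrable_Cc cc_powr cc_W W_nonneg)
  have "(\<integral>x. P F x powr p \<partial>M) \<le> (\<integral>x. W F x powr p \<partial>M)" unfolding P_def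
    by (rule avg_contraction[OF beta.compact_prob_axioms cc_W[OF F(1)] W_nonneg[OF F(2)] p])
  also have "\<dots> \<le> (\<integral>x. (avg \<mu>' (avg \<mu> F) x powr p + F x powr p) / 2 \<partial>M)"
  proof (rule integral_mono[OF i(3)])
    fix x
    show "W F x powr p \<le> (avg \<mu>' (avg \<mu> F) x powr p + F x powr p) / 2"
      unfolding W_def by (rule powr_midpoint) (use p F c in auto)
  qed (use i in simp)
  also have "\<dots> = ((\<integral>x. avg \<mu>' (avg \<mu> F) x powr p \<partial>M) + (\<integral>x. F x powr p \<partial>M)) / 2" using i by simp
  also have "(\<integral>x. avg \<mu>' (avg \<mu> F) x powr p \<partial>M) \<le> (\<integral>x. avg \<mu> F x powr p \<partial>M)"
    by (rule avg_contraction[OF mu'.compact_prob_axioms mu.cc_avg[OF F(1)] mu.avg_nonneg[OF F(2)] p])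
  also have "\<dots> \<le> \<rho> * (\<integral>x. F x powr p \<partial>M)" by (rule contraction[OF F])
  finally show ?thesis by (simp add: \<theta>_def field_simps)
qed

end

subsection \<open>A positive superharmonic function\<close>

context walk begin

text \<open>Half of the exponent that the contraction allows: \<open>P\<close> shrinks p-th power
  integrals by \<open>\<theta>\<close>, and \<open>r powr p\<close> takes back only its square root,
  so \<open>r * P\<close> still shrinks them by \<open>\<kappa> < 1\<close>.\<close>

definition r :: real where "r = \<theta> powr (- 1 / (2 * p))"

definition \<kappa> :: real where "\<kappa> = \<theta> powr (1 / 2)"

lemma r: "1 < r"
proof -
  have "0 < (- 1 / (2 * p)) * ln \<theta>"
    using \<theta> p ln_less_zero[of \<theta>] by (intro mult_neg_neg) auto
  then show ?thesis using \<theta> by (simp add: r_def powr_def)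
qed

lemma \<kappa>: "0 < \<kappa>" "\<kappa> < 1"
  unfolding \<kappa>_def using \<theta> powr_less_mono2[of "1/2" \<theta> 1] by auto

lemma r_powr_\<theta>: "r powr p * \<theta> = \<kappa>"
proof -
  have "r powr p = \<theta> powr (- 1 / 2)" using p by (simp add: r_def powr_powr)
  then have "r powr p * \<theta> = \<theta> powr (- 1 / 2) * \<theta> powr 1" using \<theta> by simp
  also have "\<dots> = \<theta> powr (1 / 2)" unfolding powr_add[symmetric] by simp
  finally show ?thesis by (simp add: \<kappa>_def)
qed

text \<open>\<open>v k\<close> is the term \<open>r ^ k\<close> times \<open>P ^ k\<close> applied
  to \<open>b\<close>, and \<open>u n\<close> is the sum of the terms with \<open>k < n\<close>. In
  the recursive form, \<open>r * P (u n) x \<le> u (Suc n) x\<close> is immediate.\<close>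

primrec u :: "nat \<Rightarrow> 'a \<Rightarrow> real" where
  "u 0 = (\<lambda>_. 0)"
| "u (Suc n) = (\<lambda>x. b x + r * P (u n) x)"

primrec v :: "nat \<Rightarrow> 'a \<Rightarrow> real" where
  "v 0 = b"
| "v (Suc n) = (\<lambda>x. r * P (v n) x)"

lemma cc_u: "cc (u n)"
  by (induction n) (auto intro!: cc_zero cc_add b cc_cmult cc_P)

lemma cc_v: "cc (v n)"
  by (induction n) (auto intro!: b cc_cmult cc_P)

lemmas continuous_u = cc_u[THEN cc_continuous]
lemmas continuous_v = cc_v[THEN cc_continuous]

lemma u_nonneg: "0 \<le> u n x"
  using r by (induction n arbitrary: x) (auto intro!: add_nonneg_nonneg b_nonneg mult_nonneg_nonneg P_nonneg)

lemma v_nonneg: "0 \<le> v n x"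
  using r by (induction n arbitrary: x) (auto intro!: b_nonneg mult_nonneg_nonneg P_nonneg)

lemma P_u_nonneg: "0 \<le> P (u n) x" and W_u_nonneg: "0 \<le> W (u n) x" and P_v_nonneg: "0 \<le> P (v n) x"
  by (intro P_nonneg W_nonneg u_nonneg v_nonneg)+

lemma u_Suc_diff: "u (Suc n) x = u n x + v n x"
proof (induction n arbitrary: x)
  case 0
  have "P (\<lambda>_. 0) x = 0" using P_diff[of "\<lambda>_. 0" "\<lambda>_. 0" x] by simp
  then show ?case by simp
next
  case (Suc n)
  have "v n = (\<lambda>x. u (Suc n) x - u n x)" using Suc.IH by auto
  then have "P (v n) x = P (u (Suc n)) x - P (u n) x"
    using P_diff[OF continuous_u[of "Suc n"] continuous_u[of n]] by (simp del: u.simps)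
  then have "r * P (u (Suc n)) x = r * (P (u n) x + P (v n) x)" by (simp del: u.simps)
  then show ?case by (simp add: distrib_left)
qed

lemma incseq_u: "incseq (\<lambda>n. u n x)"
  using v_nonneg by (intro incseq_SucI) (simp add: u_Suc_diff del: u.simps)

lemma u_mono: "m \<le> n \<Longrightarrow> u m x \<le> u n x"
  using incseq_u by (auto simp: incseq_def)

lemma integral_v_powr: "(\<integral>x. v n x powr p \<partial>M) \<le> \<kappa> ^ n * (\<integral>x. b x powr p \<partial>M)"
proof (induction n)
  case (Suc n)
  have "(\<integral>x. v (Suc n) x powr p \<partial>M) = r powr p * (\<integral>x. P (v n) x powr p \<partial>M)"
    using r P_v_nonneg by (simp add: powr_mult)
  also have "\<dots> \<le> r powr p * (\<theta> * (\<integral>x. v n x powr p \<partial>M))"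
    by (intro mult_left_mono P_contraction cc_v v_nonneg) simp
  also have "\<dots> = \<kappa> * (\<integral>x. v n x powr p \<partial>M)" by (simp add: r_powr_\<theta>[symmetric])
  also have "\<dots> \<le> \<kappa> * (\<kappa> ^ n * (\<integral>x. b x powr p \<partial>M))" using \<kappa> by (intro mult_left_mono Suc) auto
  finally show ?case by simp
qed simp

text \<open>The known decay concerns p-th power integrals of the terms, while the pairing with
  \<open>h\<close> is linear. Each term is split at a height \<open>c\<close>: below, it costs at
  most \<open>c\<close> times the integral of \<open>h\<close>; above, it is dominated by its p-th
  power.\<close>

lemma integral_u_bounded:
  assumes h: "cc h" "\<And>x. 0 \<le> h x" obtains B where "\<And>n. (\<integral>x. h x * u n x \<partial>M) \<le> B"
proof -
  obtain H where H: "H > 0" "\<And>x. \<bar>h x\<bar> \<le> H" using cc_bounded[OF h(1)] by metis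
  define \<delta> where "\<delta> = \<kappa> powr (1 / p)"
  have \<delta>: "0 < \<delta>" "\<delta> < 1" unfolding \<delta>_def using \<kappa> p powr_less_mono2[of "1/p" \<kappa> 1] by auto
  define A where "A = (\<integral>x. h x \<partial>M) + H * (\<integral>x. b x powr p \<partial>M)"
  have A: "A \<ge> 0" unfolding A_def using h H by (intro add_nonneg_nonneg mult_nonneg_nonneg) auto
  have hv: "integrable M (\<lambda>x. h x * v n x)" "integrable M (\<lambda>x. h x * u n x)" for n
    by (intro integrable_Cc cc_mult_right h continuous_v continuous_u)+
  have 1: "(\<integral>x. h x * v n x \<partial>M) \<le> \<delta> ^ n * A" for n
  proof -
    \<comment> \<open>This height balances the two parts: \<open>c powr p = \<kappa> ^ n\<close>
      gives \<open>c powr (1 - p) * \<kappa> ^ n = c\<close>, so both are of order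
      \<open>\<delta> ^ n\<close> and the sum over \<open>n\<close> is geometric.\<close>
    define c where "c = \<delta> ^ n"
    have c: "c > 0" using \<delta> by (simp add: c_def)
    have vp: "integrable M (\<lambda>x. v n x powr p)" using p v_nonneg by (intro integrable_Cc cc_powr cc_v) auto
    \<comment> \<open>\<open>t \<le> c + c\<^sup>1\<^sup>-\<^sup>p t\<^sup>p\<close>\<close>
    have pt: "h x * v n x \<le> c * h x + c powr (1 - p) * H * v n x powr p" for x
    proof (cases "v n x \<le> c")
      case True
      then have "h x * v n x \<le> c * h x" using mult_left_mono[OF True h(2)[of x]] by (simp add: mult.commute)
      moreover have "0 \<le> c powr (1 - p) * H * v n x powr p" using H by simp
      ultimately show ?thesis by linarith
    next
      case False
      then have vc: "v n x > c" "v n x > 0" using c by auto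
      have "v n x powr (1 - p) \<le> c powr (1 - p)" using vc c p by (intro powr_mono2') auto
      then have "v n x powr (1 - p) * v n x powr p \<le> c powr (1 - p) * v n x powr p" by (rule mult_right_mono) simp
      then have "v n x \<le> c powr (1 - p) * v n x powr p" using vc by (simp add: powr_add[symmetric])
      then have "h x * v n x \<le> H * (c powr (1 - p) * v n x powr p)"
        using H(2)[of x] H(1) h(2)[of x] vc by (intro mult_mono) auto
      moreover have "0 \<le> c * h x" using c h by simp
      ultimately show ?thesis by (simp add: mult_ac)
    qed
    have "(\<integral>x. h x * v n x \<partial>M) \<le> (\<integral>x. c * h x + c powr (1 - p) * H * v n x powr p \<partial>M)"
      using pt hv vp integrable_Cc[OF h(1)] by (intro integral_mono) auto
    also have "\<dots> = c * (\<integral>x. h x \<partial>M) + c powr (1 - p) * H * (\<integral>x. v n x powr p \<partial>M)"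
      using vp integrable_Cc[OF h(1)] by simp
    also have "\<dots> \<le> c * (\<integral>x. h x \<partial>M) + c powr (1 - p) * H * (\<kappa> ^ n * (\<integral>x. b x powr p \<partial>M))"
      using H by (intro add_left_mono mult_left_mono integral_v_powr) auto
    also have "c powr (1 - p) * H * (\<kappa> ^ n * (\<integral>x. b x powr p \<partial>M)) = (c powr (1 - p) * \<kappa> ^ n) * (H * (\<integral>x. b x powr p \<partial>M))"
      by (simp add: mult_ac)
    also have "c powr (1 - p) * \<kappa> ^ n = c"
    proof -
      have ck: "c powr p = \<kappa> ^ n" unfolding c_def \<delta>_def using \<kappa> p
        by (simp add: powr_powr powr_realpow[symmetric] mult.commute)
      have "c powr (1 - p) * c powr p = c" using c by (simp add: powr_add[symmetric])
      then show ?thesis unfolding ck .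
    qed
    finally show ?thesis by (simp add: A_def c_def algebra_simps)
  qed
  have "(\<integral>x. h x * u n x \<partial>M) \<le> (\<Sum>k<n. \<delta> ^ k) * A" for n
  proof (induction n)
    case (Suc n)
    have "(\<integral>x. h x * u (Suc n) x \<partial>M) = (\<integral>x. h x * u n x \<partial>M) + (\<integral>x. h x * v n x \<partial>M)"
      using hv by (simp add: u_Suc_diff distrib_left del: u.simps)
    then show ?case using Suc 1[of n] by (simp add: algebra_simps)
  qed simp
  moreover have "(\<Sum>k<n. \<delta> ^ k) \<le> 1 / (1 - \<delta>)" for n
    using \<delta> by (simp add: sum_gp_strict divide_right_mono)
  ultimately have "(\<integral>x. h x * u n x \<partial>M) \<le> 1 / (1 - \<delta>) * A" for n
    using A by (meson mult_right_mono order_trans)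
  then show thesis by (rule that)
qed

section \<open>Harnack inequality, modulus and finiteness of the Green function\<close>

abbreviation "b4 \<equiv> cv (cv b b) (cv b b)"

lemma cc_b4: "cc b4" by (intro cc_cv b)

lemma cv_b4: "continuous_on UNIV F \<Longrightarrow> cv b (cv b (cv b (cv b F))) = cv b4 F"
proof -
  assume F: "continuous_on UNIV F"
  have 1: "cv b (cv b G) = cv (cv b b) G" if "continuous_on UNIV G" for G
    using cv_assoc[OF b b that] by auto
  show ?thesis
    unfolding 1[OF F] 1[OF continuous_cv[OF cc_cv[OF b b] F]]
    using cv_assoc[OF cc_cv[OF b b] cc_cv[OF b b] F] by auto
qed

lemma P_cv: "continuous_on UNIV F \<Longrightarrow> P F x = cv b (W F) x"
  unfolding P_def by (rule avg_\<beta>[OF continuous_W])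

text \<open>One convolution with \<open>b\<close> costs one index and a factor \<open>2\<close>; the
  surplus factor \<open>r > 1\<close> is dropped.\<close>

lemma u_lower_step:
  assumes F: "continuous_on UNIV F" "\<And>x. c * F x \<le> u n x"
  shows "c / 2 * cv b F x \<le> u (Suc n) x"
proof -
  have "c / 2 * cv b F x = cv b (\<lambda>x. c / 2 * F x) x"
    by (simp add: cv_def mult.left_commute[of "b _"])
  also have "\<dots> \<le> cv b (W (u n)) x"
  proof (rule cv_mono[OF b b_nonneg _ continuous_W[OF continuous_u]])
    fix x
    have "0 \<le> avg \<mu>' (avg \<mu> (u n)) x" by (intro mu'.avg_nonneg mu.avg_nonneg u_nonneg)
    then show "c / 2 * F x \<le> W (u n) x" using F(2)[of x] by (simp add: W_def field_simps)
  qed (intro continuous_intros F)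
  also have "\<dots> = P (u n) x" by (simp add: P_cv continuous_u)
  also have "\<dots> \<le> r * P (u n) x" using mult_right_mono[of 1 r "P (u n) x"] r P_u_nonneg[of n x] by simp
  also have "\<dots> \<le> u (Suc n) x" using b_nonneg by simp
  finally show ?thesis .
qed

lemma u_lower_b: "b4 x \<le> 8 * u 4 x"
proof -
  have c: "continuous_on UNIV b" using b cc_continuous by blast
  have "1 * b x \<le> u (Suc 0) x" for x using P_diff[of "\<lambda>_. 0" "\<lambda>_. 0" x] by simp
  from u_lower_step[OF c this]
  have "1 / 2 * cv b b x \<le> u (Suc (Suc 0)) x" for x .
  from u_lower_step[OF continuous_cv[OF b c] this]
  have "1 / 2 / 2 * cv b (cv b b) x \<le> u (Suc (Suc (Suc 0))) x" for x .
  from u_lower_step[OF continuous_cv[OF b continuous_cv[OF b c]] this]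
  have "1 / 2 / 2 / 2 * cv b (cv b (cv b b)) x \<le> u (Suc (Suc (Suc (Suc 0)))) x" for x .
  moreover have "cv b (cv b (cv b b)) x = b4 x" by (rule cv_assoc[OF b b continuous_cv[OF b c]])
  moreover have "Suc (Suc (Suc (Suc 0))) = 4" by simp
  ultimately have "1 / 2 / 2 / 2 * b4 x \<le> u 4 x" by metis
  then show ?thesis by simp
qed

text \<open>\<open>r * cv b (W (u n))\<close> is already below \<open>u (Suc n)\<close>; three uses
  of \<open>u_lower_step\<close> supply the other three convolutions, three more indices and the
  factor \<open>2 ^ 3\<close>.\<close>

lemma u_lower_W: "r * cv b4 (W (u n)) x \<le> 8 * u (n + 4) x"
proof -
  have c: "continuous_on UNIV (W (u n))" by (intro continuous_W continuous_u)
  have "r * cv b (W (u n)) x \<le> u (Suc n) x" for x using b_nonneg[of x] by (simp add: P_cv continuous_u)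
  from u_lower_step[OF continuous_cv[OF b c] this]
  have "r / 2 * cv b (cv b (W (u n))) x \<le> u (Suc (Suc n)) x" for x .
  from u_lower_step[OF continuous_cv[OF b continuous_cv[OF b c]] this]
  have "r / 2 / 2 * cv b (cv b (cv b (W (u n)))) x \<le> u (Suc (Suc (Suc n))) x" for x .
  from u_lower_step[OF continuous_cv[OF b continuous_cv[OF b continuous_cv[OF b c]]] this]
  have "r / 2 / 2 / 2 * cv b (cv b (cv b (cv b (W (u n))))) x \<le> u (Suc (Suc (Suc (Suc n)))) x" for x .
  moreover have "Suc (Suc (Suc (Suc n))) = n + 4" by simp
  ultimately have "r / 2 / 2 / 2 * cv b4 (W (u n)) x \<le> u (n + 4) x" unfolding cv_b4[OF c] by metis
  then show ?thesis by simp
qed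

text \<open>Left translation of the argument moves onto the kernel, where
  \<open>b (y + s) \<le> C * b4 s\<close>, and the convolution with \<open>b4\<close> is paid for by
  three further steps. Hence the indices \<open>Suc n\<close> and \<open>n + 4\<close>; their
  difference disappears in the limit.\<close>

lemma u_harnack: obtains C where "C > 0" "\<And>y n x. y \<in> S \<Longrightarrow> u (Suc n) (y + x) \<le> C * u (n + 4) x"
proof -
  obtain C where C: "C > 0" "\<And>y s. y \<in> S \<Longrightarrow> b (y + s) \<le> C * b4 s" using harnack by blast
  have "u (Suc n) (y + x) \<le> 16 * C * u (n + 4) x" if y: "y \<in> S" for y n x
  proof -
    have c: "continuous_on UNIV (W (u n))" by (intro continuous_W continuous_u)
    have "cv b (W (u n)) (y + x) = cv (\<lambda>s. b (y + s)) (W (u n)) x" by (rule cv_translate[OF b c])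
    also have "\<dots> \<le> (\<integral>s. C * (b4 s * W (u n) (- s + x)) \<partial>M)"
      unfolding cv_def[of _ "W (u n)"]
    proof (rule integral_mono)
      fix s
      show "b (y + s) * W (u n) (- s + x) \<le> C * (b4 s * W (u n) (- s + x))"
        using mult_right_mono[OF C(2)[OF y, of s], of "W (u n) (- s + x)"] W_u_nonneg by (simp add: mult.assoc)
    qed (auto intro!: integrable_mult_right integrable_Cc cc_cv_integrand cc_b4 cc_translate(1)[OF b] c)
    also have "\<dots> = C * cv b4 (W (u n)) x" by (simp add: cv_def[of b4])
    finally have "r * cv b (W (u n)) (y + x) \<le> C * (r * cv b4 (W (u n)) x)" using r by (simp add: mult.left_commute)
    also have "\<dots> \<le> C * (8 * u (n + 4) x)" using C by (intro mult_left_mono u_lower_W) auto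
    finally have 1: "r * P (u n) (y + x) \<le> 8 * C * u (n + 4) x" by (simp add: P_cv continuous_u)
    have "b (y + x) \<le> C * (8 * u 4 x)"
      using C(2)[OF y, of x] mult_left_mono[OF u_lower_b[of x], of C] C(1) by linarith
    also have "\<dots> \<le> C * (8 * u (n + 4) x)" using C u_mono[of 4 "n + 4" x] by simp
    finally show ?thesis using 1 by simp
  qed
  then show thesis using C(1) by (intro that[of "16 * C"]) auto
qed

text \<open>The argument for \<open>u_harnack\<close>, with a difference of kernels. The bound is
  relative to \<open>u (n + 4) x\<close>, a form that survives the limit and becomes a uniform
  modulus for the logarithm.\<close>

lemma u_modulus:
  assumes e: "e > 0"
  obtains V where "open V" "0 \<in> V" "V \<subseteq> S" "\<And>z n x. z \<in> V \<Longrightarrow> \<bar>u (Suc n) (z + x) - u (Suc n) x\<bar> \<le> e * u (n + 4) x"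
proof -
  \<comment> \<open>The summand \<open>b\<close> and the summand with \<open>P\<close> contribute
    \<open>8 * d\<close> each.\<close>
  define d where "d = e / 16"
  have d: "d > 0" using e by (simp add: d_def)
  obtain V where V: "open V" "0 \<in> V" "V \<subseteq> S" "\<And>z s. z \<in> V \<Longrightarrow> \<bar>b (z + s) - b s\<bar> \<le> d * b4 s" using modulus[OF d] by blast
  have "\<bar>u (Suc n) (y + x) - u (Suc n) x\<bar> \<le> e * u (n + 4) x" if y: "y \<in> V" for y n x
  proof -
    have c: "continuous_on UNIV (W (u n))" by (intro continuous_W continuous_u)
    note i = integrable_Cc[OF cc_cv_integrand[OF cc_translate(1)[OF b, of y] c, of x]] integrable_Cc[OF cc_cv_integrand[OF b c, of x]]
      integrable_Cc[OF cc_cv_integrand[OF cc_b4 c, of x]]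
    have "\<bar>cv b (W (u n)) (y + x) - cv b (W (u n)) x\<bar> = \<bar>\<integral>s. b (y + s) * W (u n) (- s + x) - b s * W (u n) (- s + x) \<partial>M\<bar>"
      unfolding cv_translate[OF b c] using i by (simp add: cv_def[of _ "W (u n)"])
    also have "\<dots> \<le> (\<integral>s. \<bar>b (y + s) * W (u n) (- s + x) - b s * W (u n) (- s + x)\<bar> \<partial>M)" by (rule integral_abs_bound)
    also have "\<dots> \<le> (\<integral>s. d * (b4 s * W (u n) (- s + x)) \<partial>M)"
    proof (rule integral_mono)
      fix s
      have "\<bar>b (y + s) - b s\<bar> * W (u n) (- s + x) \<le> (d * b4 s) * W (u n) (- s + x)"
        by (intro mult_right_mono V(4)[OF y] W_nonneg u_nonneg)
      then show "\<bar>b (y + s) * W (u n) (- s + x) - b s * W (u n) (- s + x)\<bar> \<le> d * (b4 s * W (u n) (- s + x))"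
        using W_u_nonneg[of n "- s + x"] by (simp add: left_diff_distrib[symmetric] abs_mult mult.assoc)
    qed (use i in auto)
    also have "\<dots> = d * cv b4 (W (u n)) x" by (simp add: cv_def[of b4])
    finally have "r * \<bar>cv b (W (u n)) (y + x) - cv b (W (u n)) x\<bar> \<le> d * (r * cv b4 (W (u n)) x)"
      using r by (simp add: mult.left_commute)
    also have "\<dots> \<le> d * (8 * u (n + 4) x)" using d by (intro mult_left_mono u_lower_W) auto
    finally have 1: "\<bar>r * P (u n) (y + x) - r * P (u n) x\<bar> \<le> 8 * d * u (n + 4) x"
      using r by (simp add: P_cv continuous_u right_diff_distrib[symmetric] abs_mult)
    have "\<bar>b (y + x) - b x\<bar> \<le> d * (8 * u 4 x)"
      using V(4)[OF y, of x] mult_left_mono[OF u_lower_b[of x], of d] d by linarith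
    also have "\<dots> \<le> d * (8 * u (n + 4) x)" using d u_mono[of 4 "n + 4" x] by simp
    finally have 2: "\<bar>b (y + x) - b x\<bar> \<le> 8 * d * u (n + 4) x" by simp
    have "\<bar>u (Suc n) (y + x) - u (Suc n) x\<bar> \<le> 8 * d * u (n + 4) x + 8 * d * u (n + 4) x"
      using 1 2 unfolding u.simps by linarith
    then show ?thesis by (simp add: d_def)
  qed
  with V show thesis by (intro that[of V]) auto
qed

text \<open>The integral of \<open>u n\<close> against a bump around \<open>x\<close> is bounded in
  \<open>n\<close>. Where the bump does not vanish, \<open>z - x\<close> and hence its inverse lie
  in \<open>S\<close>, so the Harnack inequality bounds the value at \<open>x\<close> by the values
  at these \<open>z\<close>.\<close>

lemma u_bounded: obtains B where "\<And>n. u n x \<le> B"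
proof -
  obtain C where C: "C > 0" "\<And>y n x. y \<in> S \<Longrightarrow> u (Suc n) (y + x) \<le> C * u (n + 4) x" using u_harnack by blast
  define h where "h z = b (z - x)" for z
  have h: "cc h" "\<And>z. 0 \<le> h z" unfolding h_def by (auto intro!: cc_translate_diff b b_nonneg)
  define k where "k = (\<integral>z. h z \<partial>M)"
  have k: "k > 0" unfolding k_def using b_0 by (intro integral_cc_pos[of _ x] h) (simp add: h_def)
  obtain B where B: "\<And>n. (\<integral>x. h x * u n x \<partial>M) \<le> B" using integral_u_bounded[OF h] by metis
  have "u n x \<le> C * B / k" for n
  proof -
    have pt: "h z * u (Suc n) x \<le> C * (h z * u (n + 4) z)" for z
    proof (cases "h z = 0")
      case False
      then have "z - x \<in> S" using b_S[of "z - x"] by (auto simp: h_def)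
      then have "- (z - x) \<in> S" by (rule S_uminus)
      from C(2)[OF this, of n z] have "u (Suc n) x \<le> C * u (n + 4) z"
        by (simp add: diff_conv_add_uminus minus_add add.assoc del: add_uminus_conv_diff u.simps)
      from mult_left_mono[OF this h(2)[of z]] show ?thesis by (simp add: mult_ac)
    qed simp
    have "k * u (Suc n) x = (\<integral>z. h z * u (Suc n) x \<partial>M)" by (simp add: k_def)
    also have "\<dots> \<le> (\<integral>z. C * (h z * u (n + 4) z) \<partial>M)"
      by (rule integral_mono[OF _ _ pt])
        (auto intro!: integrable_mult_right integrable_Cc h cc_mult_right[OF h(1)] continuous_u simp del: u.simps)
    also have "\<dots> \<le> C * B" using C B by simp
    finally have "u (Suc n) x \<le> C * B / k" using k by (simp add: field_simps del: u.simps)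
    then show ?thesis using u_mono[of n "Suc n" x] by linarith
  qed
  then show thesis by (rule that)
qed

definition U :: "'a \<Rightarrow> real" where "U x = lim (\<lambda>n. u n x)"

lemma u_tendsto: "(\<lambda>n. u n x) \<longlonglongrightarrow> U x"
proof -
  obtain B where "\<And>n. u n x \<le> B" using u_bounded by metis
  then have "convergent (\<lambda>n. u n x)" using incseq_u incseq_convergent[of "\<lambda>n. u n x" B] by (metis convergentI)
  then show ?thesis unfolding U_def by (simp add: convergent_LIMSEQ_iff)
qed

lemma u_le_U: "u n x \<le> U x"
  by (rule incseq_le[OF incseq_u u_tendsto])

lemma U_nonneg: "0 \<le> U x" using u_nonneg[of 0 x] u_le_U[of 0 x] by linarith

lemma U_0: "0 < U 0"
proof -
  have "b 0 \<le> u 1 0" using r P_u_nonneg[of 0 0] by simp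
  then show ?thesis using u_le_U[of 1 0] b_0 by linarith
qed

lemma U_harnack: obtains C where "C > 0" "\<And>y x. y \<in> S \<Longrightarrow> U (y + x) \<le> C * U x"
proof -
  obtain C where C: "C > 0" "\<And>y n x. y \<in> S \<Longrightarrow> u (Suc n) (y + x) \<le> C * u (n + 4) x" using u_harnack by blast
  have "U (y + x) \<le> C * U x" if y: "y \<in> S" for x y
  proof (rule LIMSEQ_le_const2[OF LIMSEQ_Suc[OF u_tendsto]], intro exI allI impI)
    fix n
    show "u (Suc n) (y + x) \<le> C * U x" using C(2)[OF y, of n x] mult_left_mono[OF u_le_U[of "n + 4" x], of C] C(1) by linarith
  qed
  then show thesis using that C by blast
qed

lemma U_modulus:
  assumes e: "e > 0"
  obtains V where "open V" "0 \<in> V" "V \<subseteq> S" "\<And>z x. z \<in> V \<Longrightarrow> \<bar>U (z + x) - U x\<bar> \<le> e * U x"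
proof -
  obtain V where V: "open V" "0 \<in> V" "V \<subseteq> S" "\<And>z n x. z \<in> V \<Longrightarrow> \<bar>u (Suc n) (z + x) - u (Suc n) x\<bar> \<le> e * u (n + 4) x"
    using u_modulus[OF e] by metis
  have "\<bar>U (z + x) - U x\<bar> \<le> e * U x" if z: "z \<in> V" for z x
  proof (rule LIMSEQ_le_const2[OF tendsto_rabs[OF tendsto_diff[OF LIMSEQ_Suc[OF u_tendsto] LIMSEQ_Suc[OF u_tendsto]]]], intro exI allI impI)
    fix n
    show "\<bar>u (Suc n) (z + x) - u (Suc n) x\<bar> \<le> e * U x"
      using V(4)[OF z, of n x] mult_left_mono[OF u_le_U[of "n + 4" x], of e] e by linarith
  qed
  with V show thesis by (intro that[of V]) auto
qed

lemma continuous_of_modulus: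
  fixes F :: "'a \<Rightarrow> real"
  assumes "\<And>e x. e > 0 \<Longrightarrow> \<exists>V. open V \<and> 0 \<in> V \<and> (\<forall>z\<in>V. \<bar>F (z + x) - F x\<bar> \<le> e)"
  shows "continuous_on UNIV F"
proof -
  have "(F \<longlongrightarrow> F x) (at x)" for x
  proof (rule tendstoI)
    fix e :: real assume e: "e > 0"
    obtain V where V: "open V" "0 \<in> V" "\<And>z. z\<in>V \<Longrightarrow> \<bar>F (z + x) - F x\<bar> \<le> e / 2" using assms[of "e / 2" x] e by auto
    have "open ((\<lambda>y. y + - x) -` V)" by (intro open_vimage V continuous_intros)
    moreover have "x \<in> (\<lambda>y. y + - x) -` V" using V by simp
    ultimately have "eventually (\<lambda>y. y \<in> (\<lambda>y. y + - x) -` V) (at x)" by (rule eventually_at_in_open')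
    then show "eventually (\<lambda>y. dist (F y) (F x) < e) (at x)"
    proof eventually_elim
      case (elim y)
      then have "\<bar>F (y + - x + x) - F x\<bar> \<le> e / 2" by (intro V) simp
      then show ?case using e by (simp add: dist_real_def)
    qed
  qed
  then show ?thesis by (simp add: continuous_on_def)
qed

lemma continuous_U: "continuous_on UNIV U"
proof (rule continuous_of_modulus)
  fix e :: real and x assume e: "e > 0"
  \<comment> \<open>A relative modulus is turned into an absolute one at the fixed point
    \<open>x\<close>; the \<open>+ 1\<close> covers the case \<open>U x = 0\<close>.\<close>
  have e': "e / (U x + 1) > 0" using e U_nonneg[of x] by simp
  obtain V where V: "open V" "0 \<in> V" "\<And>z y. z \<in> V \<Longrightarrow> \<bar>U (z + y) - U y\<bar> \<le> e / (U x + 1) * U y" using U_modulus[OF e'] by metis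
  have "e / (U x + 1) * U x \<le> e" using e U_nonneg[of x] by (simp add: field_simps)
  then show "\<exists>V. open V \<and> 0 \<in> V \<and> (\<forall>z\<in>V. \<bar>U (z + x) - U x\<bar> \<le> e)" using V by (intro exI[of _ V]) (auto intro: order_trans)
qed

text \<open>\<open>r * P (u n) x \<le> u (Suc n) x\<close> passes to the limit layer by layer, by
  dominated convergence. The dominating functions are built from \<open>U\<close>, and they are
  integrable because \<open>U\<close> is continuous.\<close>

lemma U_superharmonic: "r * P U x \<le> U x"
proof -
  have 1: "(\<lambda>n. avg \<mu> (u n) x) \<longlonglongrightarrow> avg \<mu> U x" for x
    by (rule mu.avg_limit[where F = u, OF continuous_u continuous_U u_nonneg u_le_U u_tendsto])
  have 2: "(\<lambda>n. avg \<mu>' (avg \<mu> (u n)) x) \<longlonglongrightarrow> avg \<mu>' (avg \<mu> U) x" for x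
    by (rule mu'.avg_limit[where F = "\<lambda>n. avg \<mu> (u n)", OF mu.continuous_avg[OF continuous_u] mu.continuous_avg[OF continuous_U] mu.avg_nonneg[of "u _", OF u_nonneg]
          mu.avg_mono[OF continuous_u continuous_U u_le_U] 1])
  have 3: "(\<lambda>n. W (u n) x) \<longlonglongrightarrow> W U x" for x
    unfolding W_def by (intro tendsto_intros 2 u_tendsto) simp
  have 4: "(\<lambda>n. P (u n) x) \<longlonglongrightarrow> P U x" unfolding P_def
    by (rule beta.avg_limit[where F = "\<lambda>n. W (u n)", OF continuous_W[OF continuous_u] continuous_W[OF continuous_U] W_u_nonneg
          W_mono[OF continuous_u continuous_U u_le_U] 3])
  show ?thesis
  proof (rule LIMSEQ_le_const2[OF tendsto_mult[OF tendsto_const 4]], intro exI allI impI)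
    fix n
    have "r * P (u n) x \<le> u (Suc n) x" using b_nonneg by simp
    then show "r * P (u n) x \<le> U x" using u_le_U[of "Suc n" x] by linarith
  qed
qed

end

subsection \<open>Averaging operators on amenable groups\<close>

text \<open>The domain on which the mean is used. These functions are determined pointwise, so
  exceptional sets disappear, and sums, multiples and left translates stay inside.\<close>

definition bc :: "('a::topological_space \<Rightarrow> real) \<Rightarrow> bool" where
  "bc f \<longleftrightarrow> continuous_on UNIV f \<and> (\<exists>B. \<forall>x. \<bar>f x\<bar> \<le> B)"

lemma bcI: "continuous_on UNIV f \<Longrightarrow> (\<And>x. \<bar>f x\<bar> \<le> B) \<Longrightarrow> bc f"
  by (auto simp: bc_def)

lemma bc_bound: "bc f \<Longrightarrow> \<exists>B. \<forall>x. \<bar>f x\<bar> \<le> B"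
  by (simp add: bc_def)

lemma bc_continuous: "bc f \<Longrightarrow> continuous_on UNIV f"
  by (simp add: bc_def)

lemma bc_add:
  assumes "bc f" "bc g" shows "bc (\<lambda>x. f x + g x)"
proof -
  obtain A where A: "\<And>x. \<bar>f x\<bar> \<le> A" using bc_bound[OF assms(1)] by blast
  obtain B where "\<And>x. \<bar>g x\<bar> \<le> B" using bc_bound[OF assms(2)] by blast
  then have "\<bar>f x + g x\<bar> \<le> A + B" for x by (meson A abs_triangle_ineq add_mono order_trans)
  then show ?thesis using assms[THEN bc_continuous] by (intro bcI[of _ "A + B"] continuous_intros)
qed

lemma bc_cmult:
  assumes "bc f" shows "bc (\<lambda>x. c * f x)"
proof -
  obtain A where "\<And>x. \<bar>f x\<bar> \<le> A" using bc_bound[OF assms] by blast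
  then have "\<bar>c * f x\<bar> \<le> \<bar>c\<bar> * A" for x by (simp add: abs_mult mult_left_mono)
  then show ?thesis using assms[THEN bc_continuous] by (intro bcI[of _ "\<bar>c\<bar> * A"] continuous_intros)
qed

lemma bc_diff:
  assumes "bc f" "bc g" shows "bc (\<lambda>x. f x - g x)"
  using bc_add[OF assms(1) bc_cmult[OF assms(2), of "-1"]] by simp

lemma bc_const: "bc (\<lambda>_. c)"
  by (rule bcI[of _ "\<bar>c\<bar>"]) auto

lemma bc_sum: "(\<And>i. i \<in> I \<Longrightarrow> bc (f i)) \<Longrightarrow> bc (\<lambda>x. \<Sum>i\<in>I. f i x)"
  by (induction I rule: infinite_finite_induct) (auto intro: bc_const bc_add)

lemma bc_translate:
  fixes f :: "'a::topological_group_add \<Rightarrow> real"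
  assumes "bc f" shows "bc (\<lambda>x. f (a + x))"
proof -
  have "continuous_on UNIV (\<lambda>x. f (a + x))"
    by (rule continuous_on_compose2[OF bc_continuous[OF assms]]) (auto intro!: continuous_intros)
  then show ?thesis using bc_bound[OF assms] by (auto intro: bcI)
qed

lemma ln_midpoint:
  fixes a b :: real assumes "0 < a" "0 < b" shows "(ln a + ln b) / 2 \<le> ln ((a + b) / 2)"
proof -
  define c where "c = (a + b) / 2"
  have c: "c > 0" using assms by (simp add: c_def)
  have "ln (a / c) + ln (b / c) \<le> (a / c - 1) + (b / c - 1)"
    using assms c by (intro add_mono ln_le_minus_one) auto
  also have "\<dots> = 0" using assms by (simp add: c_def field_simps)
  finally show ?thesis using assms c unfolding c_def[symmetric] by (simp add: ln_div)
qed

locale mean =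
  fixes m :: "('a::{topological_group_add, t2_space} \<Rightarrow> real) \<Rightarrow> real"
  assumes m_add: "\<And>f g. bc f \<Longrightarrow> bc g \<Longrightarrow> m (\<lambda>x. f x + g x) = m f + m g"
    and m_cmult: "\<And>c f. bc f \<Longrightarrow> m (\<lambda>x. c * f x) = c * m f"
    and m_nonneg: "\<And>f. bc f \<Longrightarrow> (\<And>x. 0 \<le> f x) \<Longrightarrow> 0 \<le> m f"
    and m_one: "m (\<lambda>_. 1) = 1"
    and m_translate: "\<And>a f. bc f \<Longrightarrow> m (\<lambda>x. f (a + x)) = m f"
begin

lemma m_diff: "bc f \<Longrightarrow> bc g \<Longrightarrow> m (\<lambda>x. f x - g x) = m f - m g"
  using m_add[of f "\<lambda>x. -1 * g x"] m_cmult[of g "-1"] bc_cmult[of g "-1"] by simp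

lemma m_const: "m (\<lambda>_. c) = c"
  using m_cmult[of "\<lambda>_. 1" c] bc_const[of 1] m_one by simp

lemma m_mono: "bc f \<Longrightarrow> bc g \<Longrightarrow> (\<And>x. f x \<le> g x) \<Longrightarrow> m f \<le> m g"
  using m_nonneg[of "\<lambda>x. g x - f x"] bc_diff[of g f] m_diff[of g f] by simp

lemma m_abs: "bc f \<Longrightarrow> (\<And>x. \<bar>f x\<bar> \<le> e) \<Longrightarrow> \<bar>m f\<bar> \<le> e"
  using m_mono[of f "\<lambda>_. e"] m_mono[of "\<lambda>_. - e" f] by (simp add: abs_le_iff minus_le_iff bc_const m_const)

lemma m_sum: "(\<And>i. i \<in> I \<Longrightarrow> bc (f i)) \<Longrightarrow> m (\<lambda>x. \<Sum>i\<in>I. f i x) = (\<Sum>i\<in>I. m (f i))"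
proof (induction I rule: infinite_finite_induct)
  case (insert i I)
  then show ?case by (simp add: m_add bc_sum)
qed (simp_all add: m_const)

end

lemma (in haar) amenable_imp_mean:
  assumes "amenable M" obtains m where "mean (m :: ('a \<Rightarrow> real) \<Rightarrow> real)"
proof -
  obtain m where m: "left_invariant_mean M m" using assms by (auto simp: amenable_def)
  note m1 = m[unfolded left_invariant_mean_def, THEN conjunct1, rule_format]
  note t1 = m[unfolded left_invariant_mean_def, THEN conjunct2]
  note m2 = t1[THEN conjunct1, rule_format]
  note t2 = t1[THEN conjunct2]
  note m3 = t2[THEN conjunct1, rule_format]
  note t3 = t2[THEN conjunct2]
  note m4 = t3[THEN conjunct1]
  note m5 = t3[THEN conjunct2, rule_format]
  define n where "n f = Re (m (\<lambda>x. complex_of_real (f x)))" for f :: "'a \<Rightarrow> real"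
  have L: "(\<lambda>x. complex_of_real (f x)) \<in> Linfty M" if bcf: "bc f" for f
  proof -
    have [measurable]: "f \<in> borel_measurable borel" using bc_continuous[OF bcf] by (rule borel_measurable_continuous_onI)
    have "(\<lambda>x. complex_of_real (f x)) \<in> borel_measurable borel" by measurable
    moreover obtain B where "\<And>x. \<bar>f x\<bar> \<le> B" using bc_bound[OF bcf] by blast
    ultimately show ?thesis unfolding Linfty_def locally_AE_def by (auto intro!: exI[of _ B])
  qed
  have "mean n"
  proof
    fix f g :: "'a \<Rightarrow> real" and a :: 'a and c :: real
    assume f: "bc f"
    show "n (\<lambda>x. f (a + x)) = n f" unfolding n_def using m5[OF L[OF f], of "- a"] by simp
    show "n (\<lambda>x. c * f x) = c * n f" unfolding n_def using m2[OF L[OF f], of "complex_of_real c"] by simp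
    show "n (\<lambda>x. f x + g x) = n f + n g" if "bc g" unfolding n_def using m1[OF L[OF f] L[OF that]] by simp
    show "0 \<le> n f" if "\<And>x. 0 \<le> f x"
    proof -
      have "m (\<lambda>x. complex_of_real (f x)) \<in> \<real>\<^sub>\<ge>\<^sub>0"
        using that by (intro m3[OF L[OF f]]) (simp add: locally_AE_def)
      then show ?thesis unfolding n_def by (simp add: complex_nonneg_Reals_iff)
    qed
  qed (simp add: n_def m4)
  then show thesis by (rule that)
qed

section \<open>A positive superharmonic function on all cosets, and its logarithm\<close>

context walk begin

text \<open>The mean can be applied to a logarithmic increment only if it is bounded;
  \<open>H\<close> collects the translations for which the ratios of \<open>U\<close> are bounded in
  both directions. It is a subgroup containing \<open>S\<close>, hence open, and
  \<open>\<mu>\<close>, \<open>\<mu>'\<close> and \<open>\<beta>\<close> are all concentrated on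
  it.\<close>

definition H :: "'a set" where
  "H = {y. \<exists>C>0. \<forall>x. U (y + x) \<le> C * U x \<and> U (- y + x) \<le> C * U x}"

lemma S_H: "S \<subseteq> H"
proof
  fix y assume y: "y \<in> S"
  obtain C where C: "C > 0" "\<And>y x. y \<in> S \<Longrightarrow> U (y + x) \<le> C * U x" using U_harnack by blast
  show "y \<in> H" unfolding H_def using C y S_uminus[OF y] by blast
qed

lemma K_H: "K \<subseteq> H" "uminus ` K \<subseteq> H"
  using K_S S_H S_uminus by auto

lemma H_0: "0 \<in> H" using S_0 S_H by auto

lemma H_uminus: "y \<in> H \<Longrightarrow> - y \<in> H"
  unfolding H_def by auto

lemma H_add:
  assumes "y \<in> H" "z \<in> H" shows "y + z \<in> H"
proof -
  obtain C where C: "C > 0" "\<And>x. U (y + x) \<le> C * U x" "\<And>x. U (- y + x) \<le> C * U x" using assms by (auto simp: H_def)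
  obtain E where E: "E > 0" "\<And>x. U (z + x) \<le> E * U x" "\<And>x. U (- z + x) \<le> E * U x" using assms by (auto simp: H_def)
  have "U ((y + z) + x) \<le> (C * E) * U x" for x
    using order_trans[OF C(2)[of "z + x"] mult_left_mono[OF E(2)[of x] less_imp_le[OF C(1)]]]
    by (simp add: add.assoc mult.assoc)
  moreover have "U (- (y + z) + x) \<le> (C * E) * U x" for x
    using order_trans[OF E(3)[of "- y + x"] mult_left_mono[OF C(3)[of x] less_imp_le[OF E(1)]]]
    by (simp add: minus_add add.assoc mult_ac diff_conv_add_uminus del: add_uminus_conv_diff)
  ultimately show ?thesis using C E unfolding H_def by (auto intro!: exI[of _ "C * E"])
qed

lemma U_pos_H: "h \<in> H \<Longrightarrow> 0 < U h"
proof -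
  assume "h \<in> H"
  then obtain C where "\<And>x. U (- h + x) \<le> C * U x" by (auto simp: H_def)
  from this[of h] show ?thesis using U_0 U_nonneg[of h] by (cases "U h = 0") (auto simp: less_le)
qed

text \<open>
  \<open>U\<close> is positive on the open subgroup \<open>H\<close> but vanishes far away.  The right translation by \<open>d x\<close>
  depends only on the coset \<open>H + x\<close> and moves it to where \<open>U\<close> is positive.
\<close>

definition d :: "'a \<Rightarrow> 'a" where "d x = (SOME d. \<forall>h\<in>H. 0 < U (h + x + d))"

lemma U_d_pos: "h \<in> H \<Longrightarrow> 0 < U (h + x + d x)"
proof -
  have "\<forall>h\<in>H. 0 < U (h + x + - x)" using U_pos_H by (simp add: add.assoc)
  then have "\<forall>h\<in>H. 0 < U (h + x + d x)" unfolding d_def by (rule someI)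
  then show "h \<in> H \<Longrightarrow> 0 < U (h + x + d x)" by blast
qed

lemma d_translate:
  assumes k: "k \<in> H" shows "d (k + x) = d x"
proof -
  have "(\<forall>h\<in>H. 0 < U (h + (k + x) + e)) \<longleftrightarrow> (\<forall>h\<in>H. 0 < U (h + x + e))" for e
  proof
    assume a: "\<forall>h\<in>H. 0 < U (h + (k + x) + e)"
    show "\<forall>h\<in>H. 0 < U (h + x + e)"
    proof
      fix h assume "h \<in> H"
      then have "0 < U (h + - k + (k + x) + e)" using a H_add[OF _ H_uminus[OF k]] by blast
      moreover have "h + - k + (k + x) = h + x" by (simp only: add.assoc minus_add_cancel)
      ultimately show "0 < U (h + x + e)" by simp
    qed
  next
    assume a: "\<forall>h\<in>H. 0 < U (h + x + e)"
    show "\<forall>h\<in>H. 0 < U (h + (k + x) + e)"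
    proof
      fix h assume "h \<in> H"
      then have "0 < U (h + k + x + e)" using a H_add[OF _ k] by blast
      then show "0 < U (h + (k + x) + e)" by (simp add: add.assoc)
    qed
  qed
  then show ?thesis unfolding d_def by simp
qed

text \<open>Averages of left translates commute with right translations, and the walk does not leave
  a coset of \<open>H\<close>, on which \<open>d\<close> is constant. So \<open>Ut\<close> keeps
  superharmonicity, the modulus and the bounds along \<open>H\<close>, and is positive
  everywhere.\<close>

definition Ut :: "'a \<Rightarrow> real" where "Ut x = U (x + d x)"

lemma Ut_pos: "0 < Ut x"
  using U_d_pos[OF H_0, of x] by (simp add: Ut_def)

lemma Ut_translate: "h \<in> H \<Longrightarrow> Ut (h + x) = U (h + (x + d x))"
  by (simp add: Ut_def d_translate add.assoc)

lemma Ut_modulus: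
  assumes "e > 0"
  obtains V where "open V" "0 \<in> V" "V \<subseteq> S" "\<And>z x. z \<in> V \<Longrightarrow> \<bar>Ut (z + x) - Ut x\<bar> \<le> e * Ut x"
proof -
  obtain V where V: "open V" "0 \<in> V" "V \<subseteq> S" "\<And>z x. z \<in> V \<Longrightarrow> \<bar>U (z + x) - U x\<bar> \<le> e * U x"
    using U_modulus[OF assms] by metis
  have "\<bar>Ut (z + x) - Ut x\<bar> \<le> e * Ut x" if "z \<in> V" for z x
    using V(4)[OF that, of "x + d x"] Ut_translate[of z x] that V(3) S_H by (auto simp: Ut_def)
  with V show thesis by (intro that[of V]) auto
qed

lemma continuous_Ut: "continuous_on UNIV Ut"
proof (rule continuous_of_modulus)
  fix e :: real and x assume e: "e > 0"
  have e': "e / (Ut x + 1) > 0" using e Ut_pos[of x] by simp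
  obtain V where V: "open V" "0 \<in> V" "\<And>z y. z \<in> V \<Longrightarrow> \<bar>Ut (z + y) - Ut y\<bar> \<le> e / (Ut x + 1) * Ut y" using Ut_modulus[OF e'] by metis
  have "e / (Ut x + 1) * Ut x \<le> e" using e Ut_pos[of x] by (simp add: field_simps)
  then show "\<exists>V. open V \<and> 0 \<in> V \<and> (\<forall>z\<in>V. \<bar>Ut (z + x) - Ut x\<bar> \<le> e)" using V by (intro exI[of _ V]) (auto intro: order_trans)
qed

text \<open>Averaging by a measure on the subgroup \<open>H\<close> sees only the coset of the
  argument, so an identity between cosets passes through it. It is used once for each averaging
  layer of \<open>P\<close>.\<close>

lemma avg_coset_cong:
  assumes "compact_prob \<nu> L" and L: "L \<subseteq> H" and F: "continuous_on UNIV F" "continuous_on UNIV G"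
    and eq: "\<And>h. h \<in> H \<Longrightarrow> F (h + x) = G (h + y)" and h: "h \<in> H"
  shows "avg \<nu> F (h + x) = avg \<nu> G (h + y)"
proof -
  interpret nu: compact_prob \<nu> L by fact
  have "F (t + (h + x)) = G (t + (h + y))" if "t \<in> L" for t
    using eq[OF H_add[OF _ h], of t] that L by (auto simp: add.assoc)
  then show ?thesis unfolding avg_def
    using nu.integrable_translate[OF F(1)] nu.integrable_translate[OF F(2)]
    by (intro integral_cong_AE eventually_mono[OF nu.AE_K]) auto
qed

lemma P_Ut: "P Ut x = P U (x + d x)"
proof -
  note c = continuous_U continuous_Ut
  have 1: "avg \<mu> Ut (h + x) = avg \<mu> U (h + (x + d x))" if "h \<in> H" for h
    by (rule avg_coset_cong[OF mu.compact_prob_axioms K_H(1) c(2,1) Ut_translate that])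
  have 2: "avg \<mu>' (avg \<mu> Ut) (h + x) = avg \<mu>' (avg \<mu> U) (h + (x + d x))" if "h \<in> H" for h
    by (rule avg_coset_cong[OF mu'.compact_prob_axioms K_H(2) mu.continuous_avg[OF c(2)] mu.continuous_avg[OF c(1)] 1 that])
  have 3: "W Ut (h + x) = W U (h + (x + d x))" if "h \<in> H" for h
    unfolding W_def 2[OF that] Ut_translate[OF that] ..
  have "P Ut (0 + x) = P U (0 + (x + d x))" unfolding P_def
    by (rule avg_coset_cong[OF beta.compact_prob_axioms S_H continuous_W[OF c(2)] continuous_W[OF c(1)] 3 H_0])
  then show ?thesis by simp
qed

lemma Ut_superharmonic: "r * P Ut x \<le> Ut x"
  using U_superharmonic[of "x + d x"] by (simp add: P_Ut Ut_def)

definition \<psi> :: "'a \<Rightarrow> real" where "\<psi> x = ln (Ut x)"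

lemma continuous_\<psi>: "continuous_on UNIV \<psi>"
  unfolding \<psi>_def[abs_def] using continuous_Ut Ut_pos by (intro continuous_intros) (auto simp: less_imp_neq[THEN not_sym])

text \<open>Concavity of \<open>ln\<close> is used once per layer: for \<open>\<mu>\<close>, for
  \<open>\<mu>'\<close>, for the midpoint in \<open>W\<close> and for \<open>\<beta>\<close>. The
  factor \<open>r\<close> becomes the additive gain \<open>ln r\<close>.\<close>

lemma \<psi>_superharmonic: "ln r + P \<psi> x \<le> \<psi> x"
proof -
  have c: "continuous_on UNIV (avg \<mu> Ut)" "\<And>x. 0 < avg \<mu> Ut x"
    using mu.continuous_avg[OF continuous_Ut] mu.avg_pos[OF continuous_Ut Ut_pos] by auto
  have c': "continuous_on UNIV (\<lambda>x. ln (avg \<mu> Ut x))"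
    using c by (intro continuous_intros) (auto simp: less_imp_neq[THEN not_sym])
  have W_pos: "0 < W Ut x" for x
    unfolding W_def using mu'.avg_pos[OF c, of x] Ut_pos[of x] by simp
  have cW: "continuous_on UNIV (W Ut)" by (rule continuous_W[OF continuous_Ut])
  have clW: "continuous_on UNIV (\<lambda>x. ln (W Ut x))"
    using cW W_pos by (intro continuous_intros) (auto simp: less_imp_neq[THEN not_sym])
  have "W \<psi> x \<le> ln (W Ut x)" for x
  proof -
    have "avg \<mu> \<psi> y \<le> ln (avg \<mu> Ut y)" for y
      using mu.avg_ln[OF continuous_Ut Ut_pos] by (simp add: \<psi>_def[abs_def])
    then have "avg \<mu>' (avg \<mu> \<psi>) x \<le> avg \<mu>' (\<lambda>y. ln (avg \<mu> Ut y)) x"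
      by (intro mu'.avg_mono mu.continuous_avg continuous_\<psi> c')
    also have "\<dots> \<le> ln (avg \<mu>' (avg \<mu> Ut) x)" by (rule mu'.avg_ln[OF c])
    finally have "W \<psi> x \<le> (ln (avg \<mu>' (avg \<mu> Ut) x) + ln (Ut x)) / 2" by (simp add: W_def \<psi>_def)
    also have "\<dots> \<le> ln (W Ut x)" unfolding W_def by (rule ln_midpoint[OF mu'.avg_pos[OF c] Ut_pos])
    finally show ?thesis .
  qed
  then have "P \<psi> x \<le> avg \<beta> (\<lambda>x. ln (W Ut x)) x"
    unfolding P_def by (intro beta.avg_mono continuous_W continuous_\<psi> clW)
  also have "\<dots> \<le> ln (P Ut x)" unfolding P_def by (rule beta.avg_ln[OF cW W_pos])
  finally have "ln r + P \<psi> x \<le> ln r + ln (P Ut x)" by simp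
  also have "\<dots> = ln (r * P Ut x)"
    using r beta.avg_pos[OF cW W_pos, of x] by (simp add: P_def ln_mult)
  also have "\<dots> \<le> \<psi> x" unfolding \<psi>_def using Ut_superharmonic[of x] r beta.avg_pos[OF cW W_pos, of x] Ut_pos[of x]
    by (subst ln_le_cancel_iff) (auto simp: P_def)
  finally show ?thesis .
qed

text \<open>Such a function may be unbounded, but its increments along \<open>H\<close> lie in the
  domain of the mean. The modulus is uniform in \<open>x\<close>, so that an average over
  translations can be replaced by a finite sum before the mean is taken.\<close>

definition reg :: "('a \<Rightarrow> real) \<Rightarrow> bool" where
  "reg \<phi> \<longleftrightarrow> (\<forall>e>0. \<exists>V. open V \<and> 0 \<in> V \<and> (\<forall>z\<in>V. \<forall>x. \<bar>\<phi> (z + x) - \<phi> x\<bar> \<le> e)) \<and>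
     (\<forall>y\<in>H. \<exists>B. \<forall>x. \<bar>\<phi> (y + x) - \<phi> x\<bar> \<le> B)"

lemma reg_modulus:
  assumes "reg \<phi>" "e > 0"
  obtains V where "open V" "0 \<in> V" "V \<subseteq> H" "\<And>z x. z \<in> V \<Longrightarrow> \<bar>\<phi> (z + x) - \<phi> x\<bar> \<le> e"
proof -
  obtain V where V: "open V" "0 \<in> V" "\<And>z x. z \<in> V \<Longrightarrow> \<bar>\<phi> (z + x) - \<phi> x\<bar> \<le> e"
    using assms(1)[unfolded reg_def, THEN conjunct1, rule_format, OF assms(2)] by auto
  obtain V' where V': "open V'" "0 \<in> V'" "V' \<subseteq> S" using modulus[of 1] by auto
  show thesis by (rule that[of "V \<inter> V'"]) (use V V' S_H in auto)
qed

lemma reg_bound: "reg \<phi> \<Longrightarrow> y \<in> H \<Longrightarrow> \<exists>B. \<forall>x. \<bar>\<phi> (y + x) - \<phi> x\<bar> \<le> B"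
  by (simp add: reg_def)

lemma reg_continuous: "reg \<phi> \<Longrightarrow> continuous_on UNIV \<phi>"
  by (rule continuous_of_modulus) (meson reg_def)

lemma reg_increment:
  assumes "reg \<phi>" "y \<in> H" shows "bc (\<lambda>x. \<phi> (y + x) - \<phi> x)"
proof -
  have "continuous_on UNIV (\<lambda>x. \<phi> (y + x) - \<phi> x)"
    using reg_continuous[OF assms(1)]
    by (intro continuous_intros continuous_on_compose2[OF reg_continuous[OF assms(1)]]) auto
  then show ?thesis using reg_bound[OF assms] by (auto intro: bcI)
qed

lemma reg_\<psi>: "reg \<psi>"
  unfolding reg_def
proof safe
  fix e :: real assume e: "e > 0"
  \<comment> \<open>For the ratio \<open>q\<close> of two values,
    \<open>\<bar>q - 1\<bar> \<le> a \<le> 1 / 2\<close> gives \<open>ln q \<le> a\<close> and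
    \<open>- ln q \<le> 2 * a\<close>; this explains both caps.\<close>
  define a where "a = min (e / 2) (1 / 2)"
  have a: "a > 0" "a \<le> 1 / 2" "2 * a \<le> e" using e by (auto simp: a_def)
  obtain V where V: "open V" "0 \<in> V" "V \<subseteq> S" "\<And>z x. z \<in> V \<Longrightarrow> \<bar>Ut (z + x) - Ut x\<bar> \<le> a * Ut x"
    using Ut_modulus[OF a(1)] by metis
  have "\<bar>\<psi> (z + x) - \<psi> x\<bar> \<le> e" if "z \<in> V" for z x
  proof -
    define q where "q = Ut (z + x) / Ut x"
    have q: "q > 0" using Ut_pos by (simp add: q_def)
    have "\<bar>q - 1\<bar> = \<bar>Ut (z + x) - Ut x\<bar> / Ut x" using Ut_pos[of x] by (simp add: q_def field_simps abs_divide)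
    also have "\<dots> \<le> a" using V(4)[OF that, of x] Ut_pos[of x] by (simp add: field_simps)
    finally have qa: "\<bar>q - 1\<bar> \<le> a" .
    have eq: "\<psi> (z + x) - \<psi> x = ln q" using Ut_pos[of x] Ut_pos[of "z + x"] by (simp add: \<psi>_def q_def ln_div)
    have "ln q \<le> a" using ln_le_minus_one[OF q] qa by linarith
    moreover have "- ln q \<le> 2 * a"
    proof -
      have "- ln q = ln (1 / q)" using q by (simp add: ln_div)
      also have "\<dots> \<le> 1 / q - 1" using q by (intro ln_le_minus_one) simp
      also have "\<dots> = (1 - q) / q" using q by (simp add: field_simps)
      also have "\<dots> \<le> a / (1 / 2)" using qa a q by (intro frac_le) linarith+
      finally show ?thesis by simp
    qed
    ultimately show ?thesis unfolding eq using a by linarith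
  qed
  then show "\<exists>V. open V \<and> 0 \<in> V \<and> (\<forall>z\<in>V. \<forall>x. \<bar>\<psi> (z + x) - \<psi> x\<bar> \<le> e)" using V by blast
next
  fix y assume y: "y \<in> H"
  then obtain C where C: "C > 0" "\<And>x. U (y + x) \<le> C * U x" "\<And>x. U (- y + x) \<le> C * U x" by (auto simp: H_def)
  have "\<bar>\<psi> (y + x) - \<psi> x\<bar> \<le> \<bar>ln C\<bar>" for x
  proof -
    have "Ut (y + x) \<le> C * Ut x" using C(2)[of "x + d x"] Ut_translate[OF y, of x] by (simp add: Ut_def)
    then have "\<psi> (y + x) \<le> ln (C * Ut x)" unfolding \<psi>_def using Ut_pos C by (subst ln_le_cancel_iff) auto
    moreover have "Ut x \<le> C * Ut (y + x)"
      using C(3)[of "y + (x + d x)"] Ut_translate[OF y, of x] by (simp add: Ut_def add.assoc[symmetric])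
    then have "\<psi> x \<le> ln (C * Ut (y + x))" unfolding \<psi>_def using Ut_pos C by (subst ln_le_cancel_iff) auto
    ultimately have "\<psi> (y + x) \<le> ln C + \<psi> x" "\<psi> x \<le> ln C + \<psi> (y + x)"
      unfolding \<psi>_def using Ut_pos[of x] Ut_pos[of "y + x"] C(1) by (simp_all add: ln_mult)
    then show ?thesis by linarith
  qed
  then show "\<exists>B. \<forall>x. \<bar>\<psi> (y + x) - \<psi> x\<bar> \<le> B" by blast
qed

end

section \<open>Means of increments and the contradiction\<close>

locale walk_mean = walk M \<mu> K b S p \<rho> + mean m
  for M \<mu> :: "'a::{topological_group_add, t2_space} measure" and K b S p \<rho>
    and m :: "('a \<Rightarrow> real) \<Rightarrow> real"
begin

text \<open>Off \<open>H\<close> the increments may be unbounded and their mean is meaningless.\<close>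

definition \<xi> :: "('a \<Rightarrow> real) \<Rightarrow> 'a \<Rightarrow> real" where
  "\<xi> \<phi> y = (if y \<in> H then m (\<lambda>x. \<phi> (y + x) - \<phi> x) else 0)"

lemma H_add_iff: "y \<in> H \<Longrightarrow> y + z \<in> H \<longleftrightarrow> z \<in> H"
  using H_add[of y z] H_add[OF H_uminus[of y], of "y + z"] by (auto simp: add.assoc[symmetric])

text \<open>The increment by \<open>y + z\<close> splits at \<open>z + x\<close>. Its first part is
  a left translate of the increment by \<open>y\<close>, and invariance of the mean removes the
  translation.\<close>

lemma \<xi>_add:
  assumes \<phi>: "reg \<phi>" and y: "y \<in> H" and z: "z \<in> H" shows "\<xi> \<phi> (y + z) = \<xi> \<phi> y + \<xi> \<phi> z"
proof -
  have "m (\<lambda>x. (\<phi> (y + (z + x)) - \<phi> (z + x)) + (\<phi> (z + x) - \<phi> x)) = m (\<lambda>x. \<phi> (y + (z + x)) - \<phi> (z + x)) + m (\<lambda>x. \<phi> (z + x) - \<phi> x)"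
    by (rule m_add) (use reg_increment[OF \<phi> z] bc_translate[OF reg_increment[OF \<phi> y], of z] in auto)
  also have "m (\<lambda>x. \<phi> (y + (z + x)) - \<phi> (z + x)) = m (\<lambda>x. \<phi> (y + x) - \<phi> x)"
    by (rule m_translate[OF reg_increment[OF \<phi> y], of z])
  finally show ?thesis using y z H_add[OF y z] by (simp add: \<xi>_def add.assoc)
qed

lemma \<xi>_0: "\<xi> \<phi> 0 = 0"
  by (simp add: \<xi>_def m_const)

lemma \<xi>_uminus:
  assumes "reg \<phi>" shows "\<xi> \<phi> (- y) = - \<xi> \<phi> y"
proof (cases "y \<in> H")
  case True
  then show ?thesis using \<xi>_add[OF assms True H_uminus[OF True]] \<xi>_0[of \<phi>] by simp
next
  case False
  then have "- y \<notin> H" using H_uminus[of "- y"] by auto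
  then show ?thesis using False by (simp add: \<xi>_def)
qed

lemma \<xi>_modulus:
  assumes \<phi>: "reg \<phi>" and z: "z \<in> H" "\<And>x. \<bar>\<phi> (z + x) - \<phi> x\<bar> \<le> e" and e: "0 \<le> e"
  shows "\<bar>\<xi> \<phi> (z + x) - \<xi> \<phi> x\<bar> \<le> e"
proof (cases "x \<in> H")
  case True
  have "\<xi> \<phi> (z + x) - \<xi> \<phi> x = \<xi> \<phi> z" using \<xi>_add[OF \<phi> z(1) True] by simp
  moreover have "\<bar>m (\<lambda>x. \<phi> (z + x) - \<phi> x)\<bar> \<le> e" by (rule m_abs[OF reg_increment[OF \<phi> z(1)] z(2)])
  ultimately show ?thesis using z by (simp add: \<xi>_def)
next
  case False
  then show ?thesis using H_add_iff[OF z(1), of x] e by (simp add: \<xi>_def)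
qed

lemma continuous_\<xi>: "reg \<phi> \<Longrightarrow> continuous_on UNIV (\<xi> \<phi>)"
proof (rule continuous_of_modulus)
  fix e :: real and x assume \<phi>: "reg \<phi>" and e: "e > 0"
  obtain V where V: "open V" "0 \<in> V" "V \<subseteq> H" "\<And>z x. z \<in> V \<Longrightarrow> \<bar>\<phi> (z + x) - \<phi> x\<bar> \<le> e"
    using reg_modulus[OF \<phi> e] by metis
  have "\<forall>z\<in>V. \<bar>\<xi> \<phi> (z + x) - \<xi> \<phi> x\<bar> \<le> e" using \<xi>_modulus[OF \<phi>] V e by (auto simp: less_imp_le)
  then show "\<exists>V. open V \<and> 0 \<in> V \<and> (\<forall>z\<in>V. \<bar>\<xi> \<phi> (z + x) - \<xi> \<phi> x\<bar> \<le> e)" using V by blast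
qed

text \<open>The bounded difference \<open>g\<close> contributes the increments
  \<open>g (y + x) - g x\<close>, which have mean zero by invariance. So averaging a function does
  not change its homomorphism.\<close>

lemma \<xi>_cong:
  assumes "reg \<phi>" "bc (\<lambda>x. a x - \<phi> x)"
  shows "\<xi> a = \<xi> \<phi>"
proof
  fix y
  show "\<xi> a y = \<xi> \<phi> y"
  proof (cases "y \<in> H")
    case True
    define g where "g x = a x - \<phi> x" for x
    have g: "bc g" using assms(2) by (simp add: g_def[abs_def])
    have "(\<lambda>x. a (y + x) - a x) = (\<lambda>x. (\<phi> (y + x) - \<phi> x) + (g (y + x) - g x))" by (auto simp: g_def)
    then have "m (\<lambda>x. a (y + x) - a x) = m (\<lambda>x. \<phi> (y + x) - \<phi> x) + m (\<lambda>x. g (y + x) - g x)"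
      using m_add[OF reg_increment[OF assms(1) True] bc_diff[OF bc_translate[OF g, of y] g]] by simp
    also have "m (\<lambda>x. g (y + x) - g x) = 0" using m_diff[OF bc_translate[OF g, of y] g] m_translate[OF g, of y] by simp
    finally show ?thesis using True by (simp add: \<xi>_def)
  qed (simp add: \<xi>_def)
qed

text \<open>A mean is only finitely additive and need not commute with integrals over
  \<open>\<nu>\<close>. One choice of nodes and weights approximates the averaged increment
  uniformly in \<open>x\<close> and, at the same time, the integral of
  \<open>\<xi> \<phi>\<close>.\<close>

lemma avg_approximation:
  assumes \<phi>: "reg \<phi>" and "compact_prob \<nu> L" and L: "L \<subseteq> H" and e: "e > 0"
  shows "\<exists>(n::nat) ys w. (\<forall>k<n. ys k \<in> H) \<and>
    (\<forall>x. \<bar>(avg \<nu> \<phi> x - \<phi> x) - (\<Sum>k<n. w k * (\<phi> (ys k + x) - \<phi> x))\<bar> \<le> e) \<and>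
    \<bar>(\<integral>t. \<xi> \<phi> t \<partial>\<nu>) - (\<Sum>k<n. w k * \<xi> \<phi> (ys k))\<bar> \<le> e"
proof -
  interpret nu: compact_prob \<nu> L by fact
  obtain V where V: "open V" "0 \<in> V" "V \<subseteq> H" "\<And>z x. z \<in> V \<Longrightarrow> \<bar>\<phi> (z + x) - \<phi> x\<bar> \<le> e"
    using reg_modulus[OF \<phi> e] by metis
  define V' where "V' y = (\<lambda>t. t + - y) -` V" for y
  have V': "open (V' y) \<and> y \<in> V' y" for y
    unfolding V'_def using V by (auto intro!: open_vimage continuous_intros)
  obtain n :: nat and ys and w :: "nat \<Rightarrow> real" where *: "\<forall>k<n. ys k \<in> L"
    "\<forall>f e. integrable \<nu> f \<longrightarrow> (\<forall>y\<in>L. \<forall>t\<in>V' y. \<bar>f t - f y\<bar> \<le> e) \<longrightarrow>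
       \<bar>(\<integral>t. f t \<partial>\<nu>) - (\<Sum>k<n. w k * f (ys k))\<bar> \<le> e"
    using nu.simple_approximation[of V', OF V'] by blast
  have dec: "t = (t + - y) + y" for t y :: 'a by (simp only: add.assoc) simp
  show ?thesis
  proof (intro exI[of _ n] exI[of _ ys] exI[of _ w] conjI allI impI)
    show "ys k \<in> H" if "k < n" for k using *(1) that L by auto
  next
    note i = nu.integrable_translate[OF reg_continuous[OF \<phi>]]
    fix x
    have "\<bar>(\<integral>t. \<phi> (t + x) - \<phi> x \<partial>\<nu>) - (\<Sum>k<n. w k * (\<phi> (ys k + x) - \<phi> x))\<bar> \<le> e"
    proof (rule *(2)[rule_format])
      show "integrable \<nu> (\<lambda>t. \<phi> (t + x) - \<phi> x)" using i nu.integrable_const by (intro Bochner_Integration.integrable_diff)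
      fix y t assume "t \<in> V' y"
      then have "\<bar>\<phi> ((t + - y) + (y + x)) - \<phi> (y + x)\<bar> \<le> e" by (intro V(4)) (simp add: V'_def)
      then show "\<bar>(\<phi> (t + x) - \<phi> x) - (\<phi> (y + x) - \<phi> x)\<bar> \<le> e" using dec[of t y] by (simp add: add.assoc[symmetric])
    qed
    moreover have "(\<integral>t. \<phi> (t + x) - \<phi> x \<partial>\<nu>) = avg \<nu> \<phi> x - \<phi> x"
      using i nu.integrable_const by (simp add: avg_def nu.space_nu nu.measure_UNIV)
    ultimately show "\<bar>(avg \<nu> \<phi> x - \<phi> x) - (\<Sum>k<n. w k * (\<phi> (ys k + x) - \<phi> x))\<bar> \<le> e" by simp
  next
    show "\<bar>(\<integral>t. \<xi> \<phi> t \<partial>\<nu>) - (\<Sum>k<n. w k * \<xi> \<phi> (ys k))\<bar> \<le> e"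
    proof (rule *(2)[rule_format, OF nu.integrable_continuous[OF continuous_\<xi>[OF \<phi>]]])
      fix y t assume "t \<in> V' y"
      then have z: "t + - y \<in> V" by (simp add: V'_def)
      have "\<bar>\<xi> \<phi> ((t + - y) + y) - \<xi> \<phi> y\<bar> \<le> e"
        by (rule \<xi>_modulus[OF \<phi>]) (use z V e in auto)
      then show "\<bar>\<xi> \<phi> t - \<xi> \<phi> y\<bar> \<le> e" using dec[of t y] by simp
    qed
  qed
qed

text \<open>On the finite sums of \<open>avg_approximation\<close> the mean acts term by term and
  turns increments into values of \<open>\<xi> \<phi>\<close>; the errors on both sides are
  arbitrarily small.\<close>

lemma avg_increment:
  assumes \<phi>: "reg \<phi>" and "compact_prob \<nu> L" and L: "L \<subseteq> H"
  shows "bc (\<lambda>x. avg \<nu> \<phi> x - \<phi> x)" "m (\<lambda>x. avg \<nu> \<phi> x - \<phi> x) = (\<integral>t. \<xi> \<phi> t \<partial>\<nu>)"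
proof -
  interpret nu: compact_prob \<nu> L by fact
  have c: "continuous_on UNIV (\<lambda>x. avg \<nu> \<phi> x - \<phi> x)"
    by (intro continuous_intros nu.continuous_avg reg_continuous \<phi>)
  have bcs: "bc (\<lambda>x. \<Sum>k<n. w k * (\<phi> (ys k + x) - \<phi> x))" if ys: "\<And>k. k < n \<Longrightarrow> ys k \<in> H" for n :: nat and ys w
    by (rule bc_sum) (use ys in \<open>auto intro!: bc_cmult reg_increment[OF \<phi>]\<close>)
  show b: "bc (\<lambda>x. avg \<nu> \<phi> x - \<phi> x)"
  proof -
    obtain n :: nat and ys w where *: "\<And>k. k < n \<Longrightarrow> ys k \<in> H"
      "\<And>x. \<bar>(avg \<nu> \<phi> x - \<phi> x) - (\<Sum>k<n. w k * (\<phi> (ys k + x) - \<phi> x))\<bar> \<le> 1"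
      "\<bar>(\<integral>t. \<xi> \<phi> t \<partial>\<nu>) - (\<Sum>k<n. w k * \<xi> \<phi> (ys k))\<bar> \<le> 1"
      using avg_approximation[OF assms zero_less_one] by blast
    obtain B where B: "\<And>x. \<bar>\<Sum>k<n. w k * (\<phi> (ys k + x) - \<phi> x)\<bar> \<le> B" using bc_bound[OF bcs[of n ys w, OF *(1)]] by auto
    have "\<bar>avg \<nu> \<phi> x - \<phi> x\<bar> \<le> B + 1" for x using B[of x] *(2)[of x] by linarith
    then show ?thesis by (rule bcI[OF c])
  qed
  have "\<bar>m (\<lambda>x. avg \<nu> \<phi> x - \<phi> x) - (\<integral>t. \<xi> \<phi> t \<partial>\<nu>)\<bar> \<le> 0 + e" if "e > 0" for e
  proof -
    have e2: "e / 2 > 0" using that by simp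
    obtain n :: nat and ys w where *: "\<And>k. k < n \<Longrightarrow> ys k \<in> H"
      "\<And>x. \<bar>(avg \<nu> \<phi> x - \<phi> x) - (\<Sum>k<n. w k * (\<phi> (ys k + x) - \<phi> x))\<bar> \<le> e / 2"
      "\<bar>(\<integral>t. \<xi> \<phi> t \<partial>\<nu>) - (\<Sum>k<n. w k * \<xi> \<phi> (ys k))\<bar> \<le> e / 2"
      using avg_approximation[OF assms e2] by blast
    have "m (\<lambda>x. \<Sum>k<n. w k * (\<phi> (ys k + x) - \<phi> x)) = (\<Sum>k<n. m (\<lambda>x. w k * (\<phi> (ys k + x) - \<phi> x)))"
      by (rule m_sum) (use *(1) in \<open>auto intro!: bc_cmult reg_increment[OF \<phi>]\<close>)
    also have "\<dots> = (\<Sum>k<n. w k * \<xi> \<phi> (ys k))"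
      using *(1) by (intro sum.cong) (auto simp: \<xi>_def m_cmult reg_increment[OF \<phi>])
    finally have "m (\<lambda>x. (avg \<nu> \<phi> x - \<phi> x) - (\<Sum>k<n. w k * (\<phi> (ys k + x) - \<phi> x))) = m (\<lambda>x. avg \<nu> \<phi> x - \<phi> x) - (\<Sum>k<n. w k * \<xi> \<phi> (ys k))"
      using m_diff[OF b bcs[of n ys w, OF *(1)]] by simp
    moreover have "\<bar>m (\<lambda>x. (avg \<nu> \<phi> x - \<phi> x) - (\<Sum>k<n. w k * (\<phi> (ys k + x) - \<phi> x)))\<bar> \<le> e / 2"
      by (rule m_abs[OF bc_diff[OF b bcs[of n ys w, OF *(1)]] *(2)])
    ultimately show ?thesis using *(3) by linarith
  qed
  then have "\<bar>m (\<lambda>x. avg \<nu> \<phi> x - \<phi> x) - (\<integral>t. \<xi> \<phi> t \<partial>\<nu>)\<bar> \<le> 0" by (rule field_le_epsilon)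
  then show "m (\<lambda>x. avg \<nu> \<phi> x - \<phi> x) = (\<integral>t. \<xi> \<phi> t \<partial>\<nu>)" by simp
qed

lemma reg_perturb_bound:
  assumes "reg \<phi>" "bc (\<lambda>x. a x - \<phi> x)" "y \<in> H" shows "\<exists>B. \<forall>x. \<bar>a (y + x) - a x\<bar> \<le> B"
proof -
  obtain A where A: "\<And>x. \<bar>a x - \<phi> x\<bar> \<le> A" using bc_bound[OF assms(2)] by blast
  obtain B where B: "\<And>x. \<bar>\<phi> (y + x) - \<phi> x\<bar> \<le> B" using reg_bound[OF assms(1,3)] by blast
  have "\<bar>a (y + x) - a x\<bar> \<le> 2 * A + B" for x
    using A[of x] A[of "y + x"] B[of x] by linarith
  then show ?thesis by blast
qed

lemma reg_avg:
  assumes \<phi>: "reg \<phi>" and "compact_prob \<nu> L" and L: "L \<subseteq> H"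
  shows "reg (avg \<nu> \<phi>)"
  unfolding reg_def
proof (intro conjI allI impI ballI)
  interpret nu: compact_prob \<nu> L by fact
  fix e :: real assume e: "e > 0"
  obtain V where V: "open V" "0 \<in> V" "\<And>z x. z \<in> V \<Longrightarrow> \<bar>\<phi> (z + x) - \<phi> x\<bar> \<le> e"
    using reg_modulus[OF \<phi> e] by metis
  \<comment> \<open>Since \<open>t + (z + x) = (t + z + - t) + (t + x)\<close>, the modulus of
    \<open>\<phi>\<close> is applied to conjugates of \<open>z\<close>. The tube lemma makes these
    small for all \<open>t\<close> in the compact \<open>L\<close> at once.\<close>
  have o: "open ((\<lambda>(z, t). t + z + - t) -` V)" unfolding case_prod_beta by (intro open_vimage V continuous_intros)
  have "{0} \<times> L \<subseteq> (\<lambda>(z, t). t + z + - t) -` V" using V(2) by auto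
  from Elementary_Topology.tube_lemma[OF nu.compact_K o this]
  obtain X where X: "0 \<in> X" "open X" "X \<times> L \<subseteq> (\<lambda>(z, t). t + z + - t) -` V" by blast
  have "\<bar>avg \<nu> \<phi> (z + x) - avg \<nu> \<phi> x\<bar> \<le> e" if z: "z \<in> X" for z x
  proof -
    note i = nu.integrable_translate[OF reg_continuous[OF \<phi>]]
    have "\<bar>avg \<nu> \<phi> (z + x) - avg \<nu> \<phi> x\<bar> = \<bar>\<integral>t. \<phi> (t + (z + x)) - \<phi> (t + x) \<partial>\<nu>\<bar>"
      unfolding avg_def using i by simp
    also have "\<dots> \<le> (\<integral>t. \<bar>\<phi> (t + (z + x)) - \<phi> (t + x)\<bar> \<partial>\<nu>)" by (rule integral_abs_bound)
    also have "\<dots> \<le> (\<integral>t. e \<partial>\<nu>)"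
    proof (rule integral_mono_AE)
      have "\<bar>\<phi> (t + (z + x)) - \<phi> (t + x)\<bar> \<le> e" if "t \<in> L" for t
      proof -
        have "t + z + - t \<in> V" using X(3) z that by auto
        from V(3)[OF this, of "t + x"]
        have "\<bar>\<phi> (t + z + - t + (t + x)) - \<phi> (t + x)\<bar> \<le> e" .
        moreover have "t + z + - t + (t + x) = t + (z + x)" by (simp only: add.assoc minus_add_cancel)
        ultimately show ?thesis by simp
      qed
      then show "AE t in \<nu>. \<bar>\<phi> (t + (z + x)) - \<phi> (t + x)\<bar> \<le> e" using nu.AE_K by (auto elim!: eventually_mono)
    qed (use i nu.integrable_const in auto)
    also have "\<dots> = e" by (rule nu.integral_const)
    finally show ?thesis .
  qed
  then show "\<exists>V. open V \<and> 0 \<in> V \<and> (\<forall>z\<in>V. \<forall>x. \<bar>avg \<nu> \<phi> (z + x) - avg \<nu> \<phi> x\<bar> \<le> e)" using X by blast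
next
  fix y assume y: "y \<in> H"
  show "\<exists>B. \<forall>x. \<bar>avg \<nu> \<phi> (y + x) - avg \<nu> \<phi> x\<bar> \<le> B"
    by (rule reg_perturb_bound[OF \<phi> avg_increment(1)[OF assms] y])
qed

lemma reg_midpoint:
  assumes "reg f" "reg g" shows "reg (\<lambda>x. (f x + g x) / 2)"
  unfolding reg_def
proof (intro conjI allI impI ballI)
  fix e :: real assume e: "e > 0"
  obtain V where V: "open V" "0 \<in> V" "\<And>z x. z \<in> V \<Longrightarrow> \<bar>f (z + x) - f x\<bar> \<le> e" using reg_modulus[OF assms(1) e] by metis
  obtain V' where V': "open V'" "0 \<in> V'" "\<And>z x. z \<in> V' \<Longrightarrow> \<bar>g (z + x) - g x\<bar> \<le> e" using reg_modulus[OF assms(2) e] by metis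
  have "\<bar>(f (z + x) + g (z + x)) / 2 - (f x + g x) / 2\<bar> \<le> e" if "z \<in> V \<inter> V'" for z x
    using V(3)[of z x] V'(3)[of z x] that by (simp add: abs_le_iff field_simps)
  then show "\<exists>V. open V \<and> 0 \<in> V \<and> (\<forall>z\<in>V. \<forall>x. \<bar>(f (z + x) + g (z + x)) / 2 - (f x + g x) / 2\<bar> \<le> e)"
    using V V' by (intro exI[of _ "V \<inter> V'"]) auto
next
  fix y assume y: "y \<in> H"
  obtain A where A: "\<And>x. \<bar>f (y + x) - f x\<bar> \<le> A" using reg_bound[OF assms(1) y] by blast
  obtain B where B: "\<And>x. \<bar>g (y + x) - g x\<bar> \<le> B" using reg_bound[OF assms(2) y] by blast
  have "\<bar>(f (y + x) + g (y + x)) / 2 - (f x + g x) / 2\<bar> \<le> A + B" for x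
    using A[of x] B[of x] by (simp add: abs_le_iff field_simps)
  then show "\<exists>B. \<forall>x. \<bar>(f (y + x) + g (y + x)) / 2 - (f x + g x) / 2\<bar> \<le> B" by blast
qed

text \<open>\<open>P \<psi> - \<psi>\<close> is telescoped along the layers. By
  \<open>\<xi>_cong\<close> every stage has the homomorphism \<open>\<xi> \<psi>\<close>, which is
  odd: \<open>\<mu>\<close> and \<open>\<mu>'\<close> contribute opposite integrals, and the
  symmetric \<open>\<beta>\<close> contributes zero.\<close>

lemma no_norm_contraction: False
proof -
  define \<phi>1 where "\<phi>1 = avg \<mu> \<psi>"
  define \<phi>2 where "\<phi>2 = W \<psi>"
  note mu_axioms = mu.compact_prob_axioms mu'.compact_prob_axioms beta.compact_prob_axioms
  have b1: "bc (\<lambda>x. \<phi>1 x - \<psi> x)" and m1: "m (\<lambda>x. \<phi>1 x - \<psi> x) = (\<integral>t. \<xi> \<psi> t \<partial>\<mu>)"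
    unfolding \<phi>1_def using avg_increment[OF reg_\<psi> mu_axioms(1) K_H(1)] by blast+
  have r1: "reg \<phi>1" unfolding \<phi>1_def by (rule reg_avg[OF reg_\<psi> mu_axioms(1) K_H(1)])
  have c1: "\<xi> \<phi>1 = \<xi> \<psi>" by (rule \<xi>_cong[OF reg_\<psi> b1])
  have b2: "bc (\<lambda>x. avg \<mu>' \<phi>1 x - \<phi>1 x)" and m2: "m (\<lambda>x. avg \<mu>' \<phi>1 x - \<phi>1 x) = (\<integral>t. \<xi> \<psi> t \<partial>\<mu>')"
    using avg_increment[OF r1 mu_axioms(2) K_H(2)] c1 by auto
  have "(\<integral>t. \<xi> \<psi> t \<partial>\<mu>') = (\<integral>t. \<xi> \<psi> (- t) \<partial>\<mu>)"
    unfolding \<mu>'_def using borel_measurable_continuous_onI[OF continuous_\<xi>[OF reg_\<psi>]]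
    by (intro integral_distr) (auto simp: mu.measurable_nu)
  also have "\<dots> = - (\<integral>t. \<xi> \<psi> t \<partial>\<mu>)" by (simp add: \<xi>_uminus[OF reg_\<psi>])
  finally have m2': "m (\<lambda>x. avg \<mu>' \<phi>1 x - \<phi>1 x) = - (\<integral>t. \<xi> \<psi> t \<partial>\<mu>)" using m2 by simp
  have eqW: "\<phi>2 x - \<psi> x = 1 / 2 * ((avg \<mu>' \<phi>1 x - \<phi>1 x) + (\<phi>1 x - \<psi> x))" for x
    by (simp add: \<phi>2_def \<phi>1_def W_def field_simps)
  have b3: "bc (\<lambda>x. \<phi>2 x - \<psi> x)" unfolding eqW by (intro bc_cmult bc_add b1 b2)
  have m3: "m (\<lambda>x. \<phi>2 x - \<psi> x) = 0" unfolding eqW using m_cmult[OF bc_add[OF b2 b1], of "1/2"] m_add[OF b2 b1] m1 m2' by simp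
  have r2: "reg \<phi>2" unfolding \<phi>2_def W_def[abs_def]
    using reg_midpoint[OF reg_avg[OF r1 mu_axioms(2) K_H(2)] reg_\<psi>] by (simp add: \<phi>1_def)
  have c2: "\<xi> \<phi>2 = \<xi> \<psi>" by (rule \<xi>_cong[OF reg_\<psi> b3])
  have b4: "bc (\<lambda>x. P \<psi> x - \<phi>2 x)" and m4: "m (\<lambda>x. P \<psi> x - \<phi>2 x) = (\<integral>t. \<xi> \<psi> t \<partial>\<beta>)"
    using avg_increment[OF r2 mu_axioms(3) S_H] c2 by (auto simp: P_def \<phi>2_def)
  have "(\<integral>t. \<xi> \<psi> (- t) \<partial>\<beta>) = (\<integral>t. \<xi> \<psi> t \<partial>\<beta>)" by (rule integral_\<beta>_uminus[OF continuous_\<xi>[OF reg_\<psi>]])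
  then have m4': "m (\<lambda>x. P \<psi> x - \<phi>2 x) = 0" using m4 by (simp add: \<xi>_uminus[OF reg_\<psi>])
  have eqP: "P \<psi> x - \<psi> x = (P \<psi> x - \<phi>2 x) + (\<phi>2 x - \<psi> x)" for x by simp
  have b5: "bc (\<lambda>x. P \<psi> x - \<psi> x)" unfolding eqP by (rule bc_add[OF b4 b3])
  have "m (\<lambda>x. P \<psi> x - \<psi> x) = 0" unfolding eqP using m_add[OF b4 b3] m4' m3 by simp
  moreover have "m (\<lambda>x. P \<psi> x - \<psi> x) \<le> m (\<lambda>_. - ln r)"
    using \<psi>_superharmonic by (intro m_mono b5 bc_const) (simp add: algebra_simps)
  ultimately have "ln r \<le> 0" by (simp add: m_const)
  then show False using r by simp
qed

end

text \<open>The kernel is chosen after \<open>K\<close>: its support has to contain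
  \<open>K\<close>, so that the translations of \<open>\<mu>\<close> belong to the subgroup
  \<open>H\<close>.\<close>

theorem (in haar) amenable_average_norm:
  assumes am: "amenable M" and \<mu>: "compact_prob \<mu> K" and p: "1 < p" and \<rho>: "0 \<le> \<rho>"
    and contr: "\<And>F. cc F \<Longrightarrow> (\<And>x. 0 \<le> F x) \<Longrightarrow> (\<integral>x. avg \<mu> F x powr p \<partial>M) \<le> \<rho> * (\<integral>x. F x powr p \<partial>M)"
  shows "1 \<le> \<rho>"
proof (rule ccontr)
  assume "\<not> 1 \<le> \<rho>"
  then have \<rho>1: "\<rho> < 1" by simp
  interpret mu: compact_prob \<mu> K by fact
  obtain m :: "('a \<Rightarrow> real) \<Rightarrow> real" where m: "mean m" using amenable_imp_mean[OF am] .
  show False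
  proof (rule kernel_exists[OF mu.compact_K])
    fix b :: "'a \<Rightarrow> real" and S
    assume b: "cc b" "\<And>x. 0 \<le> b x" "(\<integral>x. b x \<partial>M) = 1" "\<And>s. b (- s) * D s = b s" "b 0 > 0"
      "compact S" "K \<subseteq> S" "\<And>x. x \<notin> S \<Longrightarrow> b x = 0" "\<And>x. x \<in> S \<Longrightarrow> - x \<in> S" "0 \<in> S"
      "\<exists>C>0. \<forall>y\<in>S. \<forall>s. b (y + s) \<le> C * cv (cv b b) (cv b b) s"
      "\<And>e. e > 0 \<Longrightarrow> \<exists>V. open V \<and> 0 \<in> V \<and> V \<subseteq> S \<and> (\<forall>v\<in>V. \<forall>s. \<bar>b (v + s) - b s\<bar> \<le> e * cv (cv b b) (cv b b) s)"
    interpret walk M \<mu> K b S p \<rho> by unfold_locales (fact b p \<rho> \<rho>1 contr)+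
    interpret mean m by fact
    interpret walk_mean M \<mu> K b S p \<rho> m ..
    show False by (rule no_norm_contraction)
  qed
qed

subsection \<open>Bounded convolvers\<close>

context haar begin

lemma omega_eq: "omega M q x = D x powr (1 / q)"
proof -
  have "omega M q x = (1 / D x) powr (- (1 / q))" by (simp add: omega_def modular_function_eq D_uminus)
  then show ?thesis using D_pos[of x] by (simp add: powr_divide powr_minus_divide)
qed

lemma Lp_borel: "g \<in> Lp M p \<Longrightarrow> g \<in> borel_measurable borel"
  by (simp add: Lp_def)

lemma Lp_integrable: "g \<in> Lp M p \<Longrightarrow> integrable M (\<lambda>x. norm (g x) powr p)"
  by (simp add: Lp_def)

lemma sigma_finite_support_Lp:
  assumes g: "g \<in> Lp M p" shows "sigma_finite_support g"
proof -
  have [measurable]: "g \<in> borel_measurable borel" by (rule Lp_borel[OF g])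
  have "sigma_finite_support (\<lambda>x. ennreal (norm (g x) powr p))"
  proof (rule sigma_finite_support_of_nn_integral)
    show "(\<integral>\<^sup>+x. ennreal (norm (g x) powr p) \<partial>M) < \<infinity>"
      using Lp_integrable[OF g] by (subst nn_integral_eq_integral) auto
  qed measurable
  then show ?thesis by (rule sigma_finite_support_mono) simp
qed

text \<open>The exceptional null set of \<open>f\<close> is seen through inversion and a
  translation. It is controlled only where \<open>g\<close> does not vanish, which is why the factor
  \<open>g y\<close> is kept on both sides.\<close>

lemma conv_nonneg_eq:
  assumes g: "sigma_finite_support g" and f: "AE x in M. f x \<in> \<real>\<^sub>\<ge>\<^sub>0"
  shows "AE y in M. g y * f (- y + x) = g y * complex_of_real (norm (f (- y + x)))"
proof -
  obtain N where N: "N \<in> null_sets M" "\<And>x. x \<notin> N \<Longrightarrow> f x \<in> \<real>\<^sub>\<ge>\<^sub>0" using f by (auto elim!: AE_E3)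
  have "f z = complex_of_real (norm (f z))" if "z \<notin> N" for z
    using N(2)[OF that] by (auto simp: nonneg_Reals_def)
  then show ?thesis using AE_inverse_translate[OF g N(1), of x] by (auto elim!: eventually_mono)
qed

lemma integrable_conv_iff:
  assumes [measurable]: "g \<in> borel_measurable borel" "f \<in> borel_measurable borel"
  shows "integrable M (\<lambda>y. g y * f (- y + x)) \<longleftrightarrow> conv_nn (\<lambda>y. ennreal (norm (g y :: complex))) (\<lambda>y. ennreal (norm (f y))) x < \<infinity>"
proof -
  have "(\<integral>\<^sup>+y. ennreal (norm (g y * f (- y + x))) \<partial>M) = conv_nn (\<lambda>y. ennreal (norm (g y))) (\<lambda>y. ennreal (norm (f y))) x"
    unfolding conv_nn_def by (simp add: norm_mult ennreal_mult)
  moreover have "(\<lambda>y. g y * f (- y + x)) \<in> borel_measurable M" by simp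
  ultimately show ?thesis by (simp add: integrable_iff_bounded)
qed

text \<open>The integrand need not be measurable on the product, so measurability in
  \<open>x\<close> is drawn from \<open>tonelli\<close>: positive and negative parts of
  \<open>Re\<close> and \<open>Im\<close> of \<open>g\<close> are convolved separately with the norm
  of \<open>f\<close> and recombined.\<close>

lemma borel_measurable_conv:
  assumes g: "g \<in> borel_measurable borel" "sigma_finite_support g"
    and f: "f \<in> borel_measurable borel" "sigma_finite_support f" and fn: "AE x in M. f x \<in> \<real>\<^sub>\<ge>\<^sub>0"
  shows "conv M g f \<in> borel_measurable borel"
proof -
  note [measurable] = g(1) f(1)
  define F where "F y = ennreal (norm (f y))" for y
  define N where "N = conv_nn (\<lambda>y. ennreal (norm (g y))) F"
  define h where "h k x = enn2real (conv_nn (\<lambda>y. ennreal (k (g y))) F x) - enn2real (conv_nn (\<lambda>y. ennreal (- k (g y))) F x)" for k :: "complex \<Rightarrow> real" and x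
  have Fs: "F \<in> borel_measurable borel" "sigma_finite_support F"
    unfolding F_def by measurable (rule sigma_finite_support_mono[OF f(2)], simp)
  have cm: "conv_nn (\<lambda>y. ennreal (k (g y))) F \<in> borel_measurable borel" if [measurable]: "k \<in> borel_measurable borel" "k 0 = 0" for k
  proof -
    have "sigma_finite_support (\<lambda>y. ennreal (k (g y)))"
      by (rule sigma_finite_support_mono[OF g(2)]) (use \<open>k 0 = 0\<close> in auto)
    then have "tonelli (\<lambda>y. ennreal (k (g y))) F"
      by (intro tonelli_sigma_finite_support Fs) auto
    then show ?thesis by (simp add: tonelli_def)
  qed
  have Nm[measurable]: "N \<in> borel_measurable borel" unfolding N_def by (rule cm) auto
  have hm: "h k \<in> borel_measurable borel" if "k \<in> borel_measurable borel" "k 0 = 0" for k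
  proof -
    have "conv_nn (\<lambda>y. ennreal (- k (g y))) F \<in> borel_measurable borel"
      using cm[of "\<lambda>z. - k z"] that by auto
    with cm[OF that] show ?thesis unfolding h_def[abs_def] by measurable
  qed
  have [measurable]: "h Re \<in> borel_measurable borel" "h Im \<in> borel_measurable borel"
    by (intro hm; simp)+
  \<comment> \<open>Where the integral does not converge absolutely, \<open>conv\<close> has the
    default value \<open>0\<close>; this set is measurable because \<open>N\<close> is.\<close>
  have eq: "conv M g f x = (if N x < \<infinity> then complex_of_real (h Re x) + \<i> * complex_of_real (h Im x) else 0)" for x
  proof (cases "N x < \<infinity>")
    case True
    then have int: "integrable M (\<lambda>y. g y * f (- y + x))" by (simp add: integrable_conv_iff N_def F_def[abs_def])
    have AE: "AE y in M. g y * f (- y + x) = g y * complex_of_real (norm (f (- y + x)))"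
      by (rule conv_nonneg_eq[OF g(2) fn])
    have int': "integrable M (\<lambda>y. g y * complex_of_real (norm (f (- y + x))))"
      using int AE by (subst integrable_cong_AE[symmetric]) auto
    have ce: "conv M g f x = (\<integral>y. g y * complex_of_real (norm (f (- y + x))) \<partial>M)"
      unfolding conv_def using AE by (intro integral_cong_AE) auto
    have part: "(\<integral>y. k (g y) * norm (f (- y + x)) \<partial>M) = h k x"
      if i: "integrable M (\<lambda>y. k (g y) * norm (f (- y + x)))" for k
      unfolding real_lebesgue_integral_def[OF i] h_def conv_nn_def F_def
      by (simp add: ennreal_mult''[symmetric])
    have "Re (conv M g f x) = h Re x"
    proof -
      have "integrable M (\<lambda>y. Re (g y) * norm (f (- y + x)))" using integrable_Re[OF int'] by simp
      from part[OF this] show ?thesis unfolding ce using integral_Re[OF int'] by simp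
    qed
    moreover have "Im (conv M g f x) = h Im x"
    proof -
      have "integrable M (\<lambda>y. Im (g y) * norm (f (- y + x)))" using integrable_Im[OF int'] by simp
      from part[OF this] show ?thesis unfolding ce using integral_Im[OF int'] by simp
    qed
    ultimately show ?thesis using True by (simp add: complex_eq_iff)
  next
    case False
    then have "\<not> integrable M (\<lambda>y. g y * f (- y + x))" by (simp add: integrable_conv_iff N_def F_def[abs_def])
    then show ?thesis using False unfolding conv_def by (simp add: not_integrable_integral_eq)
  qed
  show ?thesis unfolding eq[abs_def] by measurable
qed

text \<open>The inversion formula is applied on compact sets exhausting the support of
  \<open>g\<close> up to a null set. Whatever lies outside them is dropped, hence an
  inequality.\<close>

lemma nn_integral_inverse_translate_le:
  fixes k :: "'a \<Rightarrow> ennreal"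
  assumes k[measurable]: "k \<in> borel_measurable borel" and S: "sigma_finite_support g"
  shows "(\<integral>\<^sup>+y. (if g y \<noteq> 0 then k (- y + x) else 0) \<partial>M) \<le> (\<integral>\<^sup>+y. k y * ennreal (D y) \<partial>M)"
proof -
  obtain K where K: "\<And>n::nat. compact (K n)" "incseq K" "AE x in M. g x \<noteq> 0 \<longrightarrow> x \<in> (\<Union>n. K n)"
    using sigma_finite_support_compacts[OF S] by blast
  have [measurable]: "K n \<in> sets borel" for n using K borel_compact by blast
  have 1: "(\<integral>\<^sup>+y. k (- y + x) * indicator (K n) y \<partial>M) \<le> (\<integral>\<^sup>+y. k y * ennreal (D y) \<partial>M)" for n
  proof -
    define C where "C = uminus ` ((\<lambda>z. - x + z) ` K n)"
    have C: "compact C" unfolding C_def by (intro compact_uminus_image compact_continuous_image K continuous_intros)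
    have [measurable]: "C \<in> sets borel" using C borel_compact by blast
    have "(\<integral>\<^sup>+y. k (- y + x) * indicator (K n) y \<partial>M) = (\<integral>\<^sup>+y. k (- (x + y) + x) * indicator (K n) (x + y) \<partial>M)"
      by (rule nn_integral_left_translate[symmetric]) measurable
    also have "\<dots> = (\<integral>\<^sup>+y. k (- y) * indicator C (- y) \<partial>M)"
    proof (rule nn_integral_cong)
      fix y
      have "x + y \<in> K n \<longleftrightarrow> - y \<in> C"
        by (auto simp: C_def image_iff add.assoc[symmetric] intro!: bexI[of _ "x + y"] dest: arg_cong[of _ _ "(+) x"])
      moreover have "- (x + y) + x = - y" by (simp only: minus_add add.assoc left_minus add_0_right)
      ultimately show "k (- (x + y) + x) * indicator (K n) (x + y) = k (- y) * indicator C (- y)" by (simp add: indicator_def)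
    qed
    also have "\<dots> = (\<integral>\<^sup>+y. (k y * indicator C y) * ennreal (D y) \<partial>M)"
      by (rule nn_integral_uminus[OF _ C]) (auto simp: indicator_def)
    also have "\<dots> \<le> (\<integral>\<^sup>+y. k y * ennreal (D y) \<partial>M)"
      by (intro nn_integral_mono) (auto simp: indicator_def)
    finally show ?thesis .
  qed
  have "(\<integral>\<^sup>+y. (if g y \<noteq> 0 then k (- y + x) else 0) \<partial>M) \<le> (\<integral>\<^sup>+y. (SUP n. k (- y + x) * indicator (K n) y) \<partial>M)"
  proof (rule nn_integral_mono_AE)
    show "AE y in M. (if g y \<noteq> 0 then k (- y + x) else 0) \<le> (SUP n. k (- y + x) * indicator (K n) y)"
      using K(3)
    proof eventually_elim
      case (elim y)
      show ?case
      proof (cases "g y = 0")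
        case False
        then obtain n where "y \<in> K n" using elim by auto
        then show ?thesis by (intro SUP_upper2[of n]) auto
      qed simp
    qed
  qed
  also have "\<dots> = (SUP n. \<integral>\<^sup>+y. k (- y + x) * indicator (K n) y \<partial>M)"
    using K(2) by (intro nn_integral_monotone_convergence_SUP)
      (auto simp: incseq_def le_fun_def indicator_def subset_iff intro!: mult_left_mono)
  also have "\<dots> \<le> (\<integral>\<^sup>+y. k y * ennreal (D y) \<partial>M)" by (rule SUP_least) (rule 1)
  finally show ?thesis .
qed

text \<open>Integrated over \<open>y\<close>, the tangent inequality bounds \<open>N x\<close>
  linearly by \<open>A x\<close>, with a free parameter \<open>t > 0\<close>. Choosing
  \<open>t\<close> separately for each \<open>x\<close> yields \<open>N x\<close> to the power
  \<open>p\<close> at most \<open>w powr (p - 1) * A x\<close>, and by Tonelli \<open>A\<close> has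
  integral \<open>a * w\<close>.\<close>

lemma young_convolution:
  assumes g: "g \<in> Lp M p" and f: "f \<in> Lp M p" and fn: "AE x in M. f x \<in> \<real>\<^sub>\<ge>\<^sub>0"
    and p: "1 < p" and pq: "1 / p + 1 / q = 1" and fw: "integrable M (\<lambda>x. norm (f x) * D x powr (1 / q))"
  defines "w \<equiv> (\<integral>x. norm (f x) * D x powr (1 / q) \<partial>M)"
  shows "conv_exists M g f" "conv M g f \<in> Lp M p"
    "(\<integral>x. norm (conv M g f x) powr p \<partial>M) \<le> w powr p * (\<integral>x. norm (g x) powr p \<partial>M)"
proof -
  note gm[measurable] = Lp_borel[OF g] and fm[measurable] = Lp_borel[OF f]
  note gs = sigma_finite_support_Lp[OF g] and fs = sigma_finite_support_Lp[OF f]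
  have w0: "0 \<le> w" unfolding w_def by simp
  define F where "F y = ennreal (norm (f y))" for y
  define G where "G y = ennreal (norm (g y))" for y
  define N where "N = conv_nn G F"
  define Gp where "Gp y = ennreal (norm (g y) powr p)" for y
  define Fw where "Fw y = ennreal (norm (f y) * D y powr (1 / q))" for y
  define A where "A = conv_nn Gp Fw"
  have [measurable]: "G \<in> borel_measurable borel" "F \<in> borel_measurable borel" "Gp \<in> borel_measurable borel" "Fw \<in> borel_measurable borel"
    unfolding G_def F_def Gp_def Fw_def by measurable
  have s: "sigma_finite_support G" "sigma_finite_support F" "sigma_finite_support Gp" "sigma_finite_support Fw"
    unfolding G_def F_def Gp_def Fw_def
    by (rule sigma_finite_support_mono[OF gs] sigma_finite_support_mono[OF fs]; auto)+
  have tN: "tonelli G F" and tA: "tonelli Gp Fw" by (intro tonelli_sigma_finite_support s; measurable)+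
  have [measurable]: "N \<in> borel_measurable borel" "A \<in> borel_measurable borel"
    using tN tA by (simp_all add: tonelli_def N_def A_def)
  have Fwi: "(\<integral>\<^sup>+y. Fw y \<partial>M) = ennreal w" unfolding Fw_def w_def using fw by (intro nn_integral_eq_integral) auto
  define a where "a = (\<integral>x. norm (g x) powr p \<partial>M)"
  have a0: "0 \<le> a" unfolding a_def by simp
  have Gpi: "(\<integral>\<^sup>+y. Gp y \<partial>M) = ennreal a" unfolding Gp_def a_def using Lp_integrable[OF g] by (intro nn_integral_eq_integral) auto
  have Ai: "(\<integral>\<^sup>+x. A x \<partial>M) = ennreal (a * w)"
    using tA Fwi Gpi a0 w0 by (simp add: tonelli_def A_def ennreal_mult)
  have A_fin: "AE x in M. A x < \<infinity>"
    using nn_integral_PInf_AE[of A M] Ai by (simp add: less_top)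
  have tangent: "ennreal (p * t powr (p - 1)) * N x \<le> A x + ennreal ((p - 1) * t powr p * w)" if t: "t > 0" for t x
  proof -
    \<comment> \<open>The exponent is chosen so that the factor \<open>D\<close> produced by
      inversion turns the integral of \<open>k\<close> into \<open>w\<close>.\<close>
    define k where "k z = ennreal (norm (f z) * D z powr (- (1 / p)))" for z
    have [measurable]: "k \<in> borel_measurable borel" unfolding k_def by measurable
    have kD: "k z * ennreal (D z) = Fw z" for z
    proof -
      have "D z powr (- (1 / p)) * D z powr 1 = D z powr (1 / q)" 
        by (subst powr_add[symmetric], rule arg_cong[of _ _ "(powr) _"]) (use pq in linarith)
      then have "D z powr (- (1 / p)) * D z = D z powr (1 / q)" using D_pos[of z] by simp
      then show ?thesis unfolding k_def Fw_def using D_pos[of z] by (simp add: ennreal_mult[symmetric] mult.assoc less_imp_le)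
    qed
    have pt: "ennreal (p * t powr (p - 1)) * (G y * F z) \<le> Gp y * Fw z + ennreal ((p - 1) * t powr p) * (if G y \<noteq> 0 then k z else 0)" for y z
    proof (cases "g y = 0")
      case True then show ?thesis by (simp add: G_def)
    next
      case False
      define \<gamma> \<phi> \<delta> where "\<gamma> = norm (g y)" and "\<phi> = norm (f z)" and "\<delta> = D z"
      have pos: "\<gamma> > 0" "\<phi> \<ge> 0" "\<delta> > 0" using False D_pos by (auto simp: \<gamma>_def \<phi>_def \<delta>_def)
      \<comment> \<open>The factor \<open>\<delta> powr (1 / p)\<close> becomes
        \<open>\<delta>\<close> in the p-th power. Multiplication by
        \<open>\<phi> * \<delta> powr (- (1 / p))\<close> then cancels it on the left and leaves the
        weights of \<open>Fw\<close> and \<open>k\<close> on the right.\<close>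
      have "p * t powr (p - 1) * (\<gamma> * \<delta> powr (1 / p)) \<le> (\<gamma> * \<delta> powr (1 / p)) powr p + (p - 1) * t powr p"
        using pos t by (intro young_tangent[OF p]) auto
      also have "(\<gamma> * \<delta> powr (1 / p)) powr p = \<gamma> powr p * \<delta>"
        using pos p by (simp add: powr_mult powr_powr)
      finally have "p * t powr (p - 1) * (\<gamma> * \<delta> powr (1 / p)) * (\<phi> * \<delta> powr (- (1 / p))) \<le> (\<gamma> powr p * \<delta> + (p - 1) * t powr p) * (\<phi> * \<delta> powr (- (1 / p)))"
        using pos by (intro mult_right_mono) auto
      moreover have "\<delta> powr (1 / p) * \<delta> powr (- (1 / p)) = 1" using pos by (simp add: powr_add[symmetric])
      then have "p * t powr (p - 1) * (\<gamma> * \<delta> powr (1 / p)) * (\<phi> * \<delta> powr (- (1 / p))) = p * t powr (p - 1) * (\<gamma> * \<phi>)"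
        by (metis (no_types, opaque_lifting) mult.assoc mult.commute mult.right_neutral)
      moreover have "\<delta> * \<delta> powr (- (1 / p)) = \<delta> powr (1 / q)"
      proof -
        have "\<delta> powr 1 * \<delta> powr (- (1 / p)) = \<delta> powr (1 / q)" 
        by (subst powr_add[symmetric], rule arg_cong[of _ _ "(powr) _"]) (use pq in linarith)
        then show ?thesis using pos by simp
      qed
      then have "(\<gamma> powr p * \<delta> + (p - 1) * t powr p) * (\<phi> * \<delta> powr (- (1 / p))) = \<gamma> powr p * (\<phi> * \<delta> powr (1 / q)) + (p - 1) * t powr p * (\<phi> * \<delta> powr (- (1 / p)))"
        by (simp add: algebra_simps)
      ultimately have "p * t powr (p - 1) * (\<gamma> * \<phi>) \<le> \<gamma> powr p * (\<phi> * \<delta> powr (1 / q)) + (p - 1) * t powr p * (\<phi> * \<delta> powr (- (1 / p)))"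
        by simp
      then have "ennreal (p * t powr (p - 1) * (\<gamma> * \<phi>)) \<le> ennreal (\<gamma> powr p * (\<phi> * \<delta> powr (1 / q)) + (p - 1) * t powr p * (\<phi> * \<delta> powr (- (1 / p))))"
        by (rule ennreal_leI)
      then show ?thesis using pos p False unfolding G_def F_def Gp_def Fw_def k_def \<gamma>_def[symmetric] \<phi>_def[symmetric] \<delta>_def[symmetric]
        by (simp add: ennreal_mult ennreal_plus)
    qed
    have [measurable]: "Measurable.pred borel (\<lambda>y. G y \<noteq> 0)" by measurable
    have "ennreal (p * t powr (p - 1)) * N x = (\<integral>\<^sup>+y. ennreal (p * t powr (p - 1)) * (G y * F (- y + x)) \<partial>M)"
      unfolding N_def conv_nn_def by (subst nn_integral_cmult) auto
    also have "\<dots> \<le> (\<integral>\<^sup>+y. Gp y * Fw (- y + x) + ennreal ((p - 1) * t powr p) * (if G y \<noteq> 0 then k (- y + x) else 0) \<partial>M)"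
      by (intro nn_integral_mono pt)
    also have "\<dots> = A x + ennreal ((p - 1) * t powr p) * (\<integral>\<^sup>+y. (if G y \<noteq> 0 then k (- y + x) else 0) \<partial>M)"
      unfolding A_def conv_nn_def by (subst nn_integral_add) (auto simp: nn_integral_cmult)
    also have "\<dots> \<le> A x + ennreal ((p - 1) * t powr p) * (\<integral>\<^sup>+y. k y * ennreal (D y) \<partial>M)"
      by (intro add_left_mono mult_left_mono nn_integral_inverse_translate_le s) auto
    also have "\<dots> = A x + ennreal ((p - 1) * t powr p * w)"
      using p w0 by (simp add: kD Fwi ennreal_mult)
    finally show ?thesis .
  qed
  have main: "N x < \<infinity> \<and> enn2real (N x) powr p \<le> w powr (p - 1) * enn2real (A x)" if Ax: "A x < \<infinity>" for x
  proof
    obtain \<alpha> where \<alpha>: "A x = ennreal \<alpha>" "0 \<le> \<alpha>" using Ax by (cases "A x") auto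
    have "ennreal (p * 1 powr (p - 1)) * N x \<le> ennreal \<alpha> + ennreal ((p - 1) * 1 powr p * w)"
      using tangent[of 1 x] \<alpha> by simp
    also have "\<dots> < \<infinity>" by (simp add: less_top)
    finally show fin: "N x < \<infinity>" using p by (auto simp: ennreal_mult_less_top)
    then obtain n where n: "N x = ennreal n" "0 \<le> n" by (cases "N x") auto
    have real: "p * t powr (p - 1) * n \<le> \<alpha> + (p - 1) * t powr p * w" if t: "t > 0" for t
    proof -
      have "ennreal (p * t powr (p - 1) * n) \<le> ennreal (\<alpha> + (p - 1) * t powr p * w)"
        using tangent[OF t, of x] n \<alpha> p w0 by (simp add: ennreal_mult ennreal_plus)
      then show ?thesis using \<alpha> p w0 by (subst (asm) ennreal_le_iff) auto
    qed
    have "n powr p \<le> w powr (p - 1) * \<alpha>"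
    proof (cases "n = 0")
      case True then show ?thesis using \<alpha> by simp
    next
      case False
      then have n0: "n > 0" using n by simp
      have w1: "w \<noteq> 0"
      proof
        assume w: "w = 0"
        \<comment> \<open>If \<open>w = 0\<close>, then
          \<open>p * t powr (p - 1) * n \<le> \<alpha>\<close> for every \<open>t\<close>; this
          \<open>t\<close> makes the left side \<open>\<alpha> + 1\<close>.\<close>
        define t where "t = ((\<alpha> + 1) / (p * n)) powr (1 / (p - 1))"
        have "t > 0" using \<alpha> n0 p by (simp add: t_def)
        moreover have "t powr (p - 1) = (\<alpha> + 1) / (p * n)" using \<alpha> n0 p by (simp add: t_def powr_powr)
        ultimately have "p * ((\<alpha> + 1) / (p * n)) * n \<le> \<alpha>" using real[of t] w by simp
        then show False using n0 p by simp
      qed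
      \<comment> \<open>The value at which the tangent inequality is sharpest; there
        \<open>t powr p * w = t powr (p - 1) * n\<close>, so the two terms with \<open>n\<close>
        combine.\<close>
      define t where "t = n / w"
      have w2: "w > 0" using w1 w0 by simp
      have t: "t > 0" using n0 w2 by (simp add: t_def)
      have tw: "t powr p * w = t powr (p - 1) * n"
      proof -
        have "t powr p = t powr (p - 1) * t powr 1" unfolding powr_add[symmetric] by simp
        then show ?thesis using t w2 n0 by (simp add: t_def)
      qed
      have "p * (t powr (p - 1) * n) \<le> \<alpha> + (p - 1) * (t powr (p - 1) * n)"
        using real[OF t] unfolding mult.assoc tw .
      then have "t powr (p - 1) * n \<le> \<alpha>" by (simp add: algebra_simps)
      then have "w powr (p - 1) * (t powr (p - 1) * n) \<le> w powr (p - 1) * \<alpha>" by (intro mult_left_mono) auto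
      moreover have "w powr (p - 1) * (t powr (p - 1) * n) = (w * t) powr (p - 1) * n powr 1"
        using t w2 n0 by (simp add: powr_mult)
      moreover have "(w * t) powr (p - 1) * n powr 1 = n powr p"
      proof -
        have "w * t = n" using w2 by (simp add: t_def)
        then show ?thesis by (simp only: powr_add[symmetric]) simp
      qed
      ultimately show ?thesis by simp
    qed
    then show "enn2real (N x) powr p \<le> w powr (p - 1) * enn2real (A x)" using n \<alpha> by simp
  qed
  show ex: "conv_exists M g f" unfolding conv_exists_def
    using A_fin
  proof eventually_elim
    case (elim x)
    have "N x < \<infinity>" using main[OF elim] by simp
    then show ?case by (simp add: integrable_conv_iff N_def G_def[abs_def] F_def[abs_def])
  qed
  have cm[measurable]: "conv M g f \<in> borel_measurable borel" by (rule borel_measurable_conv[OF gm gs fm fs fn])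
  have normle: "norm (conv M g f x) \<le> enn2real (N x)" if "N x < \<infinity>" for x
  proof -
    have i: "integrable M (\<lambda>y. g y * f (- y + x))" using that by (simp add: integrable_conv_iff N_def G_def[abs_def] F_def[abs_def])
    have "ennreal (norm (conv M g f x)) \<le> (\<integral>\<^sup>+y. ennreal (norm (g y * f (- y + x))) \<partial>M)"
      unfolding conv_def by (rule integral_norm_bound_ennreal[OF i])
    also have "\<dots> = N x" unfolding N_def conv_nn_def G_def F_def by (simp add: norm_mult ennreal_mult)
    finally have "ennreal (norm (conv M g f x)) \<le> N x" .
    then show ?thesis using that by (cases "N x") auto
  qed
  have Aint: "integrable M (\<lambda>x. enn2real (A x))" "(\<integral>x. enn2real (A x) \<partial>M) = a * w"
  proof -
    have e: "(\<integral>\<^sup>+x. ennreal (enn2real (A x)) \<partial>M) = ennreal (a * w)"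
      unfolding Ai[symmetric] using A_fin by (intro nn_integral_cong_AE) (auto elim!: eventually_mono)
    then show "integrable M (\<lambda>x. enn2real (A x))" by (intro integrableI_nonneg) auto
    show "(\<integral>x. enn2real (A x) \<partial>M) = a * w"
      using e a0 w0 by (subst integral_eq_nn_integral) auto
  qed
  have AEb: "AE x in M. norm (conv M g f x) powr p \<le> w powr (p - 1) * enn2real (A x)"
    using A_fin
  proof eventually_elim
    case (elim x)
    have "norm (conv M g f x) powr p \<le> enn2real (N x) powr p"
      using normle[of x] main[OF elim] p by (intro powr_mono2) auto
    then show ?case using main[OF elim] by simp
  qed
  have ci: "integrable M (\<lambda>x. norm (conv M g f x) powr p)"
  proof (rule Bochner_Integration.integrable_bound)
    show "integrable M (\<lambda>x. w powr (p - 1) * enn2real (A x))" using Aint by simp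
    show "AE x in M. norm (norm (conv M g f x) powr p) \<le> norm (w powr (p - 1) * enn2real (A x))"
      using AEb by (auto elim!: eventually_mono)
  qed simp
  then show "conv M g f \<in> Lp M p" using cm by (simp add: Lp_def)
  have "(\<integral>x. norm (conv M g f x) powr p \<partial>M) \<le> (\<integral>x. w powr (p - 1) * enn2real (A x) \<partial>M)"
    using Aint AEb by (intro integral_mono_AE ci) auto
  also have "\<dots> = (w powr (p - 1) * w) * a" using Aint by simp
  also have "w powr (p - 1) * w = w powr p"
    using w0 powr_mult_base[of w "p - 1"] by (cases "w = 0") (auto simp: mult.commute)
  finally show "(\<integral>x. norm (conv M g f x) powr p \<partial>M) \<le> w powr p * (\<integral>x. norm (g x) powr p \<partial>M)" by (simp add: a_def)
qed

section \<open>Comparison of the weighted space with the bounded convolvers\<close>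

lemma L1_weighted_omega_iff:
  "f \<in> L1_weighted M (omega M q) \<longleftrightarrow> f \<in> borel_measurable borel \<and> integrable M (\<lambda>x. norm (f x) * D x powr (1 / q))"
proof -
  have "norm (f x * complex_of_real (omega M q x)) powr 1 = norm (f x) * D x powr (1 / q)" for x
    by (simp add: norm_mult omega_eq)
  then show ?thesis unfolding L1_weighted_def Lp_def by (auto simp: omega_eq[abs_def])
qed

lemma weighted_subset_LpT:
  assumes f: "f \<in> L1_weighted M (omega M q)" "f \<in> Lp M p" and fn: "AE x in M. f x \<in> \<real>\<^sub>\<ge>\<^sub>0"
    and p: "1 < p" and pq: "1 / p + 1 / q = 1"
  shows "f \<in> LpT M p"
proof -
  have fw: "integrable M (\<lambda>x. norm (f x) * D x powr (1 / q))" using f by (simp add: L1_weighted_omega_iff)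
  define w where "w = (\<integral>x. norm (f x) * D x powr (1 / q) \<partial>M)"
  have w0: "0 \<le> w" unfolding w_def by simp
  note y = young_convolution[OF _ f(2) fn p pq fw, folded w_def]
  have "T_norm M p f \<le> ennreal w" unfolding T_norm_def
  proof (rule SUP_least)
    fix g assume "g \<in> {g \<in> Lp M p. Lp_norm M p g \<le> 1}"
    then have g: "g \<in> Lp M p" "Lp_norm M p g \<le> 1" by auto
    define a where "a = (\<integral>x. norm (g x) powr p \<partial>M)"
    have a0: "0 \<le> a" unfolding a_def by simp
    have "a powr (1 / p) \<le> 1" using g by (simp add: Lp_norm_def a_def ennreal_le_1)
    then have "(a powr (1 / p)) powr p \<le> 1 powr p" using p by (intro powr_mono2) auto
    then have a1: "a \<le> 1" using p a0 by (simp add: powr_powr)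
    have "(\<integral>x. norm (conv M g f x) powr p \<partial>M) \<le> w powr p * 1"
      using y(3)[OF g(1)] mult_left_mono[OF a1, of "w powr p"] by (simp add: a_def)
    then have "(\<integral>x. norm (conv M g f x) powr p \<partial>M) powr (1 / p) \<le> (w powr p * 1) powr (1 / p)"
      using p by (intro powr_mono2) auto
    also have "\<dots> = w" using p w0 by (simp add: powr_powr)
    finally show "Lp_norm M p (conv M g f) \<le> ennreal w"
      using y(2)[OF g(1)] by (simp add: Lp_norm_def ennreal_leI)
  qed
  also have "ennreal w < \<infinity>" by simp
  finally show ?thesis using f y(1) by (simp add: LpT_def)
qed

text \<open>\<open>T_norm\<close> tests only the unit ball, so \<open>g\<close> is scaled to norm
  one; this is why its p-th power integral must be positive.\<close>

lemma T_norm_bound: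
  assumes f: "f \<in> LpT M p" and p: "1 < p" and g: "g \<in> Lp M p" and a: "(\<integral>x. norm (g x) powr p \<partial>M) > 0"
  shows "integrable M (\<lambda>x. norm (conv M g f x) powr p)"
    "(\<integral>x. norm (conv M g f x) powr p \<partial>M) \<le> enn2real (T_norm M p f) powr p * (\<integral>x. norm (g x) powr p \<partial>M)"
proof -
  define C where "C = enn2real (T_norm M p f)"
  have C: "T_norm M p f = ennreal C" "0 \<le> C" using f by (auto simp: LpT_def C_def less_top)
  define a where "a = (\<integral>x. norm (g x) powr p \<partial>M)"
  have a0: "a > 0" using assms by (simp add: a_def)
  define c where "c = a powr (- (1 / p))"
  have c: "c > 0" using a0 by (simp add: c_def)
  have cp: "c powr p * a = 1" 
  proof -
    have "c powr p = a powr (- 1)" using p by (simp add: c_def powr_powr)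
    then show ?thesis using a0 by (simp add: powr_minus)
  qed
  define h where "h x = complex_of_real c * g x" for x
  have hn: "norm (h x) powr p = c powr p * norm (g x) powr p" for x
    using c by (simp add: h_def norm_mult powr_mult)
  have [measurable]: "g \<in> borel_measurable borel" by (rule Lp_borel[OF g])
  have h: "h \<in> Lp M p" using Lp_integrable[OF g] unfolding Lp_def by (auto simp: hn) (simp add: h_def[abs_def])
  have "(\<integral>x. norm (h x) powr p \<partial>M) = 1" unfolding hn using cp by (simp add: a_def)
  then have "Lp_norm M p h \<le> 1" using h by (simp add: Lp_norm_def)
  then have "Lp_norm M p (conv M h f) \<le> T_norm M p f"
    unfolding T_norm_def using h by (intro SUP_upper) auto
  then have le: "Lp_norm M p (conv M h f) \<le> ennreal C" by (simp add: C)
  then have hc: "conv M h f \<in> Lp M p" unfolding Lp_norm_def by (auto split: if_splits simp: top_unique)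
  have ch: "conv M h f x = complex_of_real c * conv M g f x" for x
    unfolding conv_def h_def by (simp add: mult.assoc)
  have chn: "norm (conv M h f x) powr p = c powr p * norm (conv M g f x) powr p" for x
    using c by (simp add: ch norm_mult powr_mult)
  have i: "integrable M (\<lambda>x. c powr p * norm (conv M g f x) powr p)"
    using Lp_integrable[OF hc] by (simp add: chn)
  have "integrable M (\<lambda>x. 1 / c powr p * (c powr p * norm (conv M g f x) powr p))"
    by (intro integrable_mult_right i)
  then show "integrable M (\<lambda>x. norm (conv M g f x) powr p)" using c by simp
  define b where "b = (\<integral>x. norm (conv M g f x) powr p \<partial>M)"
  have b0: "b \<ge> 0" unfolding b_def by simp
  have "ennreal ((c powr p * b) powr (1 / p)) \<le> ennreal C"
    using le hc by (simp add: Lp_norm_def chn b_def)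
  then have "(c powr p * b) powr (1 / p) \<le> C" using C by simp
  then have "((c powr p * b) powr (1 / p)) powr p \<le> C powr p" using p by (intro powr_mono2) auto
  then have "c powr p * b \<le> C powr p" using p b0 by (simp add: powr_powr)
  then have "(c powr p * b) * a \<le> C powr p * a" using a0 by (intro mult_right_mono) auto
  moreover have "(c powr p * b) * a = (c powr p * a) * b" by simp
  ultimately have "b \<le> C powr p * a" by (simp only: cp mult_1)
  then show "(\<integral>x. norm (conv M g f x) powr p \<partial>M) \<le> enn2real (T_norm M p f) powr p * (\<integral>x. norm (g x) powr p \<partial>M)"
    by (simp add: a_def b_def C_def)
qed

text \<open>If the integral \<open>cr\<close> exceeded the norm \<open>C\<close>, then
  \<open>h * D powr (1 / q) / cr\<close> would be the density of a probability measure of compact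
  support. The norm-preserving map from \<open>F\<close> to \<open>u\<close> turns convolution by
  \<open>h\<close> into \<open>cr\<close> times averaging by this measure, so averaging would shrink
  p-th power integrals by \<open>(C / cr) powr p < 1\<close>, which amenability excludes.\<close>

lemma bounded_compact_part_le_T_norm:
  assumes am: "amenable M" and f: "f \<in> LpT M p" and fn: "AE x in M. f x \<in> \<real>\<^sub>\<ge>\<^sub>0"
    and p: "1 < p" and pq: "1 / p + 1 / q = 1"
    and h[measurable]: "h \<in> borel_measurable borel" and h0: "\<And>x. 0 \<le> h x" and hf: "\<And>x. h x \<le> norm (f x)"
    and K: "compact K" "\<And>x. x \<notin> K \<Longrightarrow> h x = 0" and hB: "\<And>x. h x \<le> B"
  shows "(\<integral>\<^sup>+x. ennreal (h x * D x powr (1 / q)) \<partial>M) \<le> T_norm M p f"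
proof (rule ccontr)
  define C where "C = enn2real (T_norm M p f)"
  have C: "T_norm M p f = ennreal C" "0 \<le> C" using f by (auto simp: LpT_def C_def less_top)
  have fm[measurable]: "f \<in> borel_measurable borel" using f by (simp add: LpT_def Lp_def)
  assume neg: "\<not> ?thesis"
  have Kb[measurable]: "K \<in> sets borel" using borel_compact[OF K(1)] .
  have cDq: "continuous_on UNIV (\<lambda>x. D x powr s)" for s
    using continuous_D D_pos by (intro continuous_on_powr) (auto simp: less_imp_neq[THEN not_sym])
  obtain E where E: "\<And>x. x \<in> K \<Longrightarrow> D x powr (1 / q) \<le> E" "E \<ge> 0"
  proof -
    have "compact ((\<lambda>x. D x powr (1 / q)) ` K)" using K(1) cDq by (meson compact_continuous_image continuous_on_subset subset_UNIV)
    then obtain b where "\<And>y. y \<in> (\<lambda>x. D x powr (1 / q)) ` K \<Longrightarrow> norm y \<le> b" using compact_imp_bounded bounded_iff by metis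
    then have "D x powr (1 / q) \<le> max b 0" if "x \<in> K" for x using that by fastforce
    then show thesis by (intro that[of "max b 0"]) auto
  qed
  have B0: "B \<ge> 0" using h0 hB order_trans by blast
  define c where "c = (\<integral>\<^sup>+x. ennreal (h x * D x powr (1 / q)) \<partial>M)"
  have "c \<le> (\<integral>\<^sup>+x. ennreal (B * E) * indicator K x \<partial>M)" unfolding c_def
  proof (rule nn_integral_mono)
    fix x
    show "ennreal (h x * D x powr (1 / q)) \<le> ennreal (B * E) * indicator K x"
      using K(2)[of x] E(1)[of x] hB[of x] h0[of x] B0 E(2) by (cases "x \<in> K") (auto intro!: ennreal_leI mult_mono)
  qed
  also have "\<dots> = ennreal (B * E) * emeasure M K" by (simp add: nn_integral_cmult_indicator)
  also have "\<dots> < \<infinity>" using emeasure_compact[OF K(1)] by (simp add: ennreal_mult_less_top)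
  finally obtain cr where cr: "c = ennreal cr" "0 \<le> cr" by (cases c) auto
  have cC: "C < cr" using neg cr C by (simp add: c_def[symmetric] not_le ennreal_less_iff)
  then have cr0: "cr > 0" using C by simp
  define dn where "dn x = h x * D x powr (1 / q) / cr" for x
  have [measurable]: "dn \<in> borel_measurable borel" unfolding dn_def by measurable
  have dn0: "0 \<le> dn x" for x unfolding dn_def using h0 cr0 by simp
  define \<mu> where "\<mu> = density M dn"
  have "compact_prob \<mu> K"
  proof
    show "sets \<mu> = sets borel" by (simp add: \<mu>_def)
    have "emeasure \<mu> UNIV = (\<integral>\<^sup>+x. ennreal (1 / cr) * ennreal (h x * D x powr (1 / q)) \<partial>M)"
      unfolding \<mu>_def dn_def using cr0 h0 by (subst emeasure_density) (auto simp: ennreal_mult[symmetric])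
    also have "\<dots> = ennreal (1 / cr) * ennreal cr" unfolding cr(1)[symmetric] c_def by (rule nn_integral_cmult) simp
    also have "\<dots> = 1" using cr0 by (simp add: ennreal_mult[symmetric])
    finally show "emeasure \<mu> UNIV = 1" .
    have "0 < dn x \<Longrightarrow> x \<in> K" for x using K(2)[of x] by (cases "x \<in> K") (auto simp: dn_def)
    then show "AE x in \<mu>. x \<in> K" unfolding \<mu>_def by (subst AE_density) auto
  qed (rule K(1))
  then interpret mu: compact_prob \<mu> K .
  define \<rho> where "\<rho> = C powr p / cr powr p"
  have \<rho>: "0 \<le> \<rho>" "\<rho> < 1"
    unfolding \<rho>_def using C cC cr0 powr_less_mono2[of p C cr] p by auto
  have contr: "(\<integral>x. avg \<mu> F x powr p \<partial>M) \<le> \<rho> * (\<integral>x. F x powr p \<partial>M)" if F: "cc F" "\<And>x. 0 \<le> F x" for F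
  proof (cases "\<forall>x. F x = 0")
    case True
    then have "avg \<mu> F x = 0" for x by (simp add: avg_def)
    then show ?thesis using True p by simp
  next
    case False
    then obtain x0 where x0: "F x0 \<noteq> 0" by auto
    have Fm[measurable]: "F \<in> borel_measurable borel" by (rule borel_measurable_cc[OF F(1)])
    have Fp: "cc (\<lambda>x. F x powr p)" using F p by (intro cc_powr) auto
    have Ap: "cc (\<lambda>x. avg \<mu> F x powr p)" using F p by (intro cc_powr mu.cc_avg mu.avg_nonneg) auto
    have inv: "(\<integral>x. G (- x) * D x \<partial>M) = (\<integral>x. G x \<partial>M)" if "cc G" for G
      using integral_uminus[OF cc_translate(3)[OF that]] by simp
    \<comment> \<open>Inversion, with the power of \<open>D\<close> that preserves the integral of
      the p-th power.\<close>
    define u where "u x = F (- x) * D x powr (1 / p)" for x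
    have u: "cc u" unfolding u_def by (intro cc_mult_right cc_translate F cDq)
    have u0: "0 \<le> u x" for x unfolding u_def using F by simp
    have up: "u x powr p = F (- x) powr p * D x" for x
      unfolding u_def using F D_pos[of x] p by (simp add: powr_mult powr_powr)
    have [measurable]: "u \<in> borel_measurable borel" by (rule borel_measurable_cc[OF u])
    have iu: "(\<integral>x. u x powr p \<partial>M) = (\<integral>x. F x powr p \<partial>M)"
      unfolding up by (rule inv[OF Fp])
    have ipos: "(\<integral>x. F x powr p \<partial>M) > 0" by (rule integral_cc_pos[OF Fp, of x0]) (use x0 in auto)
    define g where "g x = complex_of_real (u x)" for x
    have gn: "norm (g x) = u x" for x using u0 by (simp add: g_def)
    have g: "g \<in> Lp M p" unfolding Lp_def gn
      using integrable_Cc[OF cc_powr[OF u u0, of p]] p by (auto simp: g_def[abs_def] abs_of_nonneg[OF u0])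
    note T = T_norm_bound[OF f p g, unfolded gn iu, OF ipos]
    have key: "conv_nn (\<lambda>y. ennreal (u y)) (\<lambda>y. ennreal (h y)) x = ennreal (cr * (D x powr (1 / p) * avg \<mu> F (- x)))" for x
    proof -
      define k where "k s = ennreal (D x powr (1 / p) * (F (s + - x) * D (- s) powr (1 / p) * h s))" for s
      have k0: "k s = 0" if "s \<notin> K" for s using K(2)[OF that] by (simp add: k_def)
      have km[measurable]: "k \<in> borel_measurable borel"
      proof -
        have [measurable]: "(\<lambda>s. F (s + - x)) \<in> borel_measurable borel"
          using measurable_compose[OF borel_measurable_translate(2) Fm] .
        show ?thesis unfolding k_def by measurable
      qed
      \<comment> \<open>The origin of the weight: \<open>D (- s) powr (1 / p)\<close> comes from
        \<open>u\<close>, \<open>D s\<close> from inverting the variable of integration, and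
        \<open>1 - 1 / p = 1 / q\<close>.\<close>
      have Dsplit: "D s powr (1 / q) = D (- s) powr (1 / p) * D s" for s
      proof -
        have "D (- s) powr (1 / p) = D s powr (- (1 / p))" using D_pos[of s] by (simp add: D_uminus powr_divide powr_minus_divide)
        moreover have "D s powr (- (1 / p)) * D s powr 1 = D s powr (1 / q)" 
        by (subst powr_add[symmetric], rule arg_cong[of _ _ "(powr) _"]) (use pq in linarith)
        ultimately show ?thesis using D_pos[of s] by simp
      qed
      have "conv_nn (\<lambda>y. ennreal (u y)) (\<lambda>y. ennreal (h y)) x = (\<integral>\<^sup>+t. ennreal (u (x + t)) * ennreal (h (- (x + t) + x)) \<partial>M)"
        unfolding conv_nn_def by (rule nn_integral_left_translate[symmetric]) measurable
      also have "\<dots> = (\<integral>\<^sup>+t. k (- t) \<partial>M)"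
      proof (rule nn_integral_cong)
        fix t
        have e: "- (x + t) + x = - t" by (simp only: minus_add add.assoc left_minus add_0_right)
        have "u (x + t) = F (- t + - x) * (D x powr (1 / p) * D t powr (1 / p))"
          unfolding u_def D_add minus_add using D_pos[of x] D_pos[of t] by (simp add: powr_mult)
        then show "ennreal (u (x + t)) * ennreal (h (- (x + t) + x)) = k (- t)"
          unfolding e k_def using F h0 by (simp add: ennreal_mult[symmetric] mult_ac)
      qed
      also have "\<dots> = (\<integral>\<^sup>+s. k s * ennreal (D s) \<partial>M)"
        by (rule nn_integral_uminus[OF km K(1) k0])
      also have "\<dots> = (\<integral>\<^sup>+s. ennreal (cr * D x powr (1 / p)) * (ennreal (dn s) * ennreal (F (s + - x))) \<partial>M)"
      proof (rule nn_integral_cong)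
        fix s
        have "D x powr (1 / p) * (F (s + - x) * D (- s) powr (1 / p) * h s) * D s = cr * D x powr (1 / p) * (dn s * F (s + - x))"
          unfolding dn_def Dsplit using cr0 by simp
        then show "k s * ennreal (D s) = ennreal (cr * D x powr (1 / p)) * (ennreal (dn s) * ennreal (F (s + - x)))"
          unfolding k_def using F(2)[of "s + - x"] h0[of s] dn0[of s] D_pos[of s] cr0
          by (simp add: ennreal_mult[symmetric] less_imp_le del: add_uminus_conv_diff)
      qed
      also have "\<dots> = ennreal (cr * D x powr (1 / p)) * (\<integral>\<^sup>+s. ennreal (F (s + - x)) \<partial>\<mu>)"
      proof -
        have [measurable]: "(\<lambda>s. F (s - x)) \<in> borel_measurable borel"
          using measurable_compose[OF borel_measurable_translate(2)[of "- x"] Fm] by simp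
        show ?thesis unfolding \<mu>_def by (subst nn_integral_density) (auto simp: nn_integral_cmult)
      qed
      also have "(\<integral>\<^sup>+s. ennreal (F (s + - x)) \<partial>\<mu>) = ennreal (avg \<mu> F (- x))"
        unfolding avg_def by (rule nn_integral_eq_integral[OF mu.integrable_translate[OF cc_continuous[OF F(1)]]]) (use F in auto)
      finally show ?thesis using cr0 mu.avg_nonneg[of F "- x", OF F(2)] by (simp add: ennreal_mult[symmetric] mult.assoc)
    qed
    \<comment> \<open>As \<open>u\<close> and (almost everywhere) \<open>f\<close> are nonnegative,
      there is no cancellation, and \<open>h x \<le> norm (f x)\<close> makes the convolution with
      \<open>f\<close> dominate the one with \<open>h\<close>.\<close>
    have lower: "AE x in M. cr * (D x powr (1 / p) * avg \<mu> F (- x)) \<le> norm (conv M g f x)"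
    proof -
      have "AE x in M. integrable M (\<lambda>y. g y * f (- y + x))" using f g by (auto simp: LpT_def conv_exists_def)
      then show ?thesis
      proof eventually_elim
        case (elim x)
        have AE: "AE y in M. g y * f (- y + x) = g y * complex_of_real (norm (f (- y + x)))"
          by (rule conv_nonneg_eq[OF sigma_finite_support_Lp[OF g] fn])
        have [measurable]: "g \<in> borel_measurable borel" by (rule Lp_borel[OF g])
        have i: "integrable M (\<lambda>y. u y * norm (f (- y + x)))"
          using integrable_norm[OF elim] u0 by (simp add: norm_mult gn)
        have "conv M g f x = (\<integral>y. complex_of_real (u y * norm (f (- y + x))) \<partial>M)"
          unfolding conv_def using AE by (intro integral_cong_AE) (auto simp: g_def[abs_def])
        then have "norm (conv M g f x) = (\<integral>y. u y * norm (f (- y + x)) \<partial>M)"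
          using u0 by (simp del: of_real_mult)
        then have "ennreal (norm (conv M g f x)) = (\<integral>\<^sup>+y. ennreal (u y * norm (f (- y + x))) \<partial>M)"
          using i u0 by (simp add: nn_integral_eq_integral)
        also have "\<dots> \<ge> conv_nn (\<lambda>y. ennreal (u y)) (\<lambda>y. ennreal (h y)) x"
          unfolding conv_nn_def using u0 h0 hf
          by (intro nn_integral_mono) (auto simp: ennreal_mult[symmetric] intro!: ennreal_leI mult_left_mono)
        finally show ?case unfolding key by simp
      qed
    qed
    have Am: "cc (\<lambda>x. cr powr p * (avg \<mu> F (- x) powr p * D x))"
      by (intro cc_cmult cc_mult_right continuous_D cc_translate(3)[OF Ap])
    have "(\<integral>x. cr powr p * (avg \<mu> F (- x) powr p * D x) \<partial>M) \<le> (\<integral>x. norm (conv M g f x) powr p \<partial>M)"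
    proof (rule integral_mono_AE[OF integrable_Cc[OF Am] T(1)])
      show "AE x in M. cr powr p * (avg \<mu> F (- x) powr p * D x) \<le> norm (conv M g f x) powr p"
        using lower
      proof eventually_elim
        case (elim x)
        have a0: "0 \<le> avg \<mu> F (- x)" by (rule mu.avg_nonneg[OF F(2)])
        have "cr powr p * (avg \<mu> F (- x) powr p * D x) = (cr * (D x powr (1 / p) * avg \<mu> F (- x))) powr p"
          using a0 cr0 D_pos[of x] p by (simp add: powr_mult powr_powr)
        also have "\<dots> \<le> norm (conv M g f x) powr p"
          using elim a0 cr0 p by (intro powr_mono2) auto
        finally show ?case .
      qed
    qed
    also have "\<dots> \<le> C powr p * (\<integral>x. F x powr p \<partial>M)" using T(2) by (simp add: C_def)
    finally have "cr powr p * (\<integral>x. avg \<mu> F x powr p \<partial>M) \<le> C powr p * (\<integral>x. F x powr p \<partial>M)"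
      using inv[OF Ap] by simp
    then show ?thesis unfolding \<rho>_def using cr0 by (simp add: field_simps)
  qed
  have "1 \<le> \<rho>" by (rule amenable_average_norm[OF am mu.compact_prob_axioms p \<rho>(1) contr])
  then show False using \<rho> by simp
qed

text \<open>The bound for bounded parts of compact support is \<open>T_norm M p f\<close> for every
  part, so it passes to \<open>f\<close> by monotone convergence.\<close>

lemma LpT_subset_weighted:
  assumes am: "amenable M" and f: "f \<in> LpT M p" and fn: "AE x in M. f x \<in> \<real>\<^sub>\<ge>\<^sub>0"
    and p: "1 < p" and pq: "1 / p + 1 / q = 1"
  shows "f \<in> L1_weighted M (omega M q)"
proof -
  have fL: "f \<in> Lp M p" and T: "T_norm M p f < \<infinity>" using f by (auto simp: LpT_def)
  note fm[measurable] = Lp_borel[OF fL]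
  obtain K where K: "\<And>n::nat. compact (K n)" "incseq K" "AE x in M. f x \<noteq> 0 \<longrightarrow> x \<in> (\<Union>n. K n)"
    using sigma_finite_support_compacts[OF sigma_finite_support_Lp[OF fL]] by blast
  have [measurable]: "K n \<in> sets borel" for n using K borel_compact by blast
  define h where "h n x = min (norm (f x)) (real n) * indicator (K n) x" for n x
  have hm[measurable]: "h n \<in> borel_measurable borel" for n unfolding h_def by measurable
  have h0: "0 \<le> h n x" for n x by (simp add: h_def)
  have inc: "incseq (\<lambda>n x. ennreal (h n x * D x powr (1 / q)))"
  proof (intro incseq_SucI le_funI ennreal_leI mult_right_mono)
    fix n x
    have "K n \<subseteq> K (Suc n)" using K(2) by (rule incseq_SucD)
    then show "h n x \<le> h (Suc n) x" by (auto simp: h_def indicator_def)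
  qed simp
  have "AE x in M. ennreal (norm (f x) * D x powr (1 / q)) \<le> (SUP n. ennreal (h n x * D x powr (1 / q)))"
    using K(3)
  proof eventually_elim
    case (elim x)
    show ?case
    proof (cases "f x = 0")
      case False
      then obtain m where m: "x \<in> K m" using elim by auto
      obtain n where n: "norm (f x) \<le> real n" using real_arch_simple by blast
      have "x \<in> K (max m n)" using m incseqD[OF K(2), of m "max m n"] by auto
      then have "h (max m n) x = norm (f x)" using n by (simp add: h_def)
      then show ?thesis by (intro SUP_upper2[of "max m n"]) auto
    qed simp
  qed
  then have "(\<integral>\<^sup>+x. ennreal (norm (f x) * D x powr (1 / q)) \<partial>M) \<le> (\<integral>\<^sup>+x. (SUP n. ennreal (h n x * D x powr (1 / q))) \<partial>M)"
    by (rule nn_integral_mono_AE)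
  also have "\<dots> = (SUP n. \<integral>\<^sup>+x. ennreal (h n x * D x powr (1 / q)) \<partial>M)"
    by (rule nn_integral_monotone_convergence_SUP[OF inc]) simp
  also have "\<dots> \<le> T_norm M p f"
  proof (rule SUP_least)
    fix n
    show "(\<integral>\<^sup>+x. ennreal (h n x * D x powr (1 / q)) \<partial>M) \<le> T_norm M p f"
      by (rule bounded_compact_part_le_T_norm[OF am f fn p pq hm h0 _ K(1)[of n], of n "real n"])
        (auto simp: h_def indicator_def)
  qed
  finally have fin: "(\<integral>\<^sup>+x. ennreal (norm (f x) * D x powr (1 / q)) \<partial>M) < \<infinity>" using T by (rule le_less_trans)
  have "integrable M (\<lambda>x. norm (f x) * D x powr (1 / q))"
    using fin by (intro integrableI_nonneg) auto
  then show ?thesis using fm by (simp add: L1_weighted_omega_iff)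
qed

end

theorem theorem3p4:
  fixes M :: "'a::{topological_group_add, t2_space} measure" and p q :: real
  assumes "locally_compact_space (euclidean :: 'a topology)"
    and "left_haar_measure M"
    and "amenable M"
    and "1 < p" and "1 / p + 1 / q = 1"
  shows "L1_weighted M (omega M q) \<inter> nonneg_part M (Lp M p) = nonneg_part M (LpT M p)"
proof -
  interpret haar M by unfold_locales (fact assms(1,2))+
  have "LpT M p \<subseteq> Lp M p" by (auto simp: LpT_def)
  then show ?thesis
    using weighted_subset_LpT[OF _ _ _ assms(4,5)] LpT_subset_weighted[OF assms(3) _ _ assms(4,5)]
    by (auto simp: nonneg_part_def)
qed

end
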